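(* Let $V:\mathsf Z\to[e,\infty)$ be measurable and let $Q$ be a Markov kernel on $(\mathsf Z,\mathcal Z)$ satisfying the $V$-uniform geometric ergodicity assumption (VGE) with invariant distribution $\pi$ and constants $\tau,\varkappa$. Let $p\ge2$, $C_1=60e$, $C_2=60$, and $$D_1=\tfrac83\left(\tfrac{16}{3}\right)^{1/2}C_1^2\left(C_2^{1/2}+1\right),\qquad D_2=\tfrac{8e}{3}\left(\sqrt2\,C_1^2C_2^{1/2}+C_2\right).$$ Then for every measurable $f:\mathsf Z\to\mathbb R$ with $\|f\|_{V^{1/(2p)}}<\infty$ and every integer $n\ge3$, $$\mathrm E_\pi^{1/p}\left[|S_n|^p\right]\le C_1\sqrt2\,p^{1/2}n^{1/2}\sigma_\pi(f)+4D_1\{\varkappa\pi(V)\}^{2/p}p^2\log_2(2p)\,n^{1/4}\tau^{3/4}\|f\|_{V^{1/(2p)}}$$ $$\qquad+4D_2\{\varkappa\pi(V)\}^{1/p}p^2\log_2(2p)\,n^{1/p}\,\tau\,\|f\|_{V^{1/(2p)}}.$$ Moreover, for every initial probability measure $\xi$ on $(\mathsf Z,\mathcal Z)$, $$\mathrm E_\xi^{1/p}\left[|S_n|^p\right]\le\mathrm E_\pi^{1/p}\left[|S_n|^p\right]+\tfrac{32}{15}\varkappa^{1/p}\left(\xi(V)+\pi(V)\right)^{1/p}p\,\tau\,\|f\|_{V^{1/(2p)}}.$$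
   Context: $(Z_k)_{k\ge0}$ is the (canonical) Markov chain with kernel $Q$; $\mathrm E_\xi$ is expectation when $Z_0\sim\xi$, and $\mathrm E_\xi^{1/p}[\cdot]=(\mathrm E_\xi[\cdot])^{1/p}$. For a measurable weight $W\ge1$: $\|f\|_W=\sup_z|f(z)|/W(z)$ for functions, and $\|\mu\|_W=\int W\,d|\mu|$ for signed measures. Assumption (VGE): $Q$ has a unique invariant distribution $\pi$, $\pi(V)<\infty$, and there are an integer $\tau\ge1$ and $\varkappa\ge1$ such that for every integer $n\ge0$, $$\sup_{z,z'\in\mathsf Z}\frac{\|\delta_zQ^n-\delta_{z'}Q^n\|_V}{V(z)+V(z')}\le\varkappa(1/4)^{\lfloor n/\tau\rfloor}.$$ $\bar f=f-\pi(f)$, $S_n=\sum_{\ell=0}^{n-1}\{f(Z_\ell)-\pi(f)\}$, $\sigma_\pi^2(f)=\pi(\bar f^2)+2\sum_{\ell=1}^\infty\pi(\bar f\,Q^\ell\bar f)$. *)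

theory Defs
  imports "HOL-Probability.Probability"
begin

section \<open>Weighted norms\<close>

text \<open>Powers of extended nonnegative reals; only used with exponents \<open>a > 0\<close>.\<close>

definition ennreal_powr :: "ennreal \<Rightarrow> real \<Rightarrow> ennreal" where
  "ennreal_powr x a = (if x = \<top> then \<top> else ennreal (enn2real x powr a))"

definition fun_norm :: "'a measure \<Rightarrow> ('a \<Rightarrow> real) \<Rightarrow> ('a \<Rightarrow> real) \<Rightarrow> ennreal" where
  "fun_norm M W f = (SUP z\<in>space M. ennreal (\<bar>f z\<bar> / W z))"

text \<open>
  A signed measure on \<open>M\<close> is a real set function \<open>\<mu>\<close> that is countably additive on
  \<open>sets M\<close>; \<open>total_variation M \<mu>\<close> is the positive measure \<open>|\<mu>|\<close>.  The partitions below may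
  contain the empty set, which contributes \<open>0\<close>.
\<close>

definition meas_partitions :: "'a measure \<Rightarrow> 'a set \<Rightarrow> 'a set set set" where
  "meas_partitions M A = {P. finite P \<and> P \<subseteq> sets M \<and> disjoint P \<and> \<Union>P = A}"

definition total_variation :: "'a measure \<Rightarrow> ('a set \<Rightarrow> real) \<Rightarrow> 'a measure" where
  "total_variation M \<mu> = measure_of (space M) (sets M)
     (\<lambda>A. SUP P\<in>meas_partitions M A. \<Sum>B\<in>P. ennreal \<bar>\<mu> B\<bar>)"

definition signed_norm :: "'a measure \<Rightarrow> ('a \<Rightarrow> real) \<Rightarrow> ('a set \<Rightarrow> real) \<Rightarrow> ennreal" where
  "signed_norm M W \<mu> = (\<integral>\<^sup>+ z. ennreal (W z) \<partial>total_variation M \<mu>)"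


section \<open>Markov kernels\<close>

text \<open>A Markov kernel on \<open>M\<close> is an element of \<open>M \<rightarrow>\<^sub>M prob_algebra M\<close>;
  \<open>kernel_pow M Q n z\<close> is \<open>\<delta>\<^sub>z Q\<^sup>n\<close>.\<close>

primrec kernel_pow :: "'a measure \<Rightarrow> ('a \<Rightarrow> 'a measure) \<Rightarrow> nat \<Rightarrow> 'a \<Rightarrow> 'a measure" where
  "kernel_pow M Q 0 z = return M z"
| "kernel_pow M Q (Suc n) z = kernel_pow M Q n z \<bind> Q"

definition invariant_distr :: "'a measure \<Rightarrow> ('a \<Rightarrow> 'a measure) \<Rightarrow> 'a measure \<Rightarrow> bool" where
  "invariant_distr M Q \<pi> \<longleftrightarrow> \<pi> \<in> space (prob_algebra M) \<and> \<pi> \<bind> Q = \<pi>"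

definition VGE ::
  "'a measure \<Rightarrow> ('a \<Rightarrow> 'a measure) \<Rightarrow> ('a \<Rightarrow> real) \<Rightarrow> 'a measure \<Rightarrow> nat \<Rightarrow> real \<Rightarrow> bool" where
  "VGE M Q V \<pi> \<tau> \<kappa> \<longleftrightarrow>
     invariant_distr M Q \<pi> \<and> (\<forall>\<pi>'. invariant_distr M Q \<pi>' \<longrightarrow> \<pi>' = \<pi>) \<and>
     (\<integral>\<^sup>+ z. ennreal (V z) \<partial>\<pi>) < \<infinity> \<and> \<tau> \<ge> 1 \<and> \<kappa> \<ge> 1 \<and>
     (\<forall>n. (SUP (z, z')\<in>space M \<times> space M.
             signed_norm M V
               (\<lambda>A. measure (kernel_pow M Q n z) A - measure (kernel_pow M Q n z') A)
             / ennreal (V z + V z'))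
          \<le> ennreal (\<kappa> * (1/4) ^ (n div \<tau>)))"

text \<open>
  Law of the canonical chain with initial distribution \<open>\<xi>\<close> on the sequence space
  \<open>PiM UNIV (\<lambda>_. M)\<close>, by the Ionescu-Tulcea theorem: given the coordinates \<open>\<omega> 0, \<dots>, \<omega> (n - 1)\<close>,
  coordinate \<open>n\<close> is drawn from \<open>chain_step \<xi> Q n \<omega>\<close>.
\<close>

definition chain_step ::
  "'a measure \<Rightarrow> ('a \<Rightarrow> 'a measure) \<Rightarrow> nat \<Rightarrow> (nat \<Rightarrow> 'a) \<Rightarrow> 'a measure" where
  "chain_step \<xi> Q n \<omega> = (case n of 0 \<Rightarrow> \<xi> | Suc i \<Rightarrow> Q (\<omega> i))"

definition chain_law ::
  "'a measure \<Rightarrow> ('a \<Rightarrow> 'a measure) \<Rightarrow> 'a measure \<Rightarrow> (nat \<Rightarrow> 'a) measure" where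
  "chain_law M Q \<xi> =
     projective_family.lim UNIV (Ionescu_Tulcea.CI (chain_step \<xi> Q) (\<lambda>_. M)) (\<lambda>_. M)"

definition centered :: "'a measure \<Rightarrow> ('a \<Rightarrow> real) \<Rightarrow> 'a \<Rightarrow> real" where
  "centered \<pi> f z = f z - (\<integral>x. f x \<partial>\<pi>)"

definition chain_sum :: "'a measure \<Rightarrow> ('a \<Rightarrow> real) \<Rightarrow> nat \<Rightarrow> (nat \<Rightarrow> 'a) \<Rightarrow> real" where
  "chain_sum \<pi> f n \<omega> = (\<Sum>l<n. centered \<pi> f (\<omega> l))"

text \<open>\<open>E\<^sub>\<xi>[|S\<^sub>n|\<^sup>p]\<^sup>1\<^sup>/\<^sup>p\<close>, possibly infinite.\<close>

definition chain_moment ::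
  "'a measure \<Rightarrow> ('a \<Rightarrow> 'a measure) \<Rightarrow> 'a measure \<Rightarrow> 'a measure \<Rightarrow> ('a \<Rightarrow> real) \<Rightarrow> nat \<Rightarrow> real \<Rightarrow> ennreal"
  where
  "chain_moment M Q \<xi> \<pi> f n p =
     ennreal_powr (\<integral>\<^sup>+ \<omega>. ennreal (\<bar>chain_sum \<pi> f n \<omega>\<bar> powr p) \<partial>chain_law M Q \<xi>) (1 / p)"

definition asymp_var :: "'a measure \<Rightarrow> ('a \<Rightarrow> 'a measure) \<Rightarrow> 'a measure \<Rightarrow> ('a \<Rightarrow> real) \<Rightarrow> real" where
  "asymp_var M Q \<pi> f =
     (\<integral>z. (centered \<pi> f z)\<^sup>2 \<partial>\<pi>) +
     2 * (\<Sum>l. \<integral>z. centered \<pi> f z * (\<integral>y. centered \<pi> f y \<partial>kernel_pow M Q (Suc l) z) \<partial>\<pi>)"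


section \<open>Constants\<close>

definition C1 :: real where "C1 = 60 * exp 1"
definition C2 :: real where "C2 = 60"

definition D1 :: real where
  "D1 = 8/3 * sqrt (16/3) * C1\<^sup>2 * (sqrt C2 + 1)"

definition D2 :: real where
  "D2 = 8 * exp 1 / 3 * (sqrt 2 * C1\<^sup>2 * sqrt C2 + C2)"


section \<open>Sanity checks\<close>

lemma emeasure_total_variation:
  assumes sums: "\<And>A. range A \<subseteq> sets M \<Longrightarrow> disjoint_family A \<Longrightarrow> (\<lambda>i. \<mu> (A i)) sums \<mu> (\<Union>i. A i)"
    and empty: "\<mu> {} = 0"
    and X: "X \<in> sets M"
  shows "emeasure (total_variation M \<mu>) X =
    (SUP P\<in>meas_partitions M X. \<Sum>B\<in>P. ennreal \<bar>\<mu> B\<bar>)"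
proof -
  define T where "T A = (SUP P\<in>meas_partitions M A. \<Sum>B\<in>P. ennreal \<bar>\<mu> B\<bar>)" for A
  have ne: "meas_partitions M A \<noteq> {}" if "A \<in> sets M" for A
    using that by (auto simp: meas_partitions_def intro!: exI[of _ "{A}"])
  have T_empty: "T {} = 0"
  proof -
    have "(\<Sum>B\<in>P. ennreal \<bar>\<mu> B\<bar>) = 0" if "P \<in> meas_partitions M {}" for P
      using that empty by (intro sum.neutral) (auto simp: meas_partitions_def)
    then show ?thesis
      using ne[of "{}"] by (simp add: T_def)
  qed
  have super: "T A + T B \<le> T (A \<union> B)" if "A \<in> sets M" "B \<in> sets M" "A \<inter> B = {}" for A B
  proof -
    have le: "(\<Sum>B\<in>P. ennreal \<bar>\<mu> B\<bar>) + (\<Sum>B\<in>R. ennreal \<bar>\<mu> B\<bar>) \<le> T (A \<union> B)"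
      if P: "P \<in> meas_partitions M A" and R: "R \<in> meas_partitions M B" for P R
    proof -
      have "X \<inter> Y = {}" if "X \<in> P" "Y \<in> R" for X Y
        using P R that \<open>A \<inter> B = {}\<close> by (auto simp: meas_partitions_def)
      moreover have "pairwise disjnt P" "pairwise disjnt R"
        using P R by (auto simp: meas_partitions_def)
      ultimately have "pairwise disjnt (P \<union> R)"
        unfolding pairwise_def disjnt_def by (metis Un_iff inf_commute)
      then have PR: "P \<union> R \<in> meas_partitions M (A \<union> B)"
        using P R by (simp add: meas_partitions_def)
      have "P \<inter> R \<subseteq> {{}}"
        using P R \<open>A \<inter> B = {}\<close> by (auto simp: meas_partitions_def)
      then have "(\<Sum>B\<in>P \<inter> R. ennreal \<bar>\<mu> B\<bar>) = 0"
        using empty by (intro sum.neutral) auto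
      then have "(\<Sum>B\<in>P. ennreal \<bar>\<mu> B\<bar>) + (\<Sum>B\<in>R. ennreal \<bar>\<mu> B\<bar>) = (\<Sum>B\<in>P \<union> R. ennreal \<bar>\<mu> B\<bar>)"
        using P R sum.union_inter[of P R "\<lambda>B. ennreal \<bar>\<mu> B\<bar>"]
        by (simp add: meas_partitions_def)
      also have "\<dots> \<le> T (A \<union> B)"
        unfolding T_def by (rule SUP_upper[OF PR])
      finally show ?thesis .
    qed
    have "T A + T B = (SUP P\<in>meas_partitions M A. (\<Sum>B\<in>P. ennreal \<bar>\<mu> B\<bar>) + T B)"
      unfolding T_def[of A] by (rule ennreal_SUP_add_left[symmetric, OF ne[OF that(1)]])
    also have "\<dots> \<le> T (A \<union> B)"
    proof (rule SUP_least)
      fix P assume P: "P \<in> meas_partitions M A"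
      have "(\<Sum>B\<in>P. ennreal \<bar>\<mu> B\<bar>) + T B =
          (SUP R\<in>meas_partitions M B. (\<Sum>B\<in>P. ennreal \<bar>\<mu> B\<bar>) + (\<Sum>B\<in>R. ennreal \<bar>\<mu> B\<bar>))"
        unfolding T_def[of B] by (rule ennreal_SUP_add_right[OF ne[OF that(2)]])
      also have "\<dots> \<le> T (A \<union> B)"
        by (rule SUP_least) (rule le[OF P])
      finally show "(\<Sum>B\<in>P. ennreal \<bar>\<mu> B\<bar>) + T B \<le> T (A \<union> B)" .
    qed
    finally show ?thesis .
  qed
  have mono: "T A \<le> T B" if "A \<in> sets M" "B \<in> sets M" "A \<subseteq> B" for A B
  proof -
    have "T A \<le> T A + T (B - A)" by simp
    also have "\<dots> \<le> T (A \<union> (B - A))" using that by (intro super) auto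
    also have "A \<union> (B - A) = B" using that by auto
    finally show ?thesis .
  qed
  have "countably_additive (sets M) T"
  proof (rule countably_additiveI)
    fix A :: "nat \<Rightarrow> 'a set"
    assume A: "range A \<subseteq> sets M" and dis: "disjoint_family A" and U: "\<Union>(range A) \<in> sets M"
    have Ai: "A i \<in> sets M" for i using A by auto
    have fin: "(\<Sum>i<n. T (A i)) \<le> T (\<Union>i<n. A i)" for n
    proof (induction n)
      case 0
      show ?case by simp
    next
      case (Suc n)
      have "(\<Sum>i<Suc n. T (A i)) \<le> T (\<Union>i<n. A i) + T (A n)"
        using Suc by (simp add: add_right_mono)
      also have "\<dots> \<le> T ((\<Union>i<n. A i) \<union> A n)"
      proof (rule super)
        show "(\<Union>i<n. A i) \<inter> A n = {}"
        proof -
          have "A i \<inter> A n = {}" if "i < n" for i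
            using disjoint_family_onD[OF dis, of i n] that by simp
          then show ?thesis by blast
        qed
      qed (use Ai in auto)
      also have "(\<Union>i<n. A i) \<union> A n = (\<Union>i<Suc n. A i)"
        by (auto simp: less_Suc_eq)
      finally show ?case .
    qed
    have "(\<Sum>i. T (A i)) \<le> T (\<Union>(range A))"
    proof (rule suminf_le_const)
      show "(\<Sum>i<n. T (A i)) \<le> T (\<Union>(range A))" for n
        by (rule order_trans[OF fin mono]) (use Ai U in auto)
    qed simp
    moreover have "T (\<Union>(range A)) \<le> (\<Sum>i. T (A i))"
      unfolding T_def[of "\<Union>(range A)"]
    proof (rule SUP_least)
      fix P assume P: "P \<in> meas_partitions M (\<Union>(range A))"
      then have finP: "finite P" by (simp add: meas_partitions_def)
      have "(\<Sum>B\<in>P. ennreal \<bar>\<mu> B\<bar>) \<le> (\<Sum>B\<in>P. \<Sum>i. ennreal \<bar>\<mu> (B \<inter> A i)\<bar>)"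
      proof (rule sum_mono)
        fix B assume B: "B \<in> P"
        then have Bs: "B \<in> sets M" "B \<subseteq> \<Union>(range A)"
          using P by (auto simp: meas_partitions_def)
        have "(\<lambda>i. \<mu> (B \<inter> A i)) sums \<mu> (\<Union>i. B \<inter> A i)"
          using dis Bs Ai by (intro sums) (auto simp: disjoint_family_on_def)
        moreover have "(\<Union>i. B \<inter> A i) = B" using Bs by auto
        ultimately have s: "(\<lambda>i. \<mu> (B \<inter> A i)) sums \<mu> B" by simp
        show "ennreal \<bar>\<mu> B\<bar> \<le> (\<Sum>i. ennreal \<bar>\<mu> (B \<inter> A i)\<bar>)"
        proof (rule LIMSEQ_le_const2)
          show "(\<lambda>n. ennreal \<bar>\<Sum>i<n. \<mu> (B \<inter> A i)\<bar>) \<longlonglongrightarrow> ennreal \<bar>\<mu> B\<bar>"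
            using s unfolding sums_def by (intro tendsto_ennrealI tendsto_rabs)
          have "ennreal \<bar>\<Sum>i<n. \<mu> (B \<inter> A i)\<bar> \<le> (\<Sum>i. ennreal \<bar>\<mu> (B \<inter> A i)\<bar>)" for n
          proof -
            have "ennreal \<bar>\<Sum>i<n. \<mu> (B \<inter> A i)\<bar> \<le> ennreal (\<Sum>i<n. \<bar>\<mu> (B \<inter> A i)\<bar>)"
              by (intro ennreal_leI sum_abs)
            also have "\<dots> = (\<Sum>i<n. ennreal \<bar>\<mu> (B \<inter> A i)\<bar>)"
              by (simp add: sum_ennreal)
            also have "\<dots> \<le> (\<Sum>i. ennreal \<bar>\<mu> (B \<inter> A i)\<bar>)"
              by (rule sum_le_suminf) auto
            finally show ?thesis .
          qed
          then show "\<exists>N. \<forall>n\<ge>N. ennreal \<bar>\<Sum>i<n. \<mu> (B \<inter> A i)\<bar> \<le> (\<Sum>i. ennreal \<bar>\<mu> (B \<inter> A i)\<bar>)"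
            by blast
        qed
      qed
      also have "\<dots> = (\<Sum>i. \<Sum>B\<in>P. ennreal \<bar>\<mu> (B \<inter> A i)\<bar>)"
        by (rule suminf_sum[symmetric]) simp
      also have "\<dots> \<le> (\<Sum>i. T (A i))"
      proof (rule suminf_le)
        fix i
        let ?R = "(\<lambda>B. B \<inter> A i) ` P"
        have "(\<Sum>B\<in>P. ennreal \<bar>\<mu> (B \<inter> A i)\<bar>) = (\<Sum>B\<in>?R. ennreal \<bar>\<mu> B\<bar>)"
        proof (rule sum.reindex_nontrivial[symmetric, unfolded comp_def, OF finP])
          fix X Y assume XY: "X \<in> P" "Y \<in> P" "X \<noteq> Y" "X \<inter> A i = Y \<inter> A i"
          then have "X \<inter> Y = {}"
            using P pairwiseD[of disjnt P X Y] by (simp add: meas_partitions_def disjnt_def)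
          then have "X \<inter> A i = {}" using XY by auto
          then show "ennreal \<bar>\<mu> (X \<inter> A i)\<bar> = 0" using empty by simp
        qed
        moreover have "?R \<in> meas_partitions M (A i)"
        proof -
          have "disjoint ?R"
          proof (rule pairwiseI)
            fix X Y assume "X \<in> ?R" "Y \<in> ?R" "X \<noteq> Y"
            then obtain B C where BC: "B \<in> P" "C \<in> P" "X = B \<inter> A i" "Y = C \<inter> A i" "B \<noteq> C"
              by blast
            then have "B \<inter> C = {}"
              using P pairwiseD[of disjnt P B C] by (simp add: meas_partitions_def disjnt_def)
            then show "disjnt X Y"
              using BC by (auto simp: disjnt_def)
          qed
          moreover have "\<Union>?R = \<Union>P \<inter> A i" by blast
          then have "\<Union>?R = A i"
            using P by (auto simp: meas_partitions_def)
          ultimately show ?thesis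
            using P Ai[of i] by (auto simp: meas_partitions_def)
        qed
        ultimately show "(\<Sum>B\<in>P. ennreal \<bar>\<mu> (B \<inter> A i)\<bar>) \<le> T (A i)"
          unfolding T_def by (auto intro: SUP_upper)
      qed auto
      finally show "(\<Sum>B\<in>P. ennreal \<bar>\<mu> B\<bar>) \<le> (\<Sum>i. T (A i))" .
    qed
    ultimately show "(\<Sum>i. T (A i)) = T (\<Union>(range A))" by (rule antisym)
  qed
  moreover have "positive (sets M) T" by (simp add: positive_def T_empty)
  ultimately have "emeasure (measure_of (space M) (sets M) T) X = T X"
    using X by (intro emeasure_measure_of_sigma sets.sigma_algebra_axioms)
  then show ?thesis
    by (simp add: total_variation_def T_def[abs_def])
qed

corollary emeasure_total_variation_diff:
  assumes "finite_measure N" "finite_measure N'" "sets N = sets M" "sets N' = sets M" "X \<in> sets M"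
  shows "emeasure (total_variation M (\<lambda>A. measure N A - measure N' A)) X =
    (SUP P\<in>meas_partitions M X. \<Sum>B\<in>P. ennreal \<bar>measure N B - measure N' B\<bar>)"
proof (rule emeasure_total_variation)
  fix A :: "nat \<Rightarrow> 'a set" assume "range A \<subseteq> sets M" "disjoint_family A"
  then show "(\<lambda>i. measure N (A i) - measure N' (A i)) sums (measure N (\<Union>i. A i) - measure N' (\<Union>i. A i))"
    using assms by (intro sums_diff finite_measure.finite_measure_UNION) simp_all
qed (use assms in simp_all)

lemma Ionescu_Tulcea_chain_step:
  assumes Q: "Q \<in> M \<rightarrow>\<^sub>M prob_algebra M" and \<xi>: "\<xi> \<in> space (prob_algebra M)"
  shows "Ionescu_Tulcea (chain_step \<xi> Q) (\<lambda>_. M)"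
proof (rule Ionescu_Tulcea.intro)
  show "chain_step \<xi> Q n \<in> PiM {0..<n} (\<lambda>_. M) \<rightarrow>\<^sub>M subprob_algebra M" for n
  proof (cases n)
    case 0
    then have "chain_step \<xi> Q n = (\<lambda>_. \<xi>)"
      by (simp add: chain_step_def fun_eq_iff)
    then show ?thesis
      using \<xi> by (simp add: space_prob_algebra space_subprob_algebra prob_space_imp_subprob_space)
  next
    case (Suc i)
    then have "chain_step \<xi> Q n = (\<lambda>\<omega>. Q (\<omega> i))"
      by (simp add: chain_step_def fun_eq_iff)
    then show ?thesis
      using Suc measurable_prob_algebraD[OF Q]
      by (auto intro!: measurable_compose[OF measurable_component_singleton])
  qed
  show "prob_space (chain_step \<xi> Q n \<omega>)" if "\<omega> \<in> space (PiM {0..<n} (\<lambda>_. M))" for n \<omega>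
    using that \<xi> measurable_space[OF Q]
    by (cases n) (auto simp: chain_step_def space_prob_algebra space_PiM PiE_iff)
qed

lemma
  assumes Q: "Q \<in> M \<rightarrow>\<^sub>M prob_algebra M" and \<xi>: "\<xi> \<in> space (prob_algebra M)"
  shows sets_chain_law: "sets (chain_law M Q \<xi>) = sets (PiM UNIV (\<lambda>_. M))"
    and prob_space_chain_law: "prob_space (chain_law M Q \<xi>)"
    and distr_chain_law: "finite J \<Longrightarrow> distr (chain_law M Q \<xi>) (PiM J (\<lambda>_. M)) (\<lambda>x. restrict x J)
      = Ionescu_Tulcea.CI (chain_step \<xi> Q) (\<lambda>_. M) J"
proof -
  interpret IT: Ionescu_Tulcea "chain_step \<xi> Q" "\<lambda>_. M"
    by (rule Ionescu_Tulcea_chain_step[OF assms])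
  show "sets (chain_law M Q \<xi>) = sets (PiM UNIV (\<lambda>_. M))"
    by (simp add: chain_law_def)
  show d: "finite J \<Longrightarrow> distr (chain_law M Q \<xi>) (PiM J (\<lambda>_. M)) (\<lambda>x. restrict x J)
      = Ionescu_Tulcea.CI (chain_step \<xi> Q) (\<lambda>_. M) J" for J
    unfolding chain_law_def by (rule IT.distr_lim)
  have "prob_space (distr (chain_law M Q \<xi>) (PiM {} (\<lambda>_. M)) (\<lambda>x. restrict x {}))"
    unfolding d[OF finite.emptyI] by (rule IT.PF.prob_space_P) simp_all
  then show "prob_space (chain_law M Q \<xi>)"
    by (rule prob_space_distrD[rotated])
       (auto simp: chain_law_def measurable_cong_sets[OF IT.PF.sets_lim refl])
qed

end

theory Submission
  imports Defs
begin

text \<open>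
  With the Poisson solution \<open>g = (\<Sum>k. Q\<^sup>k (f - \<pi>(f)))\<close>, the sum \<open>S\<^sub>n\<close> is, up to boundary terms, a martingale
  with increments \<open>g (Z\<^sub>i\<^sub>+\<^sub>1) - Q g (Z\<^sub>i)\<close>.  Jensen's inequality slows the rate \<open>1/4\<close> down to \<open>(1/4) powr (1 / (2 p))\<close>
  on functions bounded by \<open>V powr (1 / (2 p))\<close>, so \<open>p \<tau>\<close> is the natural time scale: the increments are grouped into
  blocks of length about \<open>p \<tau>\<close>.  The conditional variance of a block is a function \<open>H\<close> of the state at its start, with
  \<open>\<pi>(H)\<close> the block length times \<open>\<sigma>\<^sub>\<pi>\<^sup>2(f)\<close>.  A Rosenthal-type inequality reduces the claim to the sum of \<open>H\<close> along the chain
  sampled once per block, whose fluctuations, of order the square root of the number of blocks, come from a second Poisson equation and a cruder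
  martingale inequality; they produce the term with \<open>n powr (1/4)\<close>.

  For the initial distribution, two starting points are compared step by step: the common part of the two
  laws is split off each time, and Minkowski's inequality sums up what is lost on the rest.
\<close>

section \<open>Elementary inequalities\<close>

text \<open>The weight \<open>V powr (1 / (2 * p))\<close> gives \<open>f\<close>, its Poisson
  solution and the increments \<open>2 * p\<close> moments under \<pi>; the Rosenthal-type
  inequality is built to use them. Blocks produce the right powers of \<open>p\<close> and \<tau>.
  Treated step by step, the conditional variance has order \<open>G\<^sup>2\<close>, that is
  \<open>(p * \<tau>)\<^sup>2\<close>, and its Poisson solution gains another factor
  \<open>p * \<tau>\<close>; the second term would then carry
  \<open>p powr (5/2) * \<tau> powr (3/2)\<close>. Over a block the variance keeps the order
  \<open>G\<^sup>2\<close>, while the chain sampled once per block contracts by a fixed factor, so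
  that the second Poisson equation costs only 4/3. This yields
  \<open>p\<^sup>2 * \<tau> powr (3/4)\<close>. A constant \<rho> is added to the quadratic
  variation. It keeps the weights bounded and is calibrated to absorb the jumps; with the boundary
  terms it produces the term in \<open>n powr (1 / p)\<close>. For an arbitrary initial law moments
  may be infinite, hence norms with extended values; a recursion in the starting state replaces a
  joint law of two chains.\<close>

lemma powr_le_tangent:
  fixes x t a :: real
  assumes "0 \<le> x" "0 < t" "0 < a" "a \<le> 1"
  shows "x powr a \<le> t powr a * (1 - a + a * (x / t))"
proof (cases "x = 0")
  case True
  then show ?thesis using assms by simp
next
  case False
  define u where "u = x / t"
  have u: "u > 0" using False assms by (simp add: u_def)
  \<comment> \<open>The tangent of the concave power at \<open>t\<close>, reduced to Bernoulli's
    inequality for \<open>u = x / t\<close>, which is convexity of exp between 0 and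
    \<open>ln u\<close>. Integrated with \<open>t\<close> a bound on the integral of
    \<open>x\<close>, it plays the role of Jensen's inequality, also for measures whose mass is not
    1.\<close>
  have "exp ((1 - a) *\<^sub>R 0 + a *\<^sub>R ln u) \<le> (1 - a) * exp 0 + a * exp (ln u)"
    by (rule convex_onD[OF exp_convex]) (use assms in auto)
  then have "u powr a \<le> 1 - a + a * u"
    using u by (simp add: powr_def)
  moreover have "x powr a = t powr a * u powr a"
    using assms u False by (simp add: u_def powr_divide)
  ultimately show ?thesis
    using assms by (simp add: u_def mult_left_mono)
qed

text \<open>As \<open>2 * y \<le> 1\<close>, the power of 1/2 with exponent \<open>2 * y\<close>
  lies below its tangent at base 1. For \<open>y = 1 / p\<close> or \<open>y = 1 / (2 * p)\<close>
  this turns the factor \<open>1 / (1 - r)\<close> of a geometric series with ratio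
  \<open>r = (1/4) powr y\<close> into at most \<open>1 / y\<close>, which is linear in
  \<open>p\<close>.\<close>

lemma quarter_powr_le:
  fixes y :: real
  assumes "0 \<le> y" "y \<le> 1/2"
  shows "(1/4) powr y \<le> 1 - y"
proof (cases "y = 0")
  case False
  have "(1/4) powr y = (1/2::real) powr (2 * y)"
    by (simp add: powr_powr[symmetric] powr_numeral power2_eq_square)
  also have "\<dots> \<le> 1 powr (2*y) * (1 - 2*y + 2*y * ((1/2) / 1))"
    using assms False by (intro powr_le_tangent) auto
  finally show ?thesis by simp
qed simp

text \<open>If \<open>P * \<bar>y\<bar> < \<bar>x\<bar>\<close>, then
  \<open>1 + u \<le> exp u\<close> for \<open>u = y / x\<close> and a quadratic bound on the
  exponential give the expansion without remainder; otherwise the left side and the first-order term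
  are each at most \<open>(P + 1) powr P * \<bar>y\<bar> powr P\<close>. The first-order term keeps
  its sign because it has to vanish under a martingale expectation.\<close>

lemma abs_add_powr_le_taylor:
  fixes x y P :: real
  assumes P: "P \<ge> 2"
  shows "\<bar>x + y\<bar> powr P \<le> \<bar>x\<bar> powr P + P * (sgn x * \<bar>x\<bar> powr (P - 1)) * y
      + P\<^sup>2 * (\<bar>x\<bar> powr (P - 2) * y\<^sup>2) + 2 * (P + 1) powr P * \<bar>y\<bar> powr P"
proof -
  have pos: "\<bar>x + y\<bar> powr P \<le> \<bar>x\<bar> powr P + P * \<bar>x\<bar> powr (P - 1) * y
      + P\<^sup>2 * (\<bar>x\<bar> powr (P - 2) * y\<^sup>2)" if x: "x > 0" and s: "\<bar>y\<bar> < x / P" for x y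
  proof -
    define u where "u = y / x"
    have u: "\<bar>P * u\<bar> < 1" using s x P by (simp add: u_def abs_mult field_simps)
    have "P * \<bar>u\<bar> < 1" using u P by (simp add: abs_mult)
    moreover have "\<bar>u\<bar> \<le> P * \<bar>u\<bar>" using P by (simp add: mult_le_cancel_right1)
    ultimately have u1: "1 + u > 0" by linarith
    have "(1 + u) powr P \<le> exp u powr P"
      using u1 P by (intro powr_mono2) auto
    also have "\<dots> = exp (P * u)" by (simp add: powr_def)
    also have "\<dots> \<le> 1 + P * u + (P * u)\<^sup>2"
    proof (cases "P * u \<ge> 0")
      case True
      then show ?thesis using exp_bound[of "P * u"] u by simp
    next
      case False
      \<comment> \<open>For negative exponents, \<open>exp (- w) \<le> 1 - w + w\<^sup>2\<close>
        follows from the lower Taylor bound of \<open>exp w\<close>, since the product of the two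
        quadratics is at least 1.\<close>
      define w where "w = - (P * u)"
      have w: "0 < w" "w < 1" using False u by (auto simp: w_def)
      have "exp w \<ge> 1 + w + w\<^sup>2 / 2" using exp_lower_Taylor_quadratic[of w] w by simp
      moreover have "(1 + w + w\<^sup>2/2) * (1 - w + w\<^sup>2) \<ge> 1"
      proof -
        have "(1 + w + w\<^sup>2/2) * (1 - w + w\<^sup>2) = 1 + w\<^sup>2 / 2 + w^3 / 2 + w^4 / 2"
          by (simp add: power2_eq_square power3_eq_cube power4_eq_xxxx field_simps)
        then show ?thesis using w by simp
      qed
      moreover have "1 - w + w\<^sup>2 > 0" using w by (smt (verit) zero_less_power)
      ultimately have "exp w * (1 - w + w\<^sup>2) \<ge> 1"
        by (smt (verit) mult_right_mono)
      then have "exp (-w) \<le> 1 - w + w\<^sup>2"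
        by (simp add: exp_minus field_simps)
      then show ?thesis by (simp add: w_def)
    qed
    finally have *: "(1 + u) powr P \<le> 1 + P * u + (P * u)\<^sup>2" .
    have "\<bar>x + y\<bar> powr P = x powr P * (1 + u) powr P"
    proof -
      have "x + y = x * (1 + u)" using x by (simp add: u_def field_simps)
      then show ?thesis using x u1 by (simp add: abs_mult powr_mult)
    qed
    also have "\<dots> \<le> x powr P * (1 + P * u + (P * u)\<^sup>2)"
      by (intro mult_left_mono *) simp
    also have "\<dots> = x powr P + P * x powr (P - 1) * y + P\<^sup>2 * (x powr (P - 2) * y\<^sup>2)"
      using x by (simp add: u_def powr_diff field_simps power2_eq_square)
    finally show ?thesis using x by simp
  qed
  show ?thesis
  proof (cases "\<bar>y\<bar> < \<bar>x\<bar> / P")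
    case True
    then have x0: "x \<noteq> 0" using P by auto
    have "\<bar>x + y\<bar> powr P \<le> \<bar>x\<bar> powr P + P * (sgn x * \<bar>x\<bar> powr (P - 1)) * y
      + P\<^sup>2 * (\<bar>x\<bar> powr (P - 2) * y\<^sup>2)"
    proof (cases "x > 0")
      case True
      then show ?thesis using pos[of x y] \<open>\<bar>y\<bar> < \<bar>x\<bar> / P\<close> by simp
    next
      case False
      moreover have "\<bar>x + y\<bar> = \<bar>-x + -y\<bar>" by simp
      ultimately show ?thesis using pos[of "-x" "-y"] \<open>\<bar>y\<bar> < \<bar>x\<bar> / P\<close> x0 by simp
    qed
    then show ?thesis by (smt (verit) P powr_ge_zero mult_nonneg_nonneg)
  next
    case False
    then have x: "\<bar>x\<bar> \<le> P * \<bar>y\<bar>" using P by (simp add: field_simps)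
    have "\<bar>x + y\<bar> powr P \<le> ((P + 1) * \<bar>y\<bar>) powr P"
      using P x by (intro powr_mono2) (auto simp: algebra_simps)
    also have "\<dots> = (P + 1) powr P * \<bar>y\<bar> powr P" using P by (simp add: powr_mult)
    finally have 1: "\<bar>x + y\<bar> powr P \<le> (P + 1) powr P * \<bar>y\<bar> powr P" .
    \<comment> \<open>The first-order term can be this negative; it accounts for the second copy of
      the power of \<open>\<bar>y\<bar>\<close> in the remainder.\<close>
    have "- (P * (sgn x * \<bar>x\<bar> powr (P - 1)) * y) \<le> P * \<bar>x\<bar> powr (P - 1) * \<bar>y\<bar>"
    proof -
      have "- (P * (sgn x * \<bar>x\<bar> powr (P - 1)) * y) \<le> \<bar>P * (sgn x * \<bar>x\<bar> powr (P - 1)) * y\<bar>"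
        by linarith
      also have "\<dots> = P * \<bar>x\<bar> powr (P - 1) * \<bar>y\<bar>"
        using P by (simp add: abs_mult abs_sgn_eq)
      finally show ?thesis .
    qed
    also have "\<dots> \<le> P * (P * \<bar>y\<bar>) powr (P - 1) * \<bar>y\<bar>"
      using P x by (intro mult_right_mono mult_left_mono powr_mono2) auto
    also have "\<dots> = P powr P * \<bar>y\<bar> powr P"
      using P by (cases "y = 0") (simp_all add: powr_mult powr_diff)
    also have "\<dots> \<le> (P + 1) powr P * \<bar>y\<bar> powr P"
      using P by (intro mult_right_mono powr_mono2) auto
    finally have 2: "- (P * (sgn x * \<bar>x\<bar> powr (P - 1)) * y) \<le> (P + 1) powr P * \<bar>y\<bar> powr P" .
    have "0 \<le> \<bar>x\<bar> powr P" "0 \<le> P\<^sup>2 * (\<bar>x\<bar> powr (P - 2) * y\<^sup>2)" by simp_all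
    then show ?thesis using 1 2 by linarith
  qed
qed

lemma powr_le_add_powr:
  fixes a b c r :: real
  assumes "0 \<le> a" "0 \<le> b" "0 \<le> c" "0 \<le> r" "c \<le> a \<or> c \<le> b"
  shows "c powr r \<le> a powr r + b powr r"
  using assms powr_mono2[of r c a] powr_mono2[of r c b] powr_ge_zero[of a r] powr_ge_zero[of b r]
  by linarith

lemma powr_add_le:
  fixes a b r :: real
  assumes "0 \<le> a" "0 \<le> b" "0 \<le> r"
  shows "(a + b) powr r \<le> 2 powr r * (a powr r + b powr r)"
proof -
  have "((a + b) / 2) powr r \<le> a powr r + b powr r"
    by (rule powr_le_add_powr) (use assms in auto)
  then show ?thesis using assms by (simp add: powr_divide field_simps)
qed

lemma abs_diff_powr_le:
  "\<bar>x - y\<bar> powr r \<le> 2 powr r * (\<bar>x\<bar> powr r + \<bar>y\<bar> powr r)" if "0 \<le> r" for x y r :: real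
proof -
  have "\<bar>x - y\<bar> powr r \<le> (\<bar>x\<bar> + \<bar>y\<bar>) powr r"
    using that by (intro powr_mono2) auto
  also have "\<dots> \<le> 2 powr r * (\<bar>x\<bar> powr r + \<bar>y\<bar> powr r)"
    using that by (intro powr_add_le) auto
  finally show ?thesis .
qed

lemma powr_add3_le:
  fixes a b c r :: real
  assumes "0 \<le> a" "0 \<le> b" "0 \<le> c" "0 \<le> r"
  shows "(a + b + c) powr r \<le> 3 powr r * (a powr r + b powr r + c powr r)"
proof -
  have "((a + b + c) / 3) powr r \<le> a powr r + (max b c) powr r"
    by (rule powr_le_add_powr) (use assms in auto)
  moreover have "(max b c) powr r \<le> b powr r + c powr r"
    by (rule powr_le_add_powr) (use assms in auto)
  ultimately have "((a + b + c) / 3) powr r \<le> a powr r + b powr r + c powr r" by linarith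
  then show ?thesis using assms by (simp add: powr_divide field_simps)
qed

text \<open>A sum is at most \<open>n\<close> times its largest term. Compared with the power mean
  inequality this loses a factor \<open>n\<close>, but it covers all exponents
  \<open>r \<ge> 0\<close> at once.\<close>

lemma sum_powr_le:
  fixes a :: "nat \<Rightarrow> real" and r :: real
  assumes "\<And>i. 0 \<le> a i" "0 \<le> r"
  shows "(\<Sum>i<n. a i) powr r \<le> real n powr r * (\<Sum>i<n. a i powr r)"
proof (cases "n = 0")
  case False
  have "Max (a ` {..<n}) \<in> a ` {..<n}"
    using False by (intro Max_in) auto
  then obtain i where i0: "i < n" "Max (a ` {..<n}) = a i" by auto
  then have i: "i < n" "\<And>j. j < n \<Longrightarrow> a j \<le> a i"
    using Max_ge[of "a ` {..<n}"] by (simp_all add: i0(2)[symmetric])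
  have "(\<Sum>j<n. a j) \<le> real n * a i"
    using sum_bounded_above[of "{..<n}" a "a i"] i by simp
  then have "(\<Sum>j<n. a j) powr r \<le> (real n * a i) powr r"
    using assms by (intro powr_mono2 sum_nonneg) auto
  also have "\<dots> = real n powr r * a i powr r" using assms by (simp add: powr_mult)
  also have "\<dots> \<le> real n powr r * (\<Sum>j<n. a j powr r)"
    using i by (intro mult_left_mono member_le_sum) auto
  finally show ?thesis .
qed simp

text \<open>With \<open>s = a + b\<close>, each part satisfies
  \<open>x * s powr (r - 1) \<le> x powr r\<close>, since \<open>x \<le> s\<close> and the exponent
  \<open>r - 1\<close> is nonpositive.\<close>

lemma powr_subadditive:
  fixes a b r :: real
  assumes "0 \<le> a" "0 \<le> b" "0 < r" "r \<le> 1"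
  shows "(a + b) powr r \<le> a powr r + b powr r"
proof (cases "a + b = 0")
  case False
  then have s: "a + b > 0" using assms by linarith
  have le: "x * (a + b) powr (r - 1) \<le> x powr r" if "0 \<le> x" "x \<le> a + b" for x
  proof (cases "x = 0")
    case False
    have "(a + b) powr (r - 1) \<le> x powr (r - 1)"
      using assms that False by (intro powr_mono2') auto
    then have "x * (a + b) powr (r - 1) \<le> x * x powr (r - 1)" using that by (intro mult_left_mono)
    then show ?thesis using that False by (simp add: powr_mult_base)
  qed simp
  have "(a + b) powr r = (a + b) * (a + b) powr (r - 1)"
    using s by (simp add: powr_mult_base)
  then show ?thesis using le[of a] le[of b] assms by (simp add: distrib_right)
qed (use assms in auto)

section \<open>Moment inequalities for martingales\<close>

text \<open>The largest of the three absolute values replaces Young's inequality; the constant is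
  immaterial because the bound only serves to establish integrability.\<close>

lemma powr_prod_le:
  fixes x y z :: real
  assumes "2 \<le> r"
  shows "\<bar>x\<bar> powr (r - 2) * (\<bar>y\<bar> * \<bar>z\<bar>) \<le> \<bar>x\<bar> powr r + \<bar>y\<bar> powr r + \<bar>z\<bar> powr r"
proof -
  define w where "w = max \<bar>x\<bar> (max \<bar>y\<bar> \<bar>z\<bar>)"
  have w: "\<bar>x\<bar> \<le> w" "\<bar>y\<bar> \<le> w" "\<bar>z\<bar> \<le> w" "0 \<le> w" by (auto simp: w_def)
  have "\<bar>x\<bar> powr (r - 2) * (\<bar>y\<bar> * \<bar>z\<bar>) \<le> w powr (r - 2) * (w * w)"
    using w assms by (intro mult_mono powr_mono2) auto
  also have "\<dots> = w powr r"
    using w by (cases "w = 0") (auto simp: powr_diff power2_eq_square)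
  also have "\<dots> \<le> \<bar>x\<bar> powr r + \<bar>y\<bar> powr r + \<bar>z\<bar> powr r"
    using powr_ge_zero[of "\<bar>x\<bar>" r] powr_ge_zero[of "\<bar>y\<bar>" r] powr_ge_zero[of "\<bar>z\<bar>" r]
    unfolding w_def max_def by (auto simp: add_nonneg_nonneg)
  finally show ?thesis .
qed

context prob_space
begin

lemma integrable_powr_add:
  fixes X Y :: "'a \<Rightarrow> real"
  assumes "integrable M (\<lambda>\<omega>. \<bar>X \<omega>\<bar> powr r)" "integrable M (\<lambda>\<omega>. \<bar>Y \<omega>\<bar> powr r)" "0 \<le> r"
    and [measurable]: "X \<in> borel_measurable M" "Y \<in> borel_measurable M"
  shows "integrable M (\<lambda>\<omega>. \<bar>X \<omega> + Y \<omega>\<bar> powr r)"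
proof (rule Bochner_Integration.integrable_bound)
  show "integrable M (\<lambda>\<omega>. 2 powr r * (\<bar>X \<omega>\<bar> powr r + \<bar>Y \<omega>\<bar> powr r))"
    using assms by (intro integrable_mult_right Bochner_Integration.integrable_add)
  have "\<bar>X \<omega> + Y \<omega>\<bar> powr r \<le> 2 powr r * (\<bar>X \<omega>\<bar> powr r + \<bar>Y \<omega>\<bar> powr r)" for \<omega>
  proof -
    have "\<bar>X \<omega> + Y \<omega>\<bar> powr r \<le> (\<bar>X \<omega>\<bar> + \<bar>Y \<omega>\<bar>) powr r"
      using assms by (intro powr_mono2) auto
    also have "\<dots> \<le> 2 powr r * (\<bar>X \<omega>\<bar> powr r + \<bar>Y \<omega>\<bar> powr r)"
      using assms by (intro powr_add_le) auto
    finally show ?thesis .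
  qed
  then show "AE \<omega> in M. norm (\<bar>X \<omega> + Y \<omega>\<bar> powr r) \<le> norm (2 powr r * (\<bar>X \<omega>\<bar> powr r + \<bar>Y \<omega>\<bar> powr r))"
    by simp
qed measurable

lemma integrable_powr_sum:
  fixes X :: "nat \<Rightarrow> 'a \<Rightarrow> real"
  assumes "\<And>i. i < n \<Longrightarrow> integrable M (\<lambda>\<omega>. \<bar>X i \<omega>\<bar> powr r)" "0 \<le> r"
    and [measurable]: "\<And>i. X i \<in> borel_measurable M"
  shows "integrable M (\<lambda>\<omega>. \<bar>\<Sum>i<n. X i \<omega>\<bar> powr r)"
  using assms(1)
proof (induction n)
  case (Suc n)
  have "integrable M (\<lambda>\<omega>. \<bar>(\<Sum>i<n. X i \<omega>) + X n \<omega>\<bar> powr r)"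
    by (rule integrable_powr_add) (use Suc assms in auto)
  then show ?case by (simp add: add.commute)
qed simp

lemma integrable_powr_cmult:
  fixes X :: "'a \<Rightarrow> real"
  assumes "integrable M (\<lambda>\<omega>. \<bar>X \<omega>\<bar> powr r)"
  shows "integrable M (\<lambda>\<omega>. \<bar>c * X \<omega>\<bar> powr r)"
  using assms by (simp add: abs_mult powr_mult)

text \<open>A factor of growth \<open>\<bar>X\<bar> powr (r - 2)\<close> next to two factors with
  \<open>r\<close> moments is the shape of both Taylor terms: \<open>X * D\<close> in the first
  order and \<open>D * D\<close> in the second.\<close>

lemma integrable_powr_prod:
  fixes X Y Z U :: "'a \<Rightarrow> real"
  assumes r: "2 \<le> r" and U: "\<And>\<omega>. \<omega> \<in> space M \<Longrightarrow> \<bar>U \<omega>\<bar> \<le> c * \<bar>X \<omega>\<bar> powr (r - 2)"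
    and "integrable M (\<lambda>\<omega>. \<bar>X \<omega>\<bar> powr r)" "integrable M (\<lambda>\<omega>. \<bar>Y \<omega>\<bar> powr r)" "integrable M (\<lambda>\<omega>. \<bar>Z \<omega>\<bar> powr r)"
    and [measurable]: "X \<in> borel_measurable M" "Y \<in> borel_measurable M" "Z \<in> borel_measurable M" "U \<in> borel_measurable M"
  shows "integrable M (\<lambda>\<omega>. U \<omega> * (Y \<omega> * Z \<omega>))"
proof (rule Bochner_Integration.integrable_bound)
  show "integrable M (\<lambda>\<omega>. \<bar>c\<bar> * (\<bar>X \<omega>\<bar> powr r + \<bar>Y \<omega>\<bar> powr r + \<bar>Z \<omega>\<bar> powr r))"
    using assms by (intro integrable_mult_right Bochner_Integration.integrable_add)
  have "\<bar>U \<omega> * (Y \<omega> * Z \<omega>)\<bar> \<le> \<bar>c\<bar> * (\<bar>X \<omega>\<bar> powr r + \<bar>Y \<omega>\<bar> powr r + \<bar>Z \<omega>\<bar> powr r)"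
    if "\<omega> \<in> space M" for \<omega>
  proof -
    have "\<bar>U \<omega> * (Y \<omega> * Z \<omega>)\<bar> \<le> c * \<bar>X \<omega>\<bar> powr (r - 2) * (\<bar>Y \<omega>\<bar> * \<bar>Z \<omega>\<bar>)"
      using U[OF that] by (simp add: abs_mult mult_right_mono)
    also have "\<dots> \<le> \<bar>c\<bar> * \<bar>X \<omega>\<bar> powr (r - 2) * (\<bar>Y \<omega>\<bar> * \<bar>Z \<omega>\<bar>)"
      by (intro mult_right_mono) auto
    also have "\<dots> \<le> \<bar>c\<bar> * (\<bar>X \<omega>\<bar> powr r + \<bar>Y \<omega>\<bar> powr r + \<bar>Z \<omega>\<bar> powr r)"
      using powr_prod_le[OF r, of "X \<omega>" "Y \<omega>" "Z \<omega>"] by (simp add: mult.assoc mult_left_mono)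
    finally show ?thesis .
  qed
  then show "AE \<omega> in M. norm (U \<omega> * (Y \<omega> * Z \<omega>)) \<le> norm (\<bar>c\<bar> * (\<bar>X \<omega>\<bar> powr r + \<bar>Y \<omega>\<bar> powr r + \<bar>Z \<omega>\<bar> powr r))"
    by (auto intro!: AE_I2)
qed measurable

text \<open>A discrete Gronwall argument. Young's inequality with parameter
  \<open>e = 1 / (m * q\<^sup>2)\<close> makes the second-order term cost only a factor
  \<open>1 + 1 / m\<close> per step, hence at most 3 over \<open>m\<close> steps, and leaves a
  multiple of order \<open>m powr ((q - 2) / 2)\<close> of the increment moment; summation gives
  \<open>m powr (q / 2)\<close>. In norm the constant grows like \<open>q\<close>, which is
  affordable for the fluctuation of the variance.\<close>

lemma martingale_moment_le:
  fixes X D :: "nat \<Rightarrow> 'a \<Rightarrow> real"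
  assumes q: "2 \<le> q" and [measurable]: "\<And>j. X j \<in> borel_measurable M" "\<And>j. D j \<in> borel_measurable M"
    and X0: "\<And>\<omega>. X 0 \<omega> = 0" and XS: "\<And>j \<omega>. X (Suc j) \<omega> = X j \<omega> + D j \<omega>"
    and Di: "\<And>j. integrable M (\<lambda>\<omega>. \<bar>D j \<omega>\<bar> powr q)"
    and DE: "\<And>j. (\<integral>\<omega>. \<bar>D j \<omega>\<bar> powr q \<partial>M) \<le> E"
    and mart: "\<And>j. (\<integral>\<omega>. sgn (X j \<omega>) * \<bar>X j \<omega>\<bar> powr (q - 1) * D j \<omega> \<partial>M) = 0"
    and m: "0 < m"
  shows "integrable M (\<lambda>\<omega>. \<bar>X m \<omega>\<bar> powr q)"
    and "(\<integral>\<omega>. \<bar>X m \<omega>\<bar> powr q \<partial>M) \<le> 9 * (q + 1) powr q * real m powr (q / 2) * E"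
proof -
  have Xi: "integrable M (\<lambda>\<omega>. \<bar>X j \<omega>\<bar> powr q)" for j
  proof (induction j)
    case (Suc j)
    show ?case unfolding XS using Suc Di q by (intro integrable_powr_add) auto
  qed (use q in \<open>simp add: X0\<close>)
  show "integrable M (\<lambda>\<omega>. \<bar>X m \<omega>\<bar> powr q)" by (rule Xi)
  define e where "e = 1 / (real m * q\<^sup>2)"
  have e: "e > 0" using m q by (simp add: e_def)
  define K where "K = q\<^sup>2 * e powr (- ((q - 2) / 2)) + 2 * (q + 1) powr q"
  have K0: "K \<ge> 0" by (simp add: K_def)
  have E0: "E \<ge> 0" using DE[of 0] by (rule order_trans[rotated]) simp
  \<comment> \<open>Comparing \<open>d\<^sup>2\<close> with \<open>e * x\<^sup>2\<close> decides
    which of the two terms on the right dominates.\<close>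
  have young: "\<bar>x\<bar> powr (q - 2) * d\<^sup>2 \<le> e * \<bar>x\<bar> powr q + e powr (- ((q - 2) / 2)) * \<bar>d\<bar> powr q" for x d :: real
  proof (cases "d\<^sup>2 \<le> e * x\<^sup>2")
    case True
    have "\<bar>x\<bar> powr (q - 2) * d\<^sup>2 \<le> \<bar>x\<bar> powr (q - 2) * (e * x\<^sup>2)"
      using True by (intro mult_left_mono) auto
    also have "\<dots> = e * \<bar>x\<bar> powr q"
      by (cases "x = 0") (auto simp: powr_diff power2_eq_square)
    finally show ?thesis by (smt (verit) mult_nonneg_nonneg powr_ge_zero)
  next
    case False
    then have "x\<^sup>2 \<le> d\<^sup>2 / e" using e by (simp add: field_simps)
    then have "(x\<^sup>2) powr ((q - 2) / 2) \<le> (d\<^sup>2 / e) powr ((q - 2) / 2)"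
      using q by (intro powr_mono2) auto
    moreover have "(x\<^sup>2) powr ((q - 2) / 2) = \<bar>x\<bar> powr (q - 2)" for x :: real
    proof -
      have "x\<^sup>2 = \<bar>x\<bar> powr 2" by simp
      moreover have "2 * ((q - 2) / 2) = q - 2" by simp
      ultimately show ?thesis by (simp only: powr_powr)
    qed
    moreover have "(d\<^sup>2 / e) powr ((q - 2) / 2) = (d\<^sup>2) powr ((q - 2) / 2) * e powr (- ((q - 2) / 2))"
      using e by (simp add: powr_divide powr_minus field_simps)
    ultimately have "\<bar>x\<bar> powr (q - 2) * d\<^sup>2 \<le> (\<bar>d\<bar> powr (q - 2) * e powr (- ((q - 2) / 2))) * d\<^sup>2"
      by (intro mult_right_mono) auto
    also have "\<dots> = e powr (- ((q - 2) / 2)) * \<bar>d\<bar> powr q"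
      by (cases "d = 0") (auto simp: powr_diff power2_eq_square)
    finally show ?thesis using e by (smt (verit) mult_nonneg_nonneg powr_ge_zero)
  qed
  have step: "(\<integral>\<omega>. \<bar>X (Suc j) \<omega>\<bar> powr q \<partial>M) \<le> (1 + 1 / m) * (\<integral>\<omega>. \<bar>X j \<omega>\<bar> powr q \<partial>M) + K * E" for j
  proof -
    have I: "integrable M (\<lambda>\<omega>. sgn (X j \<omega>) * \<bar>X j \<omega>\<bar> powr (q - 1) * D j \<omega>)"
    proof -
      have "integrable M (\<lambda>\<omega>. (\<bar>X j \<omega>\<bar> powr (q - 2)) * (X j \<omega> * D j \<omega>))"
        by (rule integrable_powr_prod[OF q, where X="X j" and c=1]) (use Xi Di in auto)
      moreover have "\<bar>x\<bar> powr (q - 2) * (x * d) = sgn x * \<bar>x\<bar> powr (q - 1) * d" for x d :: real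
        by (cases "x = 0") (auto simp: powr_diff power2_eq_square sgn_if)
      ultimately show ?thesis by simp
    qed
    have "(\<integral>\<omega>. \<bar>X (Suc j) \<omega>\<bar> powr q \<partial>M) \<le> (\<integral>\<omega>. (1 + 1 / m) * \<bar>X j \<omega>\<bar> powr q
        + q * (sgn (X j \<omega>) * \<bar>X j \<omega>\<bar> powr (q - 1) * D j \<omega>) + K * \<bar>D j \<omega>\<bar> powr q \<partial>M)"
    proof (rule integral_mono)
      fix \<omega>
      have "q\<^sup>2 * (\<bar>X j \<omega>\<bar> powr (q - 2) * (D j \<omega>)\<^sup>2)
          \<le> q\<^sup>2 * (e * \<bar>X j \<omega>\<bar> powr q + e powr (- ((q - 2) / 2)) * \<bar>D j \<omega>\<bar> powr q)"
        by (intro mult_left_mono young) auto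
      moreover have "q\<^sup>2 * (e * \<bar>X j \<omega>\<bar> powr q) = 1 / m * \<bar>X j \<omega>\<bar> powr q"
        using q m by (simp add: e_def)
      ultimately show "\<bar>X (Suc j) \<omega>\<bar> powr q \<le> (1 + 1 / m) * \<bar>X j \<omega>\<bar> powr q
        + q * (sgn (X j \<omega>) * \<bar>X j \<omega>\<bar> powr (q - 1) * D j \<omega>) + K * \<bar>D j \<omega>\<bar> powr q"
        using abs_add_powr_le_taylor[OF q, of "X j \<omega>" "D j \<omega>"]
        by (simp add: XS K_def algebra_simps)
    qed (intro Bochner_Integration.integrable_add integrable_mult_right Xi Di I)+
    also have "\<dots> = (1 + 1 / m) * (\<integral>\<omega>. \<bar>X j \<omega>\<bar> powr q \<partial>M) + K * (\<integral>\<omega>. \<bar>D j \<omega>\<bar> powr q \<partial>M)"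
      using mart[of j] I Xi Di by simp
    also have "\<dots> \<le> (1 + 1 / m) * (\<integral>\<omega>. \<bar>X j \<omega>\<bar> powr q \<partial>M) + K * E"
      using mult_left_mono[OF DE[of j] K0] by simp
    finally show ?thesis .
  qed
  have "(\<integral>\<omega>. \<bar>X j \<omega>\<bar> powr q \<partial>M) \<le> (1 + 1 / m) ^ j * (real j * (K * E))" for j
  proof (induction j)
    case 0
    then show ?case using q by (simp add: X0)
  next
    case (Suc j)
    have "1 * (K * E) \<le> (1 + 1 / m) ^ Suc j * (K * E)"
      using K0 E0 by (intro mult_right_mono one_le_power) auto
    then have "(\<integral>\<omega>. \<bar>X (Suc j) \<omega>\<bar> powr q \<partial>M)
        \<le> (1 + 1 / m) * ((1 + 1 / m) ^ j * (real j * (K * E))) + (1 + 1 / m) ^ Suc j * (K * E)"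
      using step[of j] mult_left_mono[OF Suc, of "1 + 1 / m"] by simp
    also have "\<dots> = (1 + 1 / m) ^ Suc j * (real (Suc j) * (K * E))"
      by (simp only: power_Suc of_nat_Suc distrib_left distrib_right mult.assoc mult_1 ac_simps)
    finally show ?case .
  qed
  from this[of m] have "(\<integral>\<omega>. \<bar>X m \<omega>\<bar> powr q \<partial>M) \<le> (1 + 1 / m) ^ m * (real m * (K * E))" .
  also have "(1 + 1 / m) ^ m \<le> (3::real)"
  proof -
    have "(1 + 1 / m) ^ m \<le> exp (1 / m) ^ m" by (intro power_mono) auto
    also have "\<dots> = exp 1" using m by (simp add: exp_of_nat_mult[symmetric])
    also have "\<dots> \<le> 3" by (rule exp_le)
    finally show ?thesis .
  qed
  also have "real m * (K * E) \<le> (3 * (q + 1) powr q * real m powr (q / 2)) * E"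
  proof -
    have e': "e powr (- ((q - 2) / 2)) = real m powr ((q - 2) / 2) * q powr (q - 2)"
    proof -
      have "e = (real m * q powr 2) powr (-1)" using q m by (simp add: e_def powr_minus_divide)
      moreover have "- 1 * (- ((q - 2) / 2)) = (q - 2) / 2" by (simp add: field_simps)
      ultimately have "e powr (- ((q - 2) / 2)) = (real m * q powr 2) powr ((q - 2) / 2)"
        by (simp only: powr_powr)
      also have "\<dots> = real m powr ((q - 2) / 2) * (q powr 2) powr ((q - 2) / 2)"
        using q by (intro powr_mult)
      also have "(q powr 2) powr ((q - 2) / 2) = q powr (q - 2)"
      proof -
        have "2 * ((q - 2) / 2) = q - 2" by simp
        then show ?thesis by (simp only: powr_powr)
      qed
      finally show ?thesis .
    qed
    have "real m * K = real m * real m powr ((q - 2) / 2) * (q\<^sup>2 * q powr (q - 2)) + real m * (2 * (q + 1) powr q)"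
      unfolding K_def e' by (simp add: algebra_simps)
    also have "real m * real m powr ((q - 2) / 2) = real m powr (q / 2)"
      using m by (simp add: powr_mult_base) (simp add: field_simps)
    also have "q\<^sup>2 * q powr (q - 2) = q powr q"
      using q by (simp add: powr_diff)
    also have "real m powr (q / 2) * q powr q + real m * (2 * (q + 1) powr q)
        \<le> real m powr (q / 2) * (q + 1) powr q + real m powr (q / 2) * (2 * (q + 1) powr q)"
    proof (intro add_mono mult_mono)
      have "real m powr 1 \<le> real m powr (q / 2)" using m q by (intro powr_mono) auto
      then show "real m \<le> real m powr (q / 2)" using m by simp
    qed (use q in \<open>auto intro!: powr_mono2\<close>)
    finally have "real m * K \<le> 3 * (q + 1) powr q * real m powr (q / 2)" by (simp add: algebra_simps)
    from mult_right_mono[OF this E0] show ?thesis by (simp add: mult.assoc)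
  qed
  finally show "(\<integral>\<omega>. \<bar>X m \<omega>\<bar> powr q \<partial>M) \<le> 9 * (q + 1) powr q * real m powr (q / 2) * E"
    using K0 E0 by (simp add: mult_right_mono algebra_simps)
qed

end

text \<open>The convex function \<open>r powr (- a)\<close> lies above its tangent at
  \<open>r + s\<close>. In the weighted argument below, the term
  \<open>a * s * (r + s) powr (- a - 1)\<close> is the drop of the weight that pays for the
  second-order Taylor term.\<close>

lemma powr_minus_ge_tangent:
  fixes r s a :: real
  assumes "0 < r" "0 \<le> s" "0 < a"
  shows "(r + s) powr (- a) + a * s * (r + s) powr (- a - 1) \<le> r powr (- a)"
proof -
  define u where "u = r / (r + s)"
  have u: "0 < u" "u \<le> 1" using assms by (auto simp: u_def)
  have su: "s / (r + s) = 1 - u" using assms by (simp add: u_def field_simps)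
  have "1 + a * (1 - u) \<le> 1 + (- a) * ln u"
    using mult_left_mono[of "1 - u" "- ln u" a] assms u ln_le_minus_one[of u] by simp
  also have "\<dots> \<le> exp ((- a) * ln u)" by (rule exp_ge_add_one_self)
  also have "\<dots> = u powr (- a)" using u by (simp add: powr_def)
  finally have *: "1 + a * (1 - u) \<le> u powr (- a)" .
  have "(r + s) powr (- a) + a * s * (r + s) powr (- a - 1) = (r + s) powr (- a) * (1 + a * (1 - u))"
    using assms by (simp add: su[symmetric] powr_diff field_simps)
  also have "\<dots> \<le> (r + s) powr (- a) * u powr (- a)"
    by (intro mult_left_mono *) simp
  also have "\<dots> = r powr (- a)" using assms u by (simp add: u_def powr_mult[symmetric])
  finally show ?thesis .
qed

text \<open>
  Weighting \<open>|X|\<^sup>2\<^sup>p\<close> by \<open>R powr (- p / 2)\<close> lets the decrease of the weight absorb the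
  second-order Taylor term wherever \<open>|X|\<^sup>2 \<ge> 8 p R\<close>; this yields the optimal
  factor \<open>sqrt p\<close> without stopping times or maximal inequalities, at the price of \<open>2 p\<close> moments of the
  increments.
\<close>

lemma (in prob_space) martingale_rosenthal:
  fixes X D s R :: "nat \<Rightarrow> 'a \<Rightarrow> real"
  assumes p: "2 \<le> p" and \<rho>: "0 < \<rho>"
    and [measurable]: "\<And>j. X j \<in> borel_measurable M" "\<And>j. D j \<in> borel_measurable M" "\<And>j. s j \<in> borel_measurable M"
    and X0: "\<And>\<omega>. X 0 \<omega> = 0" and XS: "\<And>j \<omega>. X (Suc j) \<omega> = X j \<omega> + D j \<omega>"
    and R: "\<And>j \<omega>. R j \<omega> = \<rho> + (\<Sum>i<j. s i \<omega>)"
    and s0: "\<And>j \<omega>. \<omega> \<in> space M \<Longrightarrow> 0 \<le> s j \<omega>"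
    and si: "\<And>j. integrable M (\<lambda>\<omega>. \<bar>s j \<omega>\<bar> powr (p / 2))"
    and Di: "\<And>j. integrable M (\<lambda>\<omega>. \<bar>D j \<omega>\<bar> powr (2 * p))"
    and mart: "\<And>j. (\<integral>\<omega>. R (Suc j) \<omega> powr (- (p / 2)) * (sgn (X j \<omega>) * \<bar>X j \<omega>\<bar> powr (2 * p - 1)) * D j \<omega> \<partial>M) = 0"
    and var: "\<And>j. (\<integral>\<omega>. R (Suc j) \<omega> powr (- (p / 2)) * \<bar>X j \<omega>\<bar> powr (2 * p - 2) * (D j \<omega>)\<^sup>2 \<partial>M)
       = (\<integral>\<omega>. R (Suc j) \<omega> powr (- (p / 2)) * \<bar>X j \<omega>\<bar> powr (2 * p - 2) * s j \<omega> \<partial>M)"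
    and jumps: "2 * (2 * p + 1) powr (2 * p) * (\<Sum>j<m. \<integral>\<omega>. \<bar>D j \<omega>\<bar> powr (2 * p) \<partial>M) \<le> (8 * p) powr p * \<rho> powr p"
  shows "integrable M (\<lambda>\<omega>. R m \<omega> powr (p / 2))"
    and "integrable M (\<lambda>\<omega>. \<bar>X m \<omega>\<bar> powr p)"
    and "(\<integral>\<omega>. \<bar>X m \<omega>\<bar> powr p \<partial>M) \<le> (16 * p) powr (p / 2) * (\<integral>\<omega>. R m \<omega> powr (p / 2) \<partial>M)"
proof -
  define W where "W j \<omega> = R j \<omega> powr (- (p / 2))" for j \<omega>
  have [measurable]: "R j \<in> borel_measurable M" for j unfolding R[abs_def] by measurable
  have [measurable]: "W j \<in> borel_measurable M" for j unfolding W_def[abs_def] by measurable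
  have R\<rho>: "\<rho> \<le> R j \<omega>" if "\<omega> \<in> space M" for j \<omega>
    unfolding R using s0[OF that] by (simp add: sum_nonneg)
  have RS: "R (Suc j) \<omega> = R j \<omega> + s j \<omega>" for j \<omega> by (simp add: R)
  have Rmono: "R j \<omega> \<le> R k \<omega>" if "\<omega> \<in> space M" "j \<le> k" for j k \<omega>
    unfolding R using s0[OF that(1)] that(2) by (simp add: sum_mono2)
  have W0: "0 \<le> W j \<omega>" for j \<omega> by (simp add: W_def)
  have W\<rho>: "W j \<omega> \<le> \<rho> powr (- (p / 2))" if "\<omega> \<in> space M" for j \<omega>
    unfolding W_def using R\<rho>[OF that, of j] \<rho> p by (intro powr_mono2') auto
  have Ri: "integrable M (\<lambda>\<omega>. R j \<omega> powr (p / 2))" for j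
  proof -
    have "integrable M (\<lambda>\<omega>. \<bar>\<rho> + (\<Sum>i<j. s i \<omega>)\<bar> powr (p / 2))"
      using p by (intro integrable_powr_add integrable_powr_sum si) auto
    moreover have "\<bar>\<rho> + (\<Sum>i<j. s i \<omega>)\<bar> = R j \<omega>" if "\<omega> \<in> space M" for \<omega>
      using R\<rho>[OF that, of j] \<rho> unfolding R by simp
    ultimately show ?thesis by (simp cong: Bochner_Integration.integrable_cong)
  qed
  then show "integrable M (\<lambda>\<omega>. R m \<omega> powr (p / 2))" .
  have Xi: "integrable M (\<lambda>\<omega>. \<bar>X j \<omega>\<bar> powr (2 * p))" for j
  proof (induction j)
    case (Suc j)
    show ?case unfolding XS using Suc Di p by (intro integrable_powr_add) auto
  qed (use p in \<open>simp add: X0\<close>)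
  have bdd: "integrable M (\<lambda>\<omega>. W k \<omega> * Y \<omega>)" if "integrable M Y" for k and Y :: "'a \<Rightarrow> real"
  proof (rule Bochner_Integration.integrable_bound)
    show "integrable M (\<lambda>\<omega>. \<rho> powr (- (p / 2)) * Y \<omega>)" using that by simp
    have [measurable]: "Y \<in> borel_measurable M" using that by simp
    show "(\<lambda>\<omega>. W k \<omega> * Y \<omega>) \<in> borel_measurable M" by measurable
    show "AE \<omega> in M. norm (W k \<omega> * Y \<omega>) \<le> norm (\<rho> powr (- (p / 2)) * Y \<omega>)"
      using W\<rho> W0 by (intro AE_I2) (auto simp: abs_mult intro!: mult_right_mono)
  qed
  have I0: "integrable M (\<lambda>\<omega>. W k \<omega> * \<bar>X j \<omega>\<bar> powr (2 * p))" for j k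
    by (rule bdd) (rule Xi)
  have p2: "2 \<le> 2 * p" using p by simp
  have I1: "integrable M (\<lambda>\<omega>. W (Suc j) \<omega> * (sgn (X j \<omega>) * \<bar>X j \<omega>\<bar> powr (2 * p - 1)) * D j \<omega>)" for j
  proof -
    have "integrable M (\<lambda>\<omega>. W (Suc j) \<omega> * (\<bar>X j \<omega>\<bar> powr (2 * p - 2) * (X j \<omega> * D j \<omega>)))"
      by (rule bdd, rule integrable_powr_prod[OF p2, where X="X j" and c=1]) (use Xi Di in auto)
    moreover have "\<bar>x\<bar> powr (2 * p - 2) * (x * d) = sgn x * \<bar>x\<bar> powr (2 * p - 1) * d" for x d :: real
      by (cases "x = 0") (auto simp: powr_diff power2_eq_square sgn_if)
    ultimately show ?thesis by (simp add: mult.assoc)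
  qed
  have I2: "integrable M (\<lambda>\<omega>. W (Suc j) \<omega> * \<bar>X j \<omega>\<bar> powr (2 * p - 2) * (D j \<omega>)\<^sup>2)" for j
  proof -
    have "integrable M (\<lambda>\<omega>. W (Suc j) \<omega> * (\<bar>X j \<omega>\<bar> powr (2 * p - 2) * (D j \<omega> * D j \<omega>)))"
      by (rule bdd, rule integrable_powr_prod[OF p2, where X="X j" and c=1]) (use Xi Di in auto)
    then show ?thesis by (simp add: power2_eq_square mult.assoc)
  qed
  have I3: "integrable M (\<lambda>\<omega>. W (Suc j) \<omega> * \<bar>X j \<omega>\<bar> powr (2 * p - 2) * s j \<omega>)" for j
  proof -
    \<comment> \<open>Only \<open>p / 2\<close> moments of \<open>s j\<close> are available, but the
      weight contains it: \<open>s j \<le> R (Suc j)\<close> bounds \<open>W (Suc j) * s j\<close>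
      by \<open>\<rho> powr (1 - p / 2)\<close>. Hence the whole product serves as the factor
      \<open>U\<close>, and the other two factors are the constant 1.\<close>
    have "integrable M (\<lambda>\<omega>. (W (Suc j) \<omega> * \<bar>X j \<omega>\<bar> powr (2 * p - 2) * s j \<omega>) * (1 * 1))"
    proof (rule integrable_powr_prod[OF p2, where X="X j" and c="\<rho> powr (1 - p / 2)"])
      fix \<omega> assume w: "\<omega> \<in> space M"
      have "s j \<omega> \<le> R (Suc j) \<omega>"
        using R\<rho>[OF w, of j] \<rho> by (simp add: RS)
      then have "W (Suc j) \<omega> * s j \<omega> \<le> W (Suc j) \<omega> * R (Suc j) \<omega>" by (intro mult_left_mono W0)
      also have "\<dots> = R (Suc j) \<omega> powr (1 - p / 2)"
        using R\<rho>[OF w, of "Suc j"] \<rho> by (simp add: W_def powr_mult_base mult.commute)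
      also have "\<dots> \<le> \<rho> powr (1 - p / 2)"
        using R\<rho>[OF w, of "Suc j"] \<rho> p by (intro powr_mono2') auto
      finally have "\<bar>X j \<omega>\<bar> powr (2 * p - 2) * (W (Suc j) \<omega> * s j \<omega>) \<le> \<bar>X j \<omega>\<bar> powr (2 * p - 2) * \<rho> powr (1 - p / 2)"
        by (intro mult_left_mono) auto
      then show "\<bar>W (Suc j) \<omega> * \<bar>X j \<omega>\<bar> powr (2 * p - 2) * s j \<omega>\<bar> \<le> \<rho> powr (1 - p / 2) * \<bar>X j \<omega>\<bar> powr (2 * p - 2)"
        using s0[OF w, of j] W0[of "Suc j" \<omega>] by (simp add: abs_mult mult_ac)
    qed (use Xi in auto)
    then show ?thesis by simp
  qed
  have I4: "integrable M (\<lambda>\<omega>. s j \<omega> * R (Suc j) \<omega> powr (p / 2 - 1))" for j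
  proof (rule Bochner_Integration.integrable_bound[OF Ri[of "Suc j"]])
    show "AE \<omega> in M. norm (s j \<omega> * R (Suc j) \<omega> powr (p / 2 - 1)) \<le> norm (R (Suc j) \<omega> powr (p / 2))"
    proof (rule AE_I2)
      fix \<omega> assume w: "\<omega> \<in> space M"
      have "s j \<omega> * R (Suc j) \<omega> powr (p / 2 - 1) \<le> R (Suc j) \<omega> * R (Suc j) \<omega> powr (p / 2 - 1)"
        using R\<rho>[OF w, of j] \<rho> by (intro mult_right_mono) (auto simp: RS)
      also have "\<dots> = R (Suc j) \<omega> powr (p / 2)"
        using R\<rho>[OF w, of "Suc j"] \<rho> by (simp add: powr_mult_base)
      finally show "norm (s j \<omega> * R (Suc j) \<omega> powr (p / 2 - 1)) \<le> norm (R (Suc j) \<omega> powr (p / 2))"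
        using s0[OF w] by (simp add: abs_mult)
    qed
  qed measurable
  define c where "c = p / 2 * (8 * p) powr p"
  have c0: "0 \<le> c" using p by (simp add: c_def)
  define J where "J = 2 * (2 * p + 1) powr (2 * p) * \<rho> powr (- (p / 2))"
  have step: "(\<integral>\<omega>. W (Suc j) \<omega> * \<bar>X (Suc j) \<omega>\<bar> powr (2 * p) \<partial>M) \<le> (\<integral>\<omega>. W j \<omega> * \<bar>X j \<omega>\<bar> powr (2 * p) \<partial>M)
      + c * (\<integral>\<omega>. s j \<omega> * R (Suc j) \<omega> powr (p / 2 - 1) \<partial>M) + J * (\<integral>\<omega>. \<bar>D j \<omega>\<bar> powr (2 * p) \<partial>M)" for j
  proof -
    have "(\<integral>\<omega>. W (Suc j) \<omega> * \<bar>X (Suc j) \<omega>\<bar> powr (2 * p) \<partial>M)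
      \<le> (\<integral>\<omega>. W (Suc j) \<omega> * \<bar>X j \<omega>\<bar> powr (2 * p)
        + 2 * p * (W (Suc j) \<omega> * (sgn (X j \<omega>) * \<bar>X j \<omega>\<bar> powr (2 * p - 1)) * D j \<omega>)
        + (2 * p)\<^sup>2 * (W (Suc j) \<omega> * \<bar>X j \<omega>\<bar> powr (2 * p - 2) * (D j \<omega>)\<^sup>2)
        + J * \<bar>D j \<omega>\<bar> powr (2 * p) \<partial>M)"
    proof (rule integral_mono)
      fix \<omega> assume w: "\<omega> \<in> space M"
      have "W (Suc j) \<omega> * \<bar>X (Suc j) \<omega>\<bar> powr (2 * p) \<le> W (Suc j) \<omega> * (\<bar>X j \<omega>\<bar> powr (2 * p)
        + 2 * p * (sgn (X j \<omega>) * \<bar>X j \<omega>\<bar> powr (2 * p - 1)) * D j \<omega>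
        + (2 * p)\<^sup>2 * (\<bar>X j \<omega>\<bar> powr (2 * p - 2) * (D j \<omega>)\<^sup>2) + 2 * (2 * p + 1) powr (2 * p) * \<bar>D j \<omega>\<bar> powr (2 * p))"
        unfolding XS by (intro mult_left_mono abs_add_powr_le_taylor p2 W0)
      also have "\<dots> \<le> W (Suc j) \<omega> * (\<bar>X j \<omega>\<bar> powr (2 * p)
        + 2 * p * (sgn (X j \<omega>) * \<bar>X j \<omega>\<bar> powr (2 * p - 1)) * D j \<omega>
        + (2 * p)\<^sup>2 * (\<bar>X j \<omega>\<bar> powr (2 * p - 2) * (D j \<omega>)\<^sup>2))
        + \<rho> powr (- (p / 2)) * (2 * (2 * p + 1) powr (2 * p) * \<bar>D j \<omega>\<bar> powr (2 * p))"
        unfolding distrib_left by (intro add_left_mono mult_right_mono W\<rho>[OF w]) auto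
      finally show "W (Suc j) \<omega> * \<bar>X (Suc j) \<omega>\<bar> powr (2 * p) \<le> W (Suc j) \<omega> * \<bar>X j \<omega>\<bar> powr (2 * p)
        + 2 * p * (W (Suc j) \<omega> * (sgn (X j \<omega>) * \<bar>X j \<omega>\<bar> powr (2 * p - 1)) * D j \<omega>)
        + (2 * p)\<^sup>2 * (W (Suc j) \<omega> * \<bar>X j \<omega>\<bar> powr (2 * p - 2) * (D j \<omega>)\<^sup>2)
        + J * \<bar>D j \<omega>\<bar> powr (2 * p)"
        by (simp add: J_def algebra_simps)
    qed (intro Bochner_Integration.integrable_add integrable_mult_right I0 I1 I2 Di)+
    also have "\<dots> = (\<integral>\<omega>. W (Suc j) \<omega> * \<bar>X j \<omega>\<bar> powr (2 * p) \<partial>M)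
        + (2 * p)\<^sup>2 * (\<integral>\<omega>. W (Suc j) \<omega> * \<bar>X j \<omega>\<bar> powr (2 * p - 2) * (D j \<omega>)\<^sup>2 \<partial>M)
        + J * (\<integral>\<omega>. \<bar>D j \<omega>\<bar> powr (2 * p) \<partial>M)"
      using mart[of j] unfolding W_def[symmetric] by (simp add: I0 I1 I2 Di)
    also have "(\<integral>\<omega>. W (Suc j) \<omega> * \<bar>X j \<omega>\<bar> powr (2 * p - 2) * (D j \<omega>)\<^sup>2 \<partial>M)
        = (\<integral>\<omega>. W (Suc j) \<omega> * \<bar>X j \<omega>\<bar> powr (2 * p - 2) * s j \<omega> \<partial>M)"
      using var[of j] by (simp add: W_def)
    also have "(\<integral>\<omega>. W (Suc j) \<omega> * \<bar>X j \<omega>\<bar> powr (2 * p) \<partial>M) + (2 * p)\<^sup>2 * \<dots>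
        = (\<integral>\<omega>. W (Suc j) \<omega> * \<bar>X j \<omega>\<bar> powr (2 * p) + (2 * p)\<^sup>2 * (W (Suc j) \<omega> * \<bar>X j \<omega>\<bar> powr (2 * p - 2) * s j \<omega>) \<partial>M)"
      by (simp add: I0 I3)
    also have "\<dots> \<le> (\<integral>\<omega>. W j \<omega> * \<bar>X j \<omega>\<bar> powr (2 * p) + c * (s j \<omega> * R (Suc j) \<omega> powr (p / 2 - 1)) \<partial>M)"
    proof (rule integral_mono)
      fix \<omega> assume w: "\<omega> \<in> space M"
      let ?x = "\<bar>X j \<omega>\<bar>" and ?r = "R j \<omega>" and ?s = "s j \<omega>"
      have r: "0 < ?r" and r': "0 < ?r + ?s" using R\<rho>[OF w, of j] \<rho> s0[OF w, of j] by auto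
      \<comment> \<open>The threshold \<open>8 * p\<close> is \<open>(2 * p)\<^sup>2\<close> divided
        by \<open>p / 2\<close>, the coefficient in the drop of the weight. Above it the
        second-order term is absorbed by this drop; below it \<open>X\<close> is bounded in terms of
        \<open>R\<close>, and a term free of \<open>X\<close> remains.\<close>
      have key: "(2 * p)\<^sup>2 * ?x powr (2 * p - 2) \<le> p / 2 * (?x powr (2 * p) / (?r + ?s)) + c * (?r + ?s) powr (p - 1)"
      proof (cases "?x\<^sup>2 \<ge> 8 * p * (?r + ?s)")
        case True
        then have x0: "?x > 0" using r' p by (smt (verit) mult_pos_pos power_zero_numeral zero_less_abs_iff abs_zero)
        have "(2 * p)\<^sup>2 * ?x powr (2 * p - 2) = ?x powr (2 * p - 2) * (p / 2) * (8 * p)"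
          by (simp add: power2_eq_square)
        also have "\<dots> \<le> ?x powr (2 * p - 2) * (p / 2) * (?x\<^sup>2 / (?r + ?s))"
          using True r' p by (intro mult_left_mono) (auto simp: field_simps)
        also have "\<dots> = p / 2 * (?x powr (2 * p) / (?r + ?s))"
        proof -
          have "?x powr (2 * p - 2) * ?x\<^sup>2 = ?x powr (2 * p)"
            using x0 by (simp add: powr_diff)
          then show ?thesis by (metis mult.assoc mult.commute times_divide_eq_right)
        qed
        finally show ?thesis using c0 by (smt (verit) mult_nonneg_nonneg powr_ge_zero)
      next
        case False
        have "?x powr (2 * p - 2) = (?x\<^sup>2) powr (p - 1)"
        proof -
          have "?x\<^sup>2 = ?x powr 2" by simp
          moreover have "2 * (p - 1) = 2 * p - 2" by simp
          ultimately show ?thesis by (simp only: powr_powr)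
        qed
        also have "\<dots> \<le> (8 * p * (?r + ?s)) powr (p - 1)"
          using False p by (intro powr_mono2) auto
        also have "\<dots> = (8 * p) powr (p - 1) * (?r + ?s) powr (p - 1)"
          using p r' by (simp add: powr_mult)
        finally have "(2 * p)\<^sup>2 * ?x powr (2 * p - 2) \<le> (2 * p)\<^sup>2 * ((8 * p) powr (p - 1) * (?r + ?s) powr (p - 1))"
          by (intro mult_left_mono) auto
        also have "\<dots> = c * (?r + ?s) powr (p - 1)"
          using p by (simp add: c_def powr_diff power2_eq_square field_simps)
        finally show ?thesis using r' p by (smt (verit) divide_nonneg_pos mult_nonneg_nonneg powr_ge_zero divide_nonneg_nonneg)
      qed
      have conv: "(?r + ?s) powr (- (p / 2)) + p / 2 * ?s * (?r + ?s) powr (- (p / 2) - 1) \<le> ?r powr (- (p / 2))"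
        using r s0[OF w] p by (intro powr_minus_ge_tangent) auto
      have "W (Suc j) \<omega> * ?x powr (2 * p) + (2 * p)\<^sup>2 * (W (Suc j) \<omega> * ?x powr (2 * p - 2) * ?s)
        = W (Suc j) \<omega> * ?x powr (2 * p) + W (Suc j) \<omega> * ?s * ((2 * p)\<^sup>2 * ?x powr (2 * p - 2))"
        by (simp add: algebra_simps)
      also have "\<dots> \<le> W (Suc j) \<omega> * ?x powr (2 * p) + W (Suc j) \<omega> * ?s *
           (p / 2 * (?x powr (2 * p) / (?r + ?s)) + c * (?r + ?s) powr (p - 1))"
        using s0[OF w] W0 by (intro add_left_mono mult_left_mono key mult_nonneg_nonneg)
      also have "\<dots> = ?x powr (2 * p) * ((?r + ?s) powr (- (p / 2)) + p / 2 * ?s * (?r + ?s) powr (- (p / 2) - 1))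
          + c * (?s * ((?r + ?s) powr (- (p / 2)) * (?r + ?s) powr (p - 1)))"
      proof -
        have "(?r + ?s) powr (- (p / 2) - 1) = (?r + ?s) powr (- (p / 2)) / (?r + ?s)"
          using r' by (simp add: powr_diff)
        then show ?thesis by (simp add: W_def RS distrib_left mult_ac)
      qed
      also have "\<dots> \<le> ?x powr (2 * p) * ?r powr (- (p / 2)) + c * (?s * ((?r + ?s) powr (- (p / 2)) * (?r + ?s) powr (p - 1)))"
        by (intro add_right_mono mult_left_mono conv) simp
      also have "(?r + ?s) powr (- (p / 2)) * (?r + ?s) powr (p - 1) = (?r + ?s) powr (p / 2 - 1)"
        by (simp add: powr_add[symmetric])
      finally show "W (Suc j) \<omega> * ?x powr (2 * p) + (2 * p)\<^sup>2 * (W (Suc j) \<omega> * ?x powr (2 * p - 2) * ?s)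
         \<le> W j \<omega> * ?x powr (2 * p) + c * (?s * R (Suc j) \<omega> powr (p / 2 - 1))"
        by (simp add: W_def RS mult.commute)
    qed (intro Bochner_Integration.integrable_add integrable_mult_right I0 I3 I4)+
    also have "\<dots> = (\<integral>\<omega>. W j \<omega> * \<bar>X j \<omega>\<bar> powr (2 * p) \<partial>M) + c * (\<integral>\<omega>. s j \<omega> * R (Suc j) \<omega> powr (p / 2 - 1) \<partial>M)"
      by (simp add: I0 I4)
    finally show ?thesis by simp
  qed
  have "(\<integral>\<omega>. W k \<omega> * \<bar>X k \<omega>\<bar> powr (2 * p) \<partial>M)
      \<le> c * (\<Sum>j<k. \<integral>\<omega>. s j \<omega> * R (Suc j) \<omega> powr (p / 2 - 1) \<partial>M) + J * (\<Sum>j<k. \<integral>\<omega>. \<bar>D j \<omega>\<bar> powr (2 * p) \<partial>M)" for k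
  proof (induction k)
    case 0
    then show ?case using p by (simp add: X0)
  next
    case (Suc k)
    then show ?case using step[of k] by (simp add: algebra_simps)
  qed
  note this[of m]
  also have "(\<Sum>j<m. \<integral>\<omega>. s j \<omega> * R (Suc j) \<omega> powr (p / 2 - 1) \<partial>M)
      = (\<integral>\<omega>. (\<Sum>j<m. s j \<omega> * R (Suc j) \<omega> powr (p / 2 - 1)) \<partial>M)"
    using I4 by simp
  also have "\<dots> \<le> (\<integral>\<omega>. R m \<omega> powr (p / 2) \<partial>M)"
  proof (rule integral_mono)
    fix \<omega> assume w: "\<omega> \<in> space M"
    \<comment> \<open>The exponent \<open>p / 2 - 1\<close> is nonnegative, so each
      \<open>R (Suc j)\<close> may be raised to \<open>R m\<close>, after which the
      \<open>s j\<close> sum up to at most \<open>R m\<close>.\<close>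
    have "(\<Sum>j<m. s j \<omega> * R (Suc j) \<omega> powr (p / 2 - 1)) \<le> (\<Sum>j<m. s j \<omega> * R m \<omega> powr (p / 2 - 1))"
      using s0[OF w] Rmono[OF w] R\<rho>[OF w] \<rho> p
      by (intro sum_mono mult_left_mono powr_mono2) (auto intro: order_trans[OF less_imp_le])
    also have "\<dots> = (\<Sum>j<m. s j \<omega>) * R m \<omega> powr (p / 2 - 1)" by (simp add: sum_distrib_right)
    also have "\<dots> \<le> R m \<omega> * R m \<omega> powr (p / 2 - 1)"
      using \<rho> by (intro mult_right_mono) (auto simp: R)
    also have "\<dots> = R m \<omega> powr (p / 2)" using R\<rho>[OF w, of m] \<rho> by (simp add: powr_mult_base)
    finally show "(\<Sum>j<m. s j \<omega> * R (Suc j) \<omega> powr (p / 2 - 1)) \<le> R m \<omega> powr (p / 2)" .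
  qed (use I4 Ri in auto)
  finally have 1: "(\<integral>\<omega>. W m \<omega> * \<bar>X m \<omega>\<bar> powr (2 * p) \<partial>M)
      \<le> c * (\<integral>\<omega>. R m \<omega> powr (p / 2) \<partial>M) + J * (\<Sum>j<m. \<integral>\<omega>. \<bar>D j \<omega>\<bar> powr (2 * p) \<partial>M)"
    using c0 by (simp add: mult_left_mono)
  have "J * (\<Sum>j<m. \<integral>\<omega>. \<bar>D j \<omega>\<bar> powr (2 * p) \<partial>M) \<le> \<rho> powr (- (p / 2)) * ((8 * p) powr p * \<rho> powr p)"
    using mult_left_mono[OF jumps, of "\<rho> powr (- (p / 2))"] by (simp add: J_def mult_ac)
  also have "\<dots> = (8 * p) powr p * \<rho> powr (p / 2)"
  proof -
    have "\<rho> powr (- (p / 2)) * \<rho> powr p = \<rho> powr (p / 2)" by (simp add: powr_add[symmetric])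
    then show ?thesis by (simp add: mult.left_commute)
  qed
  also have "\<dots> \<le> (8 * p) powr p * (\<integral>\<omega>. R m \<omega> powr (p / 2) \<partial>M)"
  proof (rule mult_left_mono)
    have "(\<integral>\<omega>. \<rho> powr (p / 2) \<partial>M) \<le> (\<integral>\<omega>. R m \<omega> powr (p / 2) \<partial>M)"
      using R\<rho> \<rho> p Ri by (intro integral_mono powr_mono2) auto
    then show "\<rho> powr (p / 2) \<le> (\<integral>\<omega>. R m \<omega> powr (p / 2) \<partial>M)" by (simp add: prob_space)
  qed simp
  finally have "(\<integral>\<omega>. W m \<omega> * \<bar>X m \<omega>\<bar> powr (2 * p) \<partial>M)
      \<le> (p / 2 + 1) * (8 * p) powr p * (\<integral>\<omega>. R m \<omega> powr (p / 2) \<partial>M)"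
    using 1 by (simp add: c_def algebra_simps)
  also have "\<dots> \<le> (16 * p) powr p * (\<integral>\<omega>. R m \<omega> powr (p / 2) \<partial>M)"
  proof (rule mult_right_mono)
    \<comment> \<open>The linear factor \<open>p / 2 + 1\<close> is at most \<open>2 powr p\<close>,
      so doubling the base 8 to 16 absorbs it.\<close>
    have "p / 2 + 1 \<le> 1 + p * ln 2" using ln2_ge_two_thirds p mult_left_mono[of "1/2" "ln 2" p] by simp
    also have "\<dots> \<le> 2 powr p" unfolding powr_def using exp_ge_add_one_self[of "p * ln 2"] by simp
    finally have "(p / 2 + 1) * (8 * p) powr p \<le> 2 powr p * (8 * p) powr p" by (intro mult_right_mono) auto
    then show "(p / 2 + 1) * (8 * p) powr p \<le> (16 * p) powr p" using p by (simp add: powr_mult[symmetric])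
  qed simp
  finally have main: "(\<integral>\<omega>. W m \<omega> * \<bar>X m \<omega>\<bar> powr (2 * p) \<partial>M) \<le> (16 * p) powr p * (\<integral>\<omega>. R m \<omega> powr (p / 2) \<partial>M)" .
  \<comment> \<open>Removal of the weight: the square \<open>(x - \<beta> * y)\<^sup>2\<close> with
    \<open>x = \<bar>X m\<bar> powr p\<close> and \<open>y = R m powr (p / 2)\<close> is
    nonnegative. The choice of \<beta> balances the two resulting terms, since the weighted moment
    is at most \<open>\<beta>\<^sup>2\<close> times the integral of \<open>y\<close>.\<close>
  define \<beta> where "\<beta> = (16 * p) powr (p / 2)"
  have \<beta>: "0 < \<beta>" and \<beta>2: "(16 * p) powr p = \<beta> * \<beta>"
    using p by (auto simp: \<beta>_def powr_add[symmetric])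
  have pw: "\<bar>X m \<omega>\<bar> powr p \<le> (W m \<omega> * \<bar>X m \<omega>\<bar> powr (2 * p) / \<beta> + \<beta> * R m \<omega> powr (p / 2)) / 2" if w: "\<omega> \<in> space M" for \<omega>
  proof -
    let ?x = "\<bar>X m \<omega>\<bar> powr p" and ?y = "R m \<omega> powr (p / 2)"
    have y: "?y > 0" using R\<rho>[OF w, of m] \<rho> by simp
    have "W m \<omega> * \<bar>X m \<omega>\<bar> powr (2 * p) = ?x\<^sup>2 / ?y"
    proof -
      have "\<bar>X m \<omega>\<bar> powr (2 * p) = ?x\<^sup>2" by (simp add: power2_eq_square powr_add[symmetric])
      then show ?thesis by (simp add: W_def powr_minus field_simps)
    qed
    moreover have "2 * ?x \<le> ?x\<^sup>2 / ?y / \<beta> + \<beta> * ?y"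
    proof -
      have "0 \<le> (?x - \<beta> * ?y)\<^sup>2 / (?y * \<beta>)" using y \<beta> by simp
      also have "\<dots> = ?x\<^sup>2 / ?y / \<beta> + \<beta> * ?y - 2 * ?x" using y \<beta> by (simp add: power2_eq_square field_simps)
      finally show ?thesis by simp
    qed
    ultimately show ?thesis by simp
  qed
  have I5: "integrable M (\<lambda>\<omega>. (W m \<omega> * \<bar>X m \<omega>\<bar> powr (2 * p) / \<beta> + \<beta> * R m \<omega> powr (p / 2)) / 2)"
    using I0 Ri by simp
  show Xp: "integrable M (\<lambda>\<omega>. \<bar>X m \<omega>\<bar> powr p)"
    by (rule Bochner_Integration.integrable_bound[OF I5]) (use order_trans[OF pw abs_ge_self] in \<open>auto intro!: AE_I2\<close>)
  have "(\<integral>\<omega>. \<bar>X m \<omega>\<bar> powr p \<partial>M) \<le> (\<integral>\<omega>. (W m \<omega> * \<bar>X m \<omega>\<bar> powr (2 * p) / \<beta> + \<beta> * R m \<omega> powr (p / 2)) / 2 \<partial>M)"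
    by (rule integral_mono[OF Xp I5 pw])
  also have "\<dots> = ((\<integral>\<omega>. W m \<omega> * \<bar>X m \<omega>\<bar> powr (2 * p) \<partial>M) / \<beta> + \<beta> * (\<integral>\<omega>. R m \<omega> powr (p / 2) \<partial>M)) / 2"
    using I0 Ri by simp
  also have "\<dots> \<le> \<beta> * (\<integral>\<omega>. R m \<omega> powr (p / 2) \<partial>M)"
    using main \<beta> unfolding \<beta>2 by (simp add: field_simps)
  finally show "(\<integral>\<omega>. \<bar>X m \<omega>\<bar> powr p \<partial>M) \<le> (16 * p) powr (p / 2) * (\<integral>\<omega>. R m \<omega> powr (p / 2) \<partial>M)"
    by (simp add: \<beta>_def)
qed

section \<open>The Markov property of the canonical chain\<close>

lemma measurable_kernel_pow:
  assumes "Q \<in> M \<rightarrow>\<^sub>M prob_algebra M"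
  shows "kernel_pow M Q n \<in> M \<rightarrow>\<^sub>M prob_algebra M"
proof (induction n)
  case 0
  have "kernel_pow M Q 0 = return M" by (simp add: fun_eq_iff)
  then show ?case by (simp add: measurable_return_prob_space)
next
  case (Suc n)
  have "kernel_pow M Q (Suc n) = (\<lambda>z. kernel_pow M Q n z \<bind> Q)" by (simp add: fun_eq_iff)
  then show ?case using measurable_bind_prob_space[OF Suc assms] by simp
qed

locale markov_chain =
  fixes M :: "'a measure" and Q :: "'a \<Rightarrow> 'a measure" and \<xi> :: "'a measure"
  assumes Q [measurable]: "Q \<in> M \<rightarrow>\<^sub>M prob_algebra M"
    and \<xi>: "\<xi> \<in> space (prob_algebra M)"
begin

abbreviation "P \<equiv> chain_law M Q \<xi>"

sublocale P: prob_space P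
  by (rule prob_space_chain_law[OF Q \<xi>])

lemma sets_P [measurable_cong]: "sets P = sets (PiM UNIV (\<lambda>_. M))"
  by (rule sets_chain_law[OF Q \<xi>])

lemma space_P: "space P = space (PiM UNIV (\<lambda>_. M))"
  by (rule sets_eq_imp_space_eq[OF sets_P])

lemma coord_in_space [simp]: "\<omega> \<in> space P \<Longrightarrow> \<omega> k \<in> space M"
  by (auto simp: space_P space_PiM)

lemma Q_sub [measurable]: "Q \<in> M \<rightarrow>\<^sub>M subprob_algebra M"
  by (rule measurable_prob_algebraD[OF Q])

lemma kernel_pow_prob [measurable]: "kernel_pow M Q n \<in> M \<rightarrow>\<^sub>M prob_algebra M"
  by (rule measurable_kernel_pow[OF Q])

lemma kernel_pow_sub [measurable]: "kernel_pow M Q n \<in> M \<rightarrow>\<^sub>M subprob_algebra M"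
  by (rule measurable_prob_algebraD[OF kernel_pow_prob])

lemma sets_kernel_pow [simp]: "z \<in> space M \<Longrightarrow> sets (kernel_pow M Q n z) = sets M"
  using measurable_space[OF kernel_pow_sub[of n], of z] by (simp add: space_subprob_algebra)

lemma space_kernel_pow [simp]: "z \<in> space M \<Longrightarrow> space (kernel_pow M Q n z) = space M"
  by (rule sets_eq_imp_space_eq) simp

lemma nn_integral_kernel_pow_Suc:
  assumes [measurable]: "\<phi> \<in> borel_measurable M" and z: "z \<in> space M"
  shows "(\<integral>\<^sup>+y. \<phi> y \<partial>kernel_pow M Q (Suc n) z) = (\<integral>\<^sup>+y. (\<integral>\<^sup>+x. \<phi> x \<partial>Q y) \<partial>kernel_pow M Q n z)"
proof -
  have "Q \<in> kernel_pow M Q n z \<rightarrow>\<^sub>M subprob_algebra M"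
    using z by (simp cong: measurable_cong_sets)
  then show ?thesis using z by (simp add: nn_integral_bind[where B=M])
qed

text \<open>The law of the chain is a projective limit, accessible through its finite marginals. For
  an initial segment the marginal is the iterated kernel \<open>C\<close>, from which the last
  coordinate can be integrated out; this rests on \<open>up_to {0..<n} = n\<close>.\<close>

lemma distr_P_initial_segment:
  "distr P (PiM {0..<n} (\<lambda>_. M)) (\<lambda>\<omega>. restrict \<omega> {0..<n})
    = Ionescu_Tulcea.C (chain_step \<xi> Q) (\<lambda>_. M) 0 n (\<lambda>_. undefined)"
proof -
  interpret IT: Ionescu_Tulcea "chain_step \<xi> Q" "\<lambda>_. M"
    by (rule Ionescu_Tulcea_chain_step[OF Q \<xi>])
  have u: "IT.up_to {0..<n} = n"
  proof (rule antisym)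
    show "IT.up_to {0..<n} \<le> n" by (subst IT.up_to_iff) auto
    show "n \<le> IT.up_to {0..<n}"
      using IT.up_to_less[of "{0..<n}" "n - 1"] by (cases n) auto
  qed
  have x: "(\<lambda>_. undefined) \<in> space (PiM {0..<0::nat} (\<lambda>_. M))" by simp
  have s: "sets (IT.C 0 n (\<lambda>_. undefined)) = sets (PiM {0..<n} (\<lambda>_. M))"
    using IT.sets_C[OF x, of n] by simp
  have "distr P (PiM {0..<n} (\<lambda>_. M)) (\<lambda>\<omega>. restrict \<omega> {0..<n}) = IT.CI {0..<n}"
    by (rule distr_chain_law[OF Q \<xi>]) simp
  also have "\<dots> = distr (IT.C 0 n (\<lambda>_. undefined)) (IT.C 0 n (\<lambda>_. undefined)) (\<lambda>\<omega>. \<omega>)"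
    unfolding IT.CI_def u
  proof (rule distr_cong)
    fix \<omega> assume "\<omega> \<in> space (IT.C 0 n (\<lambda>_. undefined))"
    then have "\<omega> \<in> space (PiM {0..<n} (\<lambda>_. M))" by (simp add: sets_eq_imp_space_eq[OF s])
    then show "restrict \<omega> {0..<n} = \<omega>" by (simp add: space_PiM PiE_restrict)
  qed (simp_all add: s)
  also have "\<dots> = IT.C 0 n (\<lambda>_. undefined)" by (rule distr_id)
  finally show ?thesis .
qed

text \<open>The first \<open>n + 1\<close> coordinates arise from the first \<open>n\<close> by one
  draw from \<open>chain_step\<close>, so the integral over the composed kernel is an iterated one.
  At \<open>n = 0\<close> the draw is from the initial law.\<close>

lemma nn_integral_P_segment_Suc:
  assumes v [measurable]: "v \<in> borel_measurable (PiM {0..<Suc n} (\<lambda>_. M))"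
  shows "(\<integral>\<^sup>+\<omega>. v (restrict \<omega> {0..<Suc n}) \<partial>P) =
    (\<integral>\<^sup>+\<omega>. (\<integral>\<^sup>+z. v (fun_upd (restrict \<omega> {0..<n}) n z) \<partial>chain_step \<xi> Q n (restrict \<omega> {0..<n})) \<partial>P)"
proof -
  interpret IT: Ionescu_Tulcea "chain_step \<xi> Q" "\<lambda>_. M"
    by (rule Ionescu_Tulcea_chain_step[OF Q \<xi>])
  let ?u = "\<lambda>_::nat. undefined::'a"
  have x: "?u \<in> space (PiM {0..<0::nat} (\<lambda>_. M))" by simp
  have s: "sets (IT.C 0 n ?u) = sets (PiM {0..<n} (\<lambda>_. M))"
    using IT.sets_C[OF x, of n] by simp
  have r [measurable]: "(\<lambda>\<omega>. restrict \<omega> {0..<k}) \<in> P \<rightarrow>\<^sub>M PiM {0..<k} (\<lambda>_. M)" for k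
    using measurable_restrict_subset[of "{0..<k}" UNIV "\<lambda>_. M"]
    by (simp cong: measurable_cong_sets add: sets_P)
  have inner: "(\<lambda>\<omega>. \<integral>\<^sup>+z. v (fun_upd \<omega> n z) \<partial>chain_step \<xi> Q n \<omega>) \<in> borel_measurable (PiM {0..<n} (\<lambda>_. M))"
  proof (rule nn_integral_measurable_subprob_algebra2)
    show "chain_step \<xi> Q n \<in> PiM {0..<n} (\<lambda>_. M) \<rightarrow>\<^sub>M subprob_algebra M" by (rule IT.P)
    have "(\<lambda>(\<omega>, z). fun_upd \<omega> n z) \<in> PiM {0..<n} (\<lambda>_. M) \<Otimes>\<^sub>M M \<rightarrow>\<^sub>M PiM (insert n {0..<n}) (\<lambda>_. M)"
      using measurable_add_dim[of n "{0..<n}" "\<lambda>_. M"] by simp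
    moreover have "insert n {0..<n} = {0..<Suc n}" by auto
    ultimately have "(\<lambda>(\<omega>, z). fun_upd \<omega> n z) \<in> PiM {0..<n} (\<lambda>_. M) \<Otimes>\<^sub>M M \<rightarrow>\<^sub>M PiM {0..<Suc n} (\<lambda>_. M)" by simp
    from measurable_compose[OF this v]
    show "(\<lambda>(\<omega>, z). v (fun_upd \<omega> n z)) \<in> borel_measurable (PiM {0..<n} (\<lambda>_. M) \<Otimes>\<^sub>M M)"
      by (simp add: split_beta')
  qed
  have "(\<integral>\<^sup>+\<omega>. v (restrict \<omega> {0..<Suc n}) \<partial>P)
      = (\<integral>\<^sup>+\<omega>. v \<omega> \<partial>distr P (PiM {0..<Suc n} (\<lambda>_. M)) (\<lambda>\<omega>. restrict \<omega> {0..<Suc n}))"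
    by (rule nn_integral_distr[OF r, symmetric]) (simp add: v)
  also have "\<dots> = (\<integral>\<^sup>+\<omega>. v \<omega> \<partial>(IT.C 0 n ?u \<bind> IT.eP n))"
    unfolding distr_P_initial_segment by simp
  also have "\<dots> = (\<integral>\<^sup>+\<omega>. (\<integral>\<^sup>+\<omega>'. v \<omega>' \<partial>IT.eP n \<omega>) \<partial>IT.C 0 n ?u)"
    using IT.measurable_eP[of n] s
    by (intro nn_integral_bind[where B="PiM {0..<Suc n} (\<lambda>_. M)"]) (simp_all cong: measurable_cong_sets)
  also have "\<dots> = (\<integral>\<^sup>+\<omega>. (\<integral>\<^sup>+z. v (fun_upd \<omega> n z) \<partial>chain_step \<xi> Q n \<omega>) \<partial>IT.C 0 n ?u)"
    by (intro nn_integral_cong IT.nn_integral_eP) (simp_all add: sets_eq_imp_space_eq[OF s])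
  also have "\<dots> = (\<integral>\<^sup>+\<omega>. (\<integral>\<^sup>+z. v (fun_upd \<omega> n z) \<partial>chain_step \<xi> Q n \<omega>)
      \<partial>distr P (PiM {0..<n} (\<lambda>_. M)) (\<lambda>\<omega>. restrict \<omega> {0..<n}))"
    unfolding distr_P_initial_segment by simp
  also have "\<dots> = (\<integral>\<^sup>+\<omega>. (\<integral>\<^sup>+z. v (fun_upd (restrict \<omega> {0..<n}) n z) \<partial>chain_step \<xi> Q n (restrict \<omega> {0..<n})) \<partial>P)"
    by (rule nn_integral_distr[OF r]) (simp add: inner)
  finally show ?thesis .
qed

lemma nn_integral_P_initial:
  assumes [measurable]: "\<phi> \<in> borel_measurable M"
  shows "(\<integral>\<^sup>+\<omega>. \<phi> (\<omega> 0) \<partial>P) = (\<integral>\<^sup>+z. \<phi> z \<partial>\<xi>)"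
proof -
  have "(\<lambda>\<omega>. \<phi> (\<omega> 0)) \<in> borel_measurable (PiM {0..<Suc 0} (\<lambda>_. M))" by measurable
  from nn_integral_P_segment_Suc[OF this] show ?thesis
    by (simp add: chain_step_def P.emeasure_space_1)
qed

lemma nn_integral_P_step:
  assumes u [measurable]: "case_prod u \<in> borel_measurable (PiM {0..<Suc k} (\<lambda>_. M) \<Otimes>\<^sub>M M)"
  shows "(\<integral>\<^sup>+\<omega>. u (restrict \<omega> {0..<Suc k}) (\<omega> (Suc k)) \<partial>P)
    = (\<integral>\<^sup>+\<omega>. (\<integral>\<^sup>+z. u (restrict \<omega> {0..<Suc k}) z \<partial>Q (\<omega> k)) \<partial>P)"
proof -
  let ?v = "\<lambda>\<omega>. u (restrict \<omega> {0..<Suc k}) (\<omega> (Suc k))"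
  have "?v \<in> borel_measurable (PiM {0..<Suc (Suc k)} (\<lambda>_. M))"
  proof -
    have "(\<lambda>\<omega>. (restrict \<omega> {0..<Suc k}, \<omega> (Suc k))) \<in> PiM {0..<Suc (Suc k)} (\<lambda>_. M) \<rightarrow>\<^sub>M PiM {0..<Suc k} (\<lambda>_. M) \<Otimes>\<^sub>M M"
      by (intro measurable_Pair measurable_restrict_subset measurable_component_singleton) auto
    from measurable_compose[OF this u] show ?thesis by simp
  qed
  from nn_integral_P_segment_Suc[OF this]
  have "(\<integral>\<^sup>+\<omega>. ?v (restrict \<omega> {0..<Suc (Suc k)}) \<partial>P) = (\<integral>\<^sup>+\<omega>. (\<integral>\<^sup>+z. ?v (fun_upd (restrict \<omega> {0..<Suc k}) (Suc k) z)
      \<partial>chain_step \<xi> Q (Suc k) (restrict \<omega> {0..<Suc k})) \<partial>P)" .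
  moreover have "restrict (restrict \<omega> {0..<Suc (Suc k)}) {0..<Suc k} = restrict \<omega> {0..<Suc k}" for \<omega> :: "nat \<Rightarrow> 'a"
    by auto
  moreover have "restrict (fun_upd (restrict \<omega> {0..<Suc k}) (Suc k) z) {0..<Suc k} = restrict \<omega> {0..<Suc k}" for \<omega> :: "nat \<Rightarrow> 'a" and z
    by auto
  ultimately show ?thesis by (simp add: chain_step_def)
qed

text \<open>The natural filtration, with time \<open>k\<close> included. It is pulled back from a
  finite product, so that each of its events is a cylinder to which the one-step formula
  applies.\<close>

definition Fil :: "nat \<Rightarrow> (nat \<Rightarrow> 'a) measure" where
  "Fil k = vimage_algebra (space P) (\<lambda>\<omega>. restrict \<omega> {0..<Suc k}) (PiM {0..<Suc k} (\<lambda>_. M))"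

lemma space_Fil [simp]: "space (Fil k) = space P"
  by (simp add: Fil_def)

lemma restrict_in: "(\<lambda>\<omega>. restrict \<omega> {0..<k}) \<in> space P \<rightarrow> space (PiM {0..<k} (\<lambda>_. M))"
  by (auto simp: space_P space_PiM)

lemma measurable_restrict_Fil: "j \<le> k \<Longrightarrow> (\<lambda>\<omega>. restrict \<omega> {0..<Suc j}) \<in> Fil k \<rightarrow>\<^sub>M PiM {0..<Suc j} (\<lambda>_. M)"
proof -
  assume j: "j \<le> k"
  have 1: "(\<lambda>\<omega>. restrict \<omega> {0..<Suc k}) \<in> Fil k \<rightarrow>\<^sub>M PiM {0..<Suc k} (\<lambda>_. M)"
    unfolding Fil_def by (rule measurable_vimage_algebra1[OF restrict_in])
  have 2: "(\<lambda>\<omega>. restrict \<omega> {0..<Suc j}) \<in> PiM {0..<Suc k} (\<lambda>_. M) \<rightarrow>\<^sub>M PiM {0..<Suc j} (\<lambda>_. M)"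
    using j by (intro measurable_restrict_subset) auto
  have "restrict (restrict \<omega> {0..<Suc k}) {0..<Suc j} = restrict \<omega> {0..<Suc j}" for \<omega> :: "nat \<Rightarrow> 'a"
    using j by auto
  with measurable_compose[OF 1 2] show ?thesis by simp
qed

lemma measurable_coord_Fil: "i \<le> k \<Longrightarrow> (\<lambda>\<omega>. \<omega> i) \<in> Fil k \<rightarrow>\<^sub>M M"
  using measurable_compose[OF measurable_restrict_Fil[OF order_refl, of k] measurable_component_singleton[of i "{0..<Suc k}" "\<lambda>_. M"]]
  by (simp add: less_Suc_eq_le)

lemma Fil_mono: "j \<le> k \<Longrightarrow> sets (Fil j) \<subseteq> sets (Fil k)"
proof
  fix A assume j: "j \<le> k" and A: "A \<in> sets (Fil j)"
  then obtain B where "B \<in> sets (PiM {0..<Suc j} (\<lambda>_. M))" "A = (\<lambda>\<omega>. restrict \<omega> {0..<Suc j}) -` B \<inter> space P"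
    unfolding Fil_def by (auto simp: sets_vimage_algebra2[OF restrict_in])
  with measurable_sets[OF measurable_restrict_Fil[OF j], of B] show "A \<in> sets (Fil k)" by simp
qed

lemma subalgebra_Fil: "subalgebra P (Fil k)"
proof -
  have "(\<lambda>\<omega>. restrict \<omega> {0..<Suc k}) \<in> P \<rightarrow>\<^sub>M PiM {0..<Suc k} (\<lambda>_. M)"
    using measurable_restrict_subset[of "{0..<Suc k}" UNIV "\<lambda>_. M"]
    by (simp cong: measurable_cong_sets add: sets_P)
  from measurable_sets[OF this] show ?thesis
    unfolding subalgebra_def Fil_def by (auto simp: sets_vimage_algebra2[OF restrict_in])
qed

lemma measurable_Fil_mono: "F \<in> borel_measurable (Fil j) \<Longrightarrow> j \<le> k \<Longrightarrow> F \<in> borel_measurable (Fil k)"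
  using Fil_mono[of j k] by (auto simp: measurable_def)

lemma measurable_Fil_P: "F \<in> borel_measurable (Fil j) \<Longrightarrow> F \<in> borel_measurable P"
  by (rule measurable_from_subalg[OF subalgebra_Fil])

text \<open>Induction peels off the last transition: an event of \<open>Fil k\<close> also lies in
  \<open>Fil (k + l)\<close>, and integrating \<phi> against \<open>Q\<close> leaves the same claim
  for \<open>l\<close> steps.\<close>

lemma nn_integral_P_markov:
  assumes A: "A \<in> sets (Fil k)" and "\<phi> \<in> borel_measurable M"
  shows "(\<integral>\<^sup>+\<omega>. indicator A \<omega> * \<phi> (\<omega> (k + l)) \<partial>P)
    = (\<integral>\<^sup>+\<omega>. indicator A \<omega> * (\<integral>\<^sup>+z. \<phi> z \<partial>kernel_pow M Q l (\<omega> k)) \<partial>P)"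
  using assms(2)
proof (induction l arbitrary: \<phi>)
  case 0
  note [measurable] = 0
  show ?case by (intro nn_integral_cong) (simp add: nn_integral_return)
next
  case (Suc l)
  note [measurable] = Suc.prems
  obtain B where B [measurable]: "B \<in> sets (PiM {0..<Suc (k + l)} (\<lambda>_. M))" "A = (\<lambda>\<omega>. restrict \<omega> {0..<Suc (k + l)}) -` B \<inter> space P"
    using subsetD[OF Fil_mono A, of "k + l"] unfolding Fil_def by (auto simp: sets_vimage_algebra2[OF restrict_in])
  have ind: "indicator A \<omega> = (indicator B (restrict \<omega> {0..<Suc (k + l)}) :: ennreal)" if "\<omega> \<in> space P" for \<omega>
    using that by (simp add: B(2) indicator_def)
  have "(\<integral>\<^sup>+\<omega>. indicator A \<omega> * \<phi> (\<omega> (k + Suc l)) \<partial>P)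
      = (\<integral>\<^sup>+\<omega>. indicator B (restrict \<omega> {0..<Suc (k + l)}) * \<phi> (\<omega> (Suc (k + l))) \<partial>P)"
    by (intro nn_integral_cong) (simp add: ind)
  also have "\<dots> = (\<integral>\<^sup>+\<omega>. (\<integral>\<^sup>+z. indicator B (restrict \<omega> {0..<Suc (k + l)}) * \<phi> z \<partial>Q (\<omega> (k + l))) \<partial>P)"
    by (rule nn_integral_P_step[where u="\<lambda>\<omega> z. indicator B \<omega> * \<phi> z"]) measurable
  also have "\<dots> = (\<integral>\<^sup>+\<omega>. indicator A \<omega> * (\<integral>\<^sup>+z. \<phi> z \<partial>Q (\<omega> (k + l))) \<partial>P)"
  proof (rule nn_integral_cong)
    fix \<omega> assume w: "\<omega> \<in> space P"
    have "sets (Q (\<omega> (k + l))) = sets M"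
      using measurable_space[OF Q_sub coord_in_space[OF w]] by (simp add: space_subprob_algebra)
    then have "\<phi> \<in> borel_measurable (Q (\<omega> (k + l)))" by (simp cong: measurable_cong_sets)
    then show "(\<integral>\<^sup>+z. indicator B (restrict \<omega> {0..<Suc (k + l)}) * \<phi> z \<partial>Q (\<omega> (k + l)))
        = indicator A \<omega> * (\<integral>\<^sup>+z. \<phi> z \<partial>Q (\<omega> (k + l)))"
      by (simp add: ind[OF w] nn_integral_cmult)
  qed
  also have "\<dots> = (\<integral>\<^sup>+\<omega>. indicator A \<omega> * (\<integral>\<^sup>+y. (\<integral>\<^sup>+z. \<phi> z \<partial>Q y) \<partial>kernel_pow M Q l (\<omega> k)) \<partial>P)"
    by (rule Suc.IH) measurable
  also have "\<dots> = (\<integral>\<^sup>+\<omega>. indicator A \<omega> * (\<integral>\<^sup>+z. \<phi> z \<partial>kernel_pow M Q (Suc l) (\<omega> k)) \<partial>P)"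
    by (intro nn_integral_cong arg_cong2[where f="(*)"] refl nn_integral_kernel_pow_Suc[symmetric]) auto
  finally show ?case .
qed

lemma measurable_lebesgue_kernel_pow [measurable]:
  fixes \<phi> :: "'a \<Rightarrow> real"
  assumes "\<phi> \<in> borel_measurable M"
  shows "(\<lambda>z. \<integral>y. \<phi> y \<partial>kernel_pow M Q l z) \<in> borel_measurable M"
  by (rule measurable_compose[OF kernel_pow_sub integral_measurable_subprob_algebra[OF assms]])

text \<open>The nonnegative version identifies the kernel integral with the conditional expectation
  given \<open>Fil k\<close>. Pulling out what is known then admits an unbounded factor
  \<open>F\<close>, as long as the product is integrable.\<close>

lemma integral_P_markov:
  fixes F :: "(nat \<Rightarrow> 'a) \<Rightarrow> real" and \<phi> :: "'a \<Rightarrow> real"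
  assumes F: "F \<in> borel_measurable (Fil k)" and [measurable]: "\<phi> \<in> borel_measurable M"
    and i1: "integrable P (\<lambda>\<omega>. \<phi> (\<omega> (k + l)))" and i2: "integrable P (\<lambda>\<omega>. F \<omega> * \<phi> (\<omega> (k + l)))"
    and fin: "\<And>z. z \<in> space M \<Longrightarrow> integrable (kernel_pow M Q l z) \<phi>"
  shows "integrable P (\<lambda>\<omega>. F \<omega> * (\<integral>y. \<phi> y \<partial>kernel_pow M Q l (\<omega> k)))"
    and "(\<integral>\<omega>. F \<omega> * \<phi> (\<omega> (k + l)) \<partial>P) = (\<integral>\<omega>. F \<omega> * (\<integral>y. \<phi> y \<partial>kernel_pow M Q l (\<omega> k)) \<partial>P)"
proof -
  interpret fs: finite_measure_subalgebra P "Fil k"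
    by standard (rule subalgebra_Fil)
  let ?K = "\<lambda>\<omega>. \<integral>y. \<phi> y \<partial>kernel_pow M Q l (\<omega> k)"
  have Kf: "?K \<in> borel_measurable (Fil k)"
    by (rule measurable_compose[OF measurable_coord_Fil[OF order_refl]]) measurable
  have [measurable]: "?K \<in> borel_measurable P" by (rule measurable_Fil_P[OF Kf])
  have pos: "(\<integral>\<^sup>+\<omega>. ennreal (indicator A \<omega> * \<psi> (\<omega> (k + l))) \<partial>P)
      = (\<integral>\<^sup>+\<omega>. ennreal (indicator A \<omega> * (\<integral>y. \<psi> y \<partial>kernel_pow M Q l (\<omega> k))) \<partial>P)"
    if A: "A \<in> sets (Fil k)" and [measurable]: "\<psi> \<in> borel_measurable M" and p0: "\<And>z. 0 \<le> \<psi> z"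
      and fi: "\<And>z. z \<in> space M \<Longrightarrow> integrable (kernel_pow M Q l z) \<psi>" for A and \<psi> :: "'a \<Rightarrow> real"
  proof -
    have "(\<integral>\<^sup>+\<omega>. ennreal (indicator A \<omega> * \<psi> (\<omega> (k + l))) \<partial>P) = (\<integral>\<^sup>+\<omega>. indicator A \<omega> * ennreal (\<psi> (\<omega> (k + l))) \<partial>P)"
      by (intro nn_integral_cong) (auto simp: indicator_def)
    also have "\<dots> = (\<integral>\<^sup>+\<omega>. indicator A \<omega> * (\<integral>\<^sup>+z. ennreal (\<psi> z) \<partial>kernel_pow M Q l (\<omega> k)) \<partial>P)"
      by (rule nn_integral_P_markov[OF A]) measurable
    also have "\<dots> = (\<integral>\<^sup>+\<omega>. ennreal (indicator A \<omega> * (\<integral>y. \<psi> y \<partial>kernel_pow M Q l (\<omega> k))) \<partial>P)"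
      by (intro nn_integral_cong) (auto simp: indicator_def nn_integral_eq_integral fi p0)
    finally show ?thesis .
  qed
  \<comment> \<open>The nonnegative identity applies to each sign part; finiteness of the integrals
    then permits the subtraction.\<close>
  let ?p = "\<lambda>z. max 0 (\<phi> z)" and ?m = "\<lambda>z. max 0 (- \<phi> z)"
  have fp: "integrable (kernel_pow M Q l z) ?p" "integrable (kernel_pow M Q l z) ?m" if "z \<in> space M" for z
    using fin[OF that] by auto
  have ip: "integrable P (\<lambda>\<omega>. ?p (\<omega> (k + l)))" "integrable P (\<lambda>\<omega>. ?m (\<omega> (k + l)))"
    using i1 by auto
  have kp: "integrable P (\<lambda>\<omega>. \<integral>y. \<psi> y \<partial>kernel_pow M Q l (\<omega> k))"
    and eq: "A \<in> sets (Fil k) \<Longrightarrow> (\<integral>\<omega>. indicator A \<omega> * \<psi> (\<omega> (k + l)) \<partial>P) = (\<integral>\<omega>. indicator A \<omega> * (\<integral>y. \<psi> y \<partial>kernel_pow M Q l (\<omega> k)) \<partial>P)"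
    if [measurable]: "\<psi> \<in> borel_measurable M" and p0: "\<And>z. 0 \<le> \<psi> z" and ps: "integrable P (\<lambda>\<omega>. \<psi> (\<omega> (k + l)))"
      and fi: "\<And>z. z \<in> space M \<Longrightarrow> integrable (kernel_pow M Q l z) \<psi>" for A and \<psi> :: "'a \<Rightarrow> real"
  proof -
    have S: "space P \<in> sets (Fil k)" using sets.top[of "Fil k"] by simp
    show "integrable P (\<lambda>\<omega>. \<integral>y. \<psi> y \<partial>kernel_pow M Q l (\<omega> k))"
    proof (intro integrableI_nonneg)
      have "(\<integral>\<^sup>+\<omega>. ennreal (\<integral>y. \<psi> y \<partial>kernel_pow M Q l (\<omega> k)) \<partial>P) = (\<integral>\<^sup>+\<omega>. ennreal (indicator (space P) \<omega> * (\<integral>y. \<psi> y \<partial>kernel_pow M Q l (\<omega> k))) \<partial>P)"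
        by (intro nn_integral_cong) simp
      also have "\<dots> = (\<integral>\<^sup>+\<omega>. ennreal (indicator (space P) \<omega> * \<psi> (\<omega> (k + l))) \<partial>P)"
        by (rule pos[OF S that(1) p0 fi, symmetric])
      also have "\<dots> = (\<integral>\<^sup>+\<omega>. ennreal (\<psi> (\<omega> (k + l))) \<partial>P)"
        by (intro nn_integral_cong) simp
      also have "\<dots> < \<infinity>" using ps p0 by (simp add: nn_integral_eq_integral)
      finally show "(\<integral>\<^sup>+\<omega>. ennreal (\<integral>y. \<psi> y \<partial>kernel_pow M Q l (\<omega> k)) \<partial>P) < \<infinity>" .
    qed (auto intro!: integral_nonneg_AE simp: p0)
    assume A: "A \<in> sets (Fil k)"
    then have [measurable]: "A \<in> sets P" using subalgebra_Fil[of k] by (auto simp: subalgebra_def)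
    show "(\<integral>\<omega>. indicator A \<omega> * \<psi> (\<omega> (k + l)) \<partial>P) = (\<integral>\<omega>. indicator A \<omega> * (\<integral>y. \<psi> y \<partial>kernel_pow M Q l (\<omega> k)) \<partial>P)"
      using pos[OF A that(1) p0 fi] by (simp add: integral_eq_nn_integral p0 integral_nonneg_AE)
  qed
  have split: "\<phi> z = ?p z - ?m z" for z by simp
  have Ksplit: "?K \<omega> = (\<integral>y. ?p y \<partial>kernel_pow M Q l (\<omega> k)) - (\<integral>y. ?m y \<partial>kernel_pow M Q l (\<omega> k))" if "\<omega> \<in> space P" for \<omega>
  proof -
    have "?K \<omega> = (\<integral>y. ?p y - ?m y \<partial>kernel_pow M Q l (\<omega> k))" by (simp add: split[symmetric])
    also have "\<dots> = (\<integral>y. ?p y \<partial>kernel_pow M Q l (\<omega> k)) - (\<integral>y. ?m y \<partial>kernel_pow M Q l (\<omega> k))"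
      by (rule Bochner_Integration.integral_diff) (use fp that in auto)
    finally show ?thesis .
  qed
  have kpp: "integrable P (\<lambda>\<omega>. \<integral>y. ?p y \<partial>kernel_pow M Q l (\<omega> k))" by (rule kp) (use ip fp in auto)
  have kpm: "integrable P (\<lambda>\<omega>. \<integral>y. ?m y \<partial>kernel_pow M Q l (\<omega> k))" by (rule kp) (use ip fp in auto)
  have Ki: "integrable P ?K"
    using Bochner_Integration.integrable_diff[OF kpp kpm] by (simp add: Ksplit cong: Bochner_Integration.integrable_cong)
  have AEq: "AE \<omega> in P. real_cond_exp P (Fil k) (\<lambda>\<omega>. \<phi> (\<omega> (k + l))) \<omega> = ?K \<omega>"
  proof (rule fs.real_cond_exp_charact[OF _ i1 Ki Kf])
    fix A assume A: "A \<in> sets (Fil k)"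
    then have [measurable]: "A \<in> sets P" using subalgebra_Fil[of k] by (auto simp: subalgebra_def)
    have ii: "integrable P (\<lambda>\<omega>. indicator A \<omega> * h \<omega>)" if "integrable P h" for h :: "_ \<Rightarrow> real"
      using integrable_mult_indicator[OF \<open>A \<in> sets P\<close> that] by simp
    have "(\<integral>\<omega>. indicator A \<omega> * \<phi> (\<omega> (k + l)) \<partial>P)
        = (\<integral>\<omega>. indicator A \<omega> * ?p (\<omega> (k + l)) - indicator A \<omega> * ?m (\<omega> (k + l)) \<partial>P)"
      by (intro Bochner_Integration.integral_cong) (auto simp: right_diff_distrib[symmetric] split[symmetric])
    also have "\<dots> = (\<integral>\<omega>. indicator A \<omega> * ?p (\<omega> (k + l)) \<partial>P) - (\<integral>\<omega>. indicator A \<omega> * ?m (\<omega> (k + l)) \<partial>P)"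
      by (rule Bochner_Integration.integral_diff) (rule ii, rule ip)+
    also have "(\<integral>\<omega>. indicator A \<omega> * ?p (\<omega> (k + l)) \<partial>P) = (\<integral>\<omega>. indicator A \<omega> * (\<integral>y. ?p y \<partial>kernel_pow M Q l (\<omega> k)) \<partial>P)"
      by (rule eq) (use ip fp A in auto)
    also have "(\<integral>\<omega>. indicator A \<omega> * ?m (\<omega> (k + l)) \<partial>P) = (\<integral>\<omega>. indicator A \<omega> * (\<integral>y. ?m y \<partial>kernel_pow M Q l (\<omega> k)) \<partial>P)"
      by (rule eq) (use ip fp A in auto)
    also have "(\<integral>\<omega>. indicator A \<omega> * (\<integral>y. ?p y \<partial>kernel_pow M Q l (\<omega> k)) \<partial>P) - (\<integral>\<omega>. indicator A \<omega> * (\<integral>y. ?m y \<partial>kernel_pow M Q l (\<omega> k)) \<partial>P)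
       = (\<integral>\<omega>. indicator A \<omega> * (\<integral>y. ?p y \<partial>kernel_pow M Q l (\<omega> k)) - indicator A \<omega> * (\<integral>y. ?m y \<partial>kernel_pow M Q l (\<omega> k)) \<partial>P)"
      by (rule Bochner_Integration.integral_diff[symmetric]) (rule ii, rule kpp kpm)+
    also have "\<dots> = (\<integral>\<omega>. indicator A \<omega> * ?K \<omega> \<partial>P)"
      by (intro Bochner_Integration.integral_cong) (auto simp: Ksplit right_diff_distrib)
    finally show "(\<integral>\<omega>\<in>A. \<phi> (\<omega> (k + l)) \<partial>P) = (\<integral>\<omega>\<in>A. ?K \<omega> \<partial>P)"
      by (simp add: set_lebesgue_integral_def)
  qed
  have mm: "(\<lambda>\<omega>. \<phi> (\<omega> (k + l))) \<in> borel_measurable P" using i1 by simp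
  note FP [measurable] = measurable_Fil_P[OF F]
  have AE2: "AE \<omega> in P. F \<omega> * real_cond_exp P (Fil k) (\<lambda>\<omega>. \<phi> (\<omega> (k + l))) \<omega> = F \<omega> * ?K \<omega>"
    using AEq by eventually_elim simp
  show "integrable P (\<lambda>\<omega>. F \<omega> * ?K \<omega>)"
    using fs.real_cond_exp_intg(1)[OF i2 F mm] by (rule integrable_cong_AE_imp) (use AE2 in auto)
  have "(\<integral>\<omega>. F \<omega> * \<phi> (\<omega> (k + l)) \<partial>P) = (\<integral>\<omega>. F \<omega> * real_cond_exp P (Fil k) (\<lambda>\<omega>. \<phi> (\<omega> (k + l))) \<omega> \<partial>P)"
    by (rule fs.real_cond_exp_intg(2)[OF i2 F mm, symmetric])
  also have "\<dots> = (\<integral>\<omega>. F \<omega> * ?K \<omega> \<partial>P)"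
    by (rule integral_cong_AE) (use AE2 in auto)
  finally show "(\<integral>\<omega>. F \<omega> * \<phi> (\<omega> (k + l)) \<partial>P) = (\<integral>\<omega>. F \<omega> * ?K \<omega> \<partial>P)" .
qed

end

section \<open>Consequences of V-uniform geometric ergodicity\<close>

definition sum_measure :: "'a measure \<Rightarrow> 'a measure \<Rightarrow> 'a measure" where
  "sum_measure \<mu> \<nu> = measure_of (space \<mu>) (sets \<mu>) (\<lambda>A. emeasure \<mu> A + emeasure \<nu> A)"

lemma sets_sum_measure [simp]: "sets (sum_measure \<mu> \<nu>) = sets \<mu>"
  by (simp add: sum_measure_def)

lemma emeasure_sum_measure:
  assumes s: "sets \<nu> = sets \<mu>" and A: "A \<in> sets \<mu>"
  shows "emeasure (sum_measure \<mu> \<nu>) A = emeasure \<mu> A + emeasure \<nu> A"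
  unfolding sum_measure_def
proof (rule emeasure_measure_of_sigma)
  show "sigma_algebra (space \<mu>) (sets \<mu>)" ..
  show "positive (sets \<mu>) (\<lambda>A. emeasure \<mu> A + emeasure \<nu> A)" by (simp add: positive_def)
  show "countably_additive (sets \<mu>) (\<lambda>A. emeasure \<mu> A + emeasure \<nu> A)"
    by (rule countably_additiveI) (simp add: suminf_add[symmetric] suminf_emeasure s)
qed (rule A)

lemma nn_integral_sum_measure:
  assumes s: "sets \<nu> = sets \<mu>" and u: "u \<in> borel_measurable \<mu>"
  shows "(\<integral>\<^sup>+x. u x \<partial>sum_measure \<mu> \<nu>) = (\<integral>\<^sup>+x. u x \<partial>\<mu>) + (\<integral>\<^sup>+x. u x \<partial>\<nu>)"
proof -
  let ?K = "sum_measure \<mu> \<nu>"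
  note m = measurable_cong_sets[OF s refl] measurable_cong_sets[OF sets_sum_measure refl]
  note sp = sets_eq_imp_space_eq[OF s] sets_eq_imp_space_eq[OF sets_sum_measure]
  show ?thesis using u
  proof (induction rule: borel_measurable_induct)
    case (cong f g)
    have "integral\<^sup>N ?K g = integral\<^sup>N ?K f" "integral\<^sup>N \<mu> g = integral\<^sup>N \<mu> f" "integral\<^sup>N \<nu> g = integral\<^sup>N \<nu> f"
      using cong.hyps(3) by (auto intro!: nn_integral_cong simp: sp)
    then show ?case using cong.IH by simp
  next
    case (set A)
    then show ?case by (simp add: emeasure_sum_measure s)
  next
    case (mult u c)
    then show ?case by (simp add: nn_integral_cmult m distrib_left)
  next
    case (add u v)
    then show ?case by (simp add: nn_integral_add m add_ac)
  next
    case (seq U)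
    have mono: "incseq (\<lambda>i. integral\<^sup>N K (U i))" for K
      using \<open>incseq U\<close> by (auto simp: incseq_def le_fun_def intro!: nn_integral_mono)
    have eq: "integral\<^sup>N K (Sup (range U)) = (SUP i. integral\<^sup>N K (U i))" if "sets K = sets \<mu>" for K
    proof -
      have "U i \<in> borel_measurable K" for i
        using seq.hyps(1)[of i] by (simp add: measurable_cong_sets[OF that])
      note nn_integral_monotone_convergence_SUP[OF \<open>incseq U\<close> this]
      moreover have "Sup (range U) = (\<lambda>x. SUP i. U i x)" by (simp add: fun_eq_iff image_comp)
      ultimately show ?thesis by simp
    qed
    show ?case
      unfolding eq[OF sets_sum_measure] eq[OF refl] eq[OF s] seq.IH
      by (rule ennreal_SUP_add[OF mono mono])
  qed
qed

text \<open>Domination on measurable sets says that \<open>N\<close> lies below the sum of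
  \<open>N'\<close> and \<open>T\<close> as a measure; the integral is monotone and additive in the
  measure. Total variation bounds pass to integrals in this way without densities.\<close>

lemma nn_integral_le_add_measure:
  assumes s: "sets N' = sets N" "sets T = sets N"
    and le: "\<And>A. A \<in> sets N \<Longrightarrow> emeasure N A \<le> emeasure N' A + emeasure T A"
    and u: "u \<in> borel_measurable N"
  shows "(\<integral>\<^sup>+x. u x \<partial>N) \<le> (\<integral>\<^sup>+x. u x \<partial>N') + (\<integral>\<^sup>+x. u x \<partial>T)"
proof -
  have "N \<le> sum_measure N' T"
    by (subst le_measure) (simp_all add: s emeasure_sum_measure le)
  then have "(\<integral>\<^sup>+x. u x \<partial>N) \<le> (\<integral>\<^sup>+x. u x \<partial>sum_measure N' T)"
    by (intro nn_integral_mono_measure) (simp_all add: s)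
  then show ?thesis
    using nn_integral_sum_measure[of T N' u] u by (simp add: s measurable_cong_sets[OF s(1)])
qed

lemma nn_integral_add_measure_le:
  assumes s: "sets N' = sets N" "sets T = sets N"
    and le: "\<And>A. A \<in> sets N \<Longrightarrow> emeasure N' A + emeasure T A \<le> emeasure N A"
    and u: "u \<in> borel_measurable N"
  shows "(\<integral>\<^sup>+x. u x \<partial>N') + (\<integral>\<^sup>+x. u x \<partial>T) \<le> (\<integral>\<^sup>+x. u x \<partial>N)"
proof -
  have "sum_measure N' T \<le> N"
    by (subst le_measure) (simp_all add: s emeasure_sum_measure le)
  then have "(\<integral>\<^sup>+x. u x \<partial>sum_measure N' T) \<le> (\<integral>\<^sup>+x. u x \<partial>N)"
    by (intro nn_integral_mono_measure) (simp_all add: s)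
  then show ?thesis
    using nn_integral_sum_measure[of T N' u] u by (simp add: s measurable_cong_sets[OF s(1)])
qed

section \<open>Kernel powers as laws of the chain started at a point\<close>

context markov_chain
begin

lemma prob_space_kernel_pow: "z \<in> space M \<Longrightarrow> prob_space (kernel_pow M Q k z)"
  using measurable_space[OF kernel_pow_prob, of z k] by (simp add: space_prob_algebra)

lemma markov_chain_return: "z \<in> space M \<Longrightarrow> markov_chain M Q (return M z)"
  by unfold_locales (use measurable_space[OF measurable_return_prob_space, of z M] in auto)

lemma coord_measurable [measurable]: "(\<lambda>\<omega>. \<omega> k) \<in> P \<rightarrow>\<^sub>M M"
  by (simp cong: measurable_cong_sets add: sets_P)

lemma nn_integral_coord:
  assumes [measurable]: "\<phi> \<in> borel_measurable M"
  shows "(\<integral>\<^sup>+\<omega>. \<phi> (\<omega> k) \<partial>P) = (\<integral>\<^sup>+z. (\<integral>\<^sup>+y. \<phi> y \<partial>kernel_pow M Q k z) \<partial>\<xi>)"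
proof -
  have "space P \<in> sets (Fil 0)" using sets.top[of "Fil 0"] by simp
  from nn_integral_P_markov[OF this assms, of k]
  have "(\<integral>\<^sup>+\<omega>. \<phi> (\<omega> k) \<partial>P) = (\<integral>\<^sup>+\<omega>. (\<integral>\<^sup>+y. \<phi> y \<partial>kernel_pow M Q k (\<omega> 0)) \<partial>P)"
    by (simp cong: nn_integral_cong)
  also have "\<dots> = (\<integral>\<^sup>+z. (\<integral>\<^sup>+y. \<phi> y \<partial>kernel_pow M Q k z) \<partial>\<xi>)"
    by (rule nn_integral_P_initial) measurable
  finally show ?thesis .
qed

text \<open>Identifying a kernel power with the law of a coordinate makes the Markov property on
  path space available for statements about kernels alone.\<close>

lemma distr_coord_return:
  assumes z: "z \<in> space M"
  shows "distr (chain_law M Q (return M z)) M (\<lambda>\<omega>. \<omega> k) = kernel_pow M Q k z"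
proof -
  interpret R: markov_chain M Q "return M z" by (rule markov_chain_return[OF z])
  show ?thesis
  proof (rule measure_eqI)
    fix A assume "A \<in> sets (distr R.P M (\<lambda>\<omega>. \<omega> k))"
    then have A [measurable]: "A \<in> sets M" by simp
    have "emeasure (distr R.P M (\<lambda>\<omega>. \<omega> k)) A = (\<integral>\<^sup>+\<omega>. indicator A (\<omega> k) \<partial>R.P)"
      by (subst nn_integral_indicator[symmetric], simp) (rule nn_integral_distr, auto)
    also have "\<dots> = (\<integral>\<^sup>+z. (\<integral>\<^sup>+y. indicator A y \<partial>kernel_pow M Q k z) \<partial>return M z)"
      by (rule R.nn_integral_coord) measurable
    also have "\<dots> = (\<integral>\<^sup>+y. indicator A y \<partial>kernel_pow M Q k z)"
      by (rule nn_integral_return[OF z]) measurable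
    also have "\<dots> = emeasure (kernel_pow M Q k z) A" using z by simp
    finally show "emeasure (distr R.P M (\<lambda>\<omega>. \<omega> k)) A = emeasure (kernel_pow M Q k z) A" .
  qed (use z in simp)
qed

text \<open>Chapman-Kolmogorov for real functions, read off from the Markov property at time
  \<open>k\<close> of the chain started in \<open>z\<close>.\<close>

lemma integral_kernel_pow_add:
  fixes \<phi> :: "'a \<Rightarrow> real"
  assumes [measurable]: "\<phi> \<in> borel_measurable M" and z: "z \<in> space M"
    and fin: "\<And>y k. y \<in> space M \<Longrightarrow> integrable (kernel_pow M Q k y) \<phi>"
  shows "integrable (kernel_pow M Q k z) (\<lambda>y. \<integral>x. \<phi> x \<partial>kernel_pow M Q l y)"
    and "(\<integral>x. \<phi> x \<partial>kernel_pow M Q (k + l) z) = (\<integral>y. (\<integral>x. \<phi> x \<partial>kernel_pow M Q l y) \<partial>kernel_pow M Q k z)"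
proof -
  interpret R: markov_chain M Q "return M z" by (rule markov_chain_return[OF z])
  have i: "integrable R.P (\<lambda>\<omega>. \<phi> (\<omega> (k + l)))"
    using fin[OF z, of "k + l"] unfolding distr_coord_return[OF z, symmetric]
    by (simp add: integrable_distr_eq)
  have i1: "integrable R.P (\<lambda>\<omega>. \<integral>x. \<phi> x \<partial>kernel_pow M Q l (\<omega> k))"
    and e: "(\<integral>\<omega>. \<phi> (\<omega> (k + l)) \<partial>R.P) = (\<integral>\<omega>. (\<integral>x. \<phi> x \<partial>kernel_pow M Q l (\<omega> k)) \<partial>R.P)"
    using R.integral_P_markov[of "\<lambda>_. 1" k \<phi> l] i fin by simp_all
  show "integrable (kernel_pow M Q k z) (\<lambda>y. \<integral>x. \<phi> x \<partial>kernel_pow M Q l y)"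
    using i1 unfolding distr_coord_return[OF z, symmetric] by (simp add: integrable_distr_eq)
  show "(\<integral>x. \<phi> x \<partial>kernel_pow M Q (k + l) z) = (\<integral>y. (\<integral>x. \<phi> x \<partial>kernel_pow M Q l y) \<partial>kernel_pow M Q k z)"
    using e unfolding distr_coord_return[OF z, of k, symmetric] distr_coord_return[OF z, of "k + l", symmetric]
    by (simp add: integral_distr)
qed

end

section \<open>The ergodicity assumption in terms of total variation measures\<close>

lemma invariant_distrD:
  assumes "invariant_distr M Q \<pi>"
  shows "\<pi> \<in> space (prob_algebra M)" "prob_space \<pi>" "sets \<pi> = sets M" "space \<pi> = space M" "\<pi> \<bind> Q = \<pi>"
  using assms by (auto simp: invariant_distr_def space_prob_algebra dest: sets_eq_imp_space_eq)

locale vge_chain =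
  fixes M :: "'a measure" and Q :: "'a \<Rightarrow> 'a measure" and V :: "'a \<Rightarrow> real"
    and \<pi> :: "'a measure" and \<tau> :: nat and \<kappa> :: real
  assumes V [measurable]: "V \<in> borel_measurable M" and V_ge: "\<And>z. z \<in> space M \<Longrightarrow> exp 1 \<le> V z"
    and Q_prob: "Q \<in> M \<rightarrow>\<^sub>M prob_algebra M"
    and VGE: "VGE M Q V \<pi> \<tau> \<kappa>"

sublocale vge_chain \<subseteq> markov_chain M Q \<pi>
  using Q_prob VGE by unfold_locales (auto simp: VGE_def invariant_distr_def)

context vge_chain
begin

lemma inv: "invariant_distr M Q \<pi>" and tau: "1 \<le> \<tau>" and kappa: "1 \<le> \<kappa>"
  and V_nn_fin: "(\<integral>\<^sup>+z. ennreal (V z) \<partial>\<pi>) < \<infinity>"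
  using VGE by (auto simp: VGE_def)

lemmas sets_pi [measurable_cong] = invariant_distrD(3)[OF inv]
lemmas space_pi [simp] = invariant_distrD(4)[OF inv]

lemma measurable_pi [simp]: "measurable \<pi> N = measurable M N"
  by (rule measurable_cong_sets[OF sets_pi refl])

sublocale \<pi>: prob_space \<pi> by (rule invariant_distrD(2)[OF inv])

lemma V_pos: "z \<in> space M \<Longrightarrow> 0 < V z" and V_ge1: "z \<in> space M \<Longrightarrow> 1 \<le> V z" and V_ge2: "z \<in> space M \<Longrightarrow> 2 \<le> V z"
  using V_ge[of z] exp_ge_add_one_self[of 1] by auto

lemma V_int [simp]: "integrable \<pi> V"
  by (rule integrableI_nonneg) (use V_nn_fin V_pos in \<open>auto intro!: AE_I2 less_imp_le\<close>)

definition v :: real where "v = (\<integral>z. V z \<partial>\<pi>)"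

lemma v_ge2: "2 \<le> v"
proof -
  have "(\<integral>z. 2 \<partial>\<pi>) \<le> v"
    unfolding v_def by (rule integral_mono) (use V_ge2 in auto)
  then show ?thesis using \<pi>.prob_space by simp
qed

lemma v_nn: "(\<integral>\<^sup>+z. ennreal (V z) \<partial>\<pi>) = ennreal v"
  unfolding v_def by (rule nn_integral_eq_integral) (use V_pos in \<open>auto intro!: AE_I2 less_imp_le\<close>)

lemma nn_integral_pi_kernel_pow:
  assumes [measurable]: "\<phi> \<in> borel_measurable M"
  shows "(\<integral>\<^sup>+z. (\<integral>\<^sup>+y. \<phi> y \<partial>kernel_pow M Q k z) \<partial>\<pi>) = (\<integral>\<^sup>+z. \<phi> z \<partial>\<pi>)"
  using assms
proof (induction k arbitrary: \<phi>)
  case 0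
  then show ?case by (intro nn_integral_cong) (simp add: nn_integral_return)
next
  case (Suc k)
  note [measurable] = Suc.prems
  have "(\<integral>\<^sup>+z. (\<integral>\<^sup>+y. \<phi> y \<partial>kernel_pow M Q (Suc k) z) \<partial>\<pi>)
      = (\<integral>\<^sup>+z. (\<integral>\<^sup>+y. (\<integral>\<^sup>+x. \<phi> x \<partial>Q y) \<partial>kernel_pow M Q k z) \<partial>\<pi>)"
    by (intro nn_integral_cong nn_integral_kernel_pow_Suc) auto
  also have "\<dots> = (\<integral>\<^sup>+y. (\<integral>\<^sup>+x. \<phi> x \<partial>Q y) \<partial>\<pi>)" by (rule Suc.IH) measurable
  also have "\<dots> = (\<integral>\<^sup>+x. \<phi> x \<partial>(\<pi> \<bind> Q))"
    using Q_sub by (intro nn_integral_bind[symmetric, where B=M]) (auto cong: measurable_cong_sets simp: sets_pi)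
  finally show ?case by (simp add: invariant_distrD(5)[OF inv])
qed

lemma distr_coord: "distr P M (\<lambda>\<omega>. \<omega> k) = \<pi>"
proof (rule measure_eqI)
  fix A assume "A \<in> sets (distr P M (\<lambda>\<omega>. \<omega> k))"
  then have A [measurable]: "A \<in> sets M" by simp
  have "emeasure (distr P M (\<lambda>\<omega>. \<omega> k)) A = (\<integral>\<^sup>+\<omega>. indicator A (\<omega> k) \<partial>P)"
    by (subst nn_integral_indicator[symmetric], simp) (rule nn_integral_distr, auto)
  also have "\<dots> = emeasure \<pi> A"
    by (simp add: nn_integral_coord nn_integral_pi_kernel_pow sets_pi)
  finally show "emeasure (distr P M (\<lambda>\<omega>. \<omega> k)) A = emeasure \<pi> A" .
qed (simp add: sets_pi)

lemma integrable_coord: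
  fixes \<phi> :: "'a \<Rightarrow> real"
  assumes [measurable]: "\<phi> \<in> borel_measurable M"
  shows "integrable P (\<lambda>\<omega>. \<phi> (\<omega> k)) \<longleftrightarrow> integrable \<pi> \<phi>"
  using integrable_distr_eq[of "\<lambda>\<omega>. \<omega> k" P M \<phi>] by (simp add: distr_coord)

lemma integral_coord:
  fixes \<phi> :: "'a \<Rightarrow> real"
  assumes [measurable]: "\<phi> \<in> borel_measurable M"
  shows "(\<integral>\<omega>. \<phi> (\<omega> k) \<partial>P) = (\<integral>z. \<phi> z \<partial>\<pi>)"
  using integral_distr[of "\<lambda>\<omega>. \<omega> k" P M \<phi>] by (simp add: distr_coord)

definition TV :: "nat \<Rightarrow> 'a \<Rightarrow> 'a \<Rightarrow> 'a measure" where
  "TV k z z' = total_variation M (\<lambda>A. measure (kernel_pow M Q k z) A - measure (kernel_pow M Q k z') A)"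

lemma sets_TV [simp, measurable_cong]: "sets (TV k z z') = sets M"
  by (simp add: TV_def total_variation_def)

lemma space_TV [simp]: "space (TV k z z') = space M"
  by (rule sets_eq_imp_space_eq) simp

lemma measurable_TV [simp]: "measurable (TV k z z') N = measurable M N"
  by (rule measurable_cong_sets[OF sets_TV refl])

lemma emeasure_TV:
  assumes "z \<in> space M" "z' \<in> space M" "X \<in> sets M"
  shows "emeasure (TV k z z') X = (SUP P\<in>meas_partitions M X. \<Sum>B\<in>P. ennreal \<bar>measure (kernel_pow M Q k z) B - measure (kernel_pow M Q k z') B\<bar>)"
  unfolding TV_def
  using prob_space_kernel_pow[OF assms(1), of k] prob_space_kernel_pow[OF assms(2), of k] assms
  by (intro emeasure_total_variation_diff) (auto simp: prob_space.finite_measure)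

lemma emeasure_TV_ge:
  assumes "z \<in> space M" "z' \<in> space M" "X \<in> sets M"
  shows "ennreal \<bar>measure (kernel_pow M Q k z) X - measure (kernel_pow M Q k z') X\<bar> \<le> emeasure (TV k z z') X"
proof -
  have "{X} \<in> meas_partitions M X" using assms(3) by (auto simp: meas_partitions_def)
  then have "(\<Sum>B\<in>{X}. ennreal \<bar>measure (kernel_pow M Q k z) B - measure (kernel_pow M Q k z') B\<bar>) \<le> emeasure (TV k z z') X"
    unfolding emeasure_TV[OF assms] by (rule SUP_upper)
  then show ?thesis by simp
qed

text \<open>Both kernel laws have mass 1, and over any partition the absolute differences sum up to
  at most the sum of the two masses.\<close>

lemma emeasure_TV_space:
  assumes "z \<in> space M" "z' \<in> space M"
  shows "emeasure (TV k z z') (space M) \<le> 2"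
  unfolding emeasure_TV[OF assms sets.top]
proof (rule SUP_least)
  fix R assume R: "R \<in> meas_partitions M (space M)"
  have one: "(\<Sum>B\<in>R. measure (kernel_pow M Q k y) B) = 1" if y: "y \<in> space M" for y
  proof -
    interpret K: prob_space "kernel_pow M Q k y" by (rule prob_space_kernel_pow[OF y])
    have "(\<Sum>B\<in>R. measure (kernel_pow M Q k y) B) = measure (kernel_pow M Q k y) (\<Union>B\<in>R. B)"
    proof (rule K.finite_measure_finite_Union[symmetric])
      show "disjoint_family_on (\<lambda>B. B) R"
        using R by (auto simp: meas_partitions_def disjoint_family_on_def pairwise_def disjnt_def)
    qed (use R y in \<open>auto simp: meas_partitions_def\<close>)
    also have "(\<Union>B\<in>R. B) = space (kernel_pow M Q k y)" using R y by (simp add: meas_partitions_def)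
    finally show ?thesis using K.prob_space by simp
  qed
  have "(\<Sum>B\<in>R. ennreal \<bar>measure (kernel_pow M Q k z) B - measure (kernel_pow M Q k z') B\<bar>)
      = ennreal (\<Sum>B\<in>R. \<bar>measure (kernel_pow M Q k z) B - measure (kernel_pow M Q k z') B\<bar>)"
    by (simp add: sum_ennreal)
  also have "\<dots> \<le> ennreal (\<Sum>B\<in>R. measure (kernel_pow M Q k z) B + measure (kernel_pow M Q k z') B)"
    by (intro ennreal_leI sum_mono) (simp add: abs_le_iff add_increasing add_increasing2)
  also have "\<dots> = 2" by (simp add: sum.distrib one assms)
  finally show "(\<Sum>B\<in>R. ennreal \<bar>measure (kernel_pow M Q k z) B - measure (kernel_pow M Q k z') B\<bar>) \<le> 2" .
qed

definition rate :: "nat \<Rightarrow> 'a \<Rightarrow> 'a \<Rightarrow> real" where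
  "rate k z z' = \<kappa> * (1/4) ^ (k div \<tau>) * (V z + V z')"

lemma rate_pos: "z \<in> space M \<Longrightarrow> z' \<in> space M \<Longrightarrow> 0 < rate k z z'"
  using V_pos[of z] V_pos[of z'] kappa by (simp add: rate_def)

lemma nn_integral_V_TV:
  assumes "z \<in> space M" "z' \<in> space M"
  shows "(\<integral>\<^sup>+x. ennreal (V x) \<partial>TV k z z') \<le> ennreal (rate k z z')"
proof -
  let ?I = "\<integral>\<^sup>+x. ennreal (V x) \<partial>TV k z z'" and ?c = "ennreal (V z + V z')"
  \<comment> \<open>The sum of weights is positive and finite, so the division inside the supremum
    can be undone.\<close>
  have c: "?c \<noteq> 0" "?c \<noteq> \<infinity>" using V_pos[OF assms(1)] V_pos[OF assms(2)] by auto
  have "?I / ?c \<le> (SUP (z, z')\<in>space M \<times> space M.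
             signed_norm M V
               (\<lambda>A. measure (kernel_pow M Q k z) A - measure (kernel_pow M Q k z') A)
             / ennreal (V z + V z'))"
    unfolding TV_def using assms by (intro SUP_upper2[of "(z, z')"]) (auto simp: signed_norm_def)
  also have "\<dots> \<le> ennreal (\<kappa> * (1/4) ^ (k div \<tau>))" using VGE by (simp add: VGE_def)
  finally have "?I / ?c * ?c \<le> ennreal (\<kappa> * (1/4) ^ (k div \<tau>)) * ?c" by (rule mult_right_mono) simp
  moreover have "?I / ?c * ?c = ?I"
    using c by (simp add: ennreal_divide_times ennreal_divide_self top.not_eq_extremum)
  ultimately show ?thesis
    using kappa V_pos[OF assms(1)] V_pos[OF assms(2)] by (simp add: rate_def ennreal_mult)
qed

lemma nn_integral_kernel_le_TV:
  assumes "z \<in> space M" "z' \<in> space M" "u \<in> borel_measurable M"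
  shows "(\<integral>\<^sup>+x. u x \<partial>kernel_pow M Q k z) \<le> (\<integral>\<^sup>+x. u x \<partial>kernel_pow M Q k z') + (\<integral>\<^sup>+x. u x \<partial>TV k z z')"
proof (rule nn_integral_le_add_measure)
  interpret K: prob_space "kernel_pow M Q k z" by (rule prob_space_kernel_pow[OF assms(1)])
  interpret K': prob_space "kernel_pow M Q k z'" by (rule prob_space_kernel_pow[OF assms(2)])
  fix A assume "A \<in> sets (kernel_pow M Q k z)"
  then have A: "A \<in> sets M" using assms by simp
  have "emeasure (kernel_pow M Q k z) A \<le> ennreal (measure (kernel_pow M Q k z') A + \<bar>measure (kernel_pow M Q k z) A - measure (kernel_pow M Q k z') A\<bar>)"
    unfolding K.emeasure_eq_measure by (intro ennreal_leI) linarith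
  also have "\<dots> = emeasure (kernel_pow M Q k z') A + ennreal \<bar>measure (kernel_pow M Q k z) A - measure (kernel_pow M Q k z') A\<bar>"
    by (simp add: K'.emeasure_eq_measure)
  also have "\<dots> \<le> emeasure (kernel_pow M Q k z') A + emeasure (TV k z z') A"
    by (intro add_left_mono emeasure_TV_ge assms A)
  finally show "emeasure (kernel_pow M Q k z) A \<le> emeasure (kernel_pow M Q k z') A + emeasure (TV k z z') A" .
qed (use assms in \<open>auto cong: measurable_cong_sets\<close>)

text \<open>Invariance and the finite mean of \<open>V\<close> under \<pi> give one state from which
  \<open>V\<close> has finite mean after \<open>k\<close> steps; the ergodicity bound transports
  finiteness to every state.\<close>

lemma V_kernel_int:
  assumes z: "z \<in> space M"
  shows "integrable (kernel_pow M Q k z) V"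
proof -
  have "\<exists>z'\<in>space M. (\<integral>\<^sup>+x. ennreal (V x) \<partial>kernel_pow M Q k z') \<noteq> \<infinity>"
  proof (rule ccontr)
    assume "\<not> ?thesis"
    then have "(\<integral>\<^sup>+z. (\<integral>\<^sup>+x. ennreal (V x) \<partial>kernel_pow M Q k z) \<partial>\<pi>) = (\<integral>\<^sup>+z. \<infinity> \<partial>\<pi>)"
      by (intro nn_integral_cong) auto
    then show False using V_nn_fin by (simp add: nn_integral_pi_kernel_pow \<pi>.emeasure_space_1[simplified] ennreal_top_mult)
  qed
  then obtain z' where z': "z' \<in> space M" "(\<integral>\<^sup>+x. ennreal (V x) \<partial>kernel_pow M Q k z') \<noteq> \<infinity>" by auto
  have "(\<integral>\<^sup>+x. ennreal (V x) \<partial>kernel_pow M Q k z) \<le> (\<integral>\<^sup>+x. ennreal (V x) \<partial>kernel_pow M Q k z') + (\<integral>\<^sup>+x. ennreal (V x) \<partial>TV k z z')"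
    by (rule nn_integral_kernel_le_TV[OF z z'(1)]) measurable
  also have "\<dots> < \<infinity>"
    using z'(2) nn_integral_V_TV[OF z z'(1), of k] by (auto simp: less_top[symmetric] top_unique)
  finally show ?thesis
    using V_pos z by (intro integrableI_nonneg) (auto intro!: AE_I2 less_imp_le cong: measurable_cong_sets)
qed

lemma powr_V_le: "z \<in> space M \<Longrightarrow> s \<le> 1 \<Longrightarrow> V z powr s \<le> V z"
  using powr_mono[of s 1 "V z"] V_ge1[of z] by simp

lemma bdd_kernel_int:
  assumes [measurable]: "\<phi> \<in> borel_measurable M" and b: "\<And>z. z \<in> space M \<Longrightarrow> \<bar>\<phi> z\<bar> \<le> C * V z powr s" and s: "s \<le> 1" and z: "z \<in> space M"
  shows "integrable (kernel_pow M Q k z) \<phi>"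
proof (rule Bochner_Integration.integrable_bound)
  show "integrable (kernel_pow M Q k z) (\<lambda>z. \<bar>C\<bar> * V z)" by (intro integrable_mult_right V_kernel_int z)
  show "\<phi> \<in> borel_measurable (kernel_pow M Q k z)" using z by (simp cong: measurable_cong_sets)
  have "\<bar>\<phi> x\<bar> \<le> \<bar>C\<bar> * V x" if "x \<in> space M" for x
    by (rule order_trans[OF b[OF that] mult_mono]) (use powr_V_le[OF that s] in auto)
  then show "AE x in kernel_pow M Q k z. norm (\<phi> x) \<le> norm (\<bar>C\<bar> * V x)"
    using z V_pos by (intro AE_I2) (auto simp: abs_mult less_imp_le)
qed

lemma bdd_pi_int:
  assumes [measurable]: "\<phi> \<in> borel_measurable M" and b: "\<And>z. z \<in> space M \<Longrightarrow> \<bar>\<phi> z\<bar> \<le> C * V z powr s" and s: "s \<le> 1"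
  shows "integrable \<pi> \<phi>"
proof (rule Bochner_Integration.integrable_bound)
  show "integrable \<pi> (\<lambda>z. \<bar>C\<bar> * V z)" by simp
  have "\<bar>\<phi> x\<bar> \<le> \<bar>C\<bar> * V x" if "x \<in> space M" for x
    by (rule order_trans[OF b[OF that] mult_mono]) (use powr_V_le[OF that s] in auto)
  then show "AE x in \<pi>. norm (\<phi> x) \<le> norm (\<bar>C\<bar> * V x)"
    using V_pos by (intro AE_I2) (auto simp: abs_mult less_imp_le)
qed simp

text \<open>Jensen's inequality by the tangent at \<open>t = rate k z z'\<close>: the total
  variation measure has mass at most 2 and integrates \<open>V\<close> to at most \<open>t\<close>,
  whence the constant \<open>3 = 2 + 1\<close>.\<close>

lemma nn_integral_powr_V_TV:
  assumes z: "z \<in> space M" "z' \<in> space M" and s: "0 < s" "s \<le> 1" and C: "0 \<le> C"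
    and b: "\<And>x. x \<in> space M \<Longrightarrow> \<phi> x \<le> C * V x powr s"
  shows "(\<integral>\<^sup>+x. ennreal (\<phi> x) \<partial>TV k z z') \<le> ennreal (3 * C * rate k z z' powr s)"
proof -
  let ?t = "rate k z z'"
  have t: "0 < ?t" by (rule rate_pos[OF z])
  have "(\<integral>\<^sup>+x. ennreal (\<phi> x) \<partial>TV k z z') \<le> (\<integral>\<^sup>+x. ennreal (C * ?t powr s) + ennreal (C * ?t powr s / ?t) * ennreal (V x) \<partial>TV k z z')"
  proof (rule nn_integral_mono)
    fix x assume "x \<in> space (TV k z z')"
    then have x: "x \<in> space M" by simp
    have "V x powr s \<le> ?t powr s * (1 - s + s * (V x / ?t))"
      using V_pos[OF x] t s by (intro powr_le_tangent) auto
    also have "\<dots> \<le> ?t powr s * (1 + V x / ?t)"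
    proof -
      have "s * (V x / ?t) \<le> V x / ?t"
        using V_pos[OF x] t s by (intro mult_left_le_one_le) auto
      then show ?thesis using s by (intro mult_left_mono) auto
    qed
    finally have "C * V x powr s \<le> C * (?t powr s * (1 + V x / ?t))" using C by (rule mult_left_mono)
    then have "\<phi> x \<le> C * ?t powr s + C * ?t powr s / ?t * V x"
      using b[OF x] by (simp add: algebra_simps)
    then show "ennreal (\<phi> x) \<le> ennreal (C * ?t powr s) + ennreal (C * ?t powr s / ?t) * ennreal (V x)"
      using C t V_pos[OF x] by (simp add: ennreal_mult[symmetric] ennreal_plus[symmetric] ennreal_leI del: ennreal_plus)
  qed
  also have "\<dots> = ennreal (C * ?t powr s) * emeasure (TV k z z') (space M) + ennreal (C * ?t powr s / ?t) * (\<integral>\<^sup>+x. ennreal (V x) \<partial>TV k z z')"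
    by (subst nn_integral_add) (simp_all add: nn_integral_cmult del: ennreal_plus)
  also have "\<dots> \<le> ennreal (C * ?t powr s) * 2 + ennreal (C * ?t powr s / ?t) * ennreal ?t"
    by (intro add_mono mult_left_mono emeasure_TV_space nn_integral_V_TV z) auto
  also have "\<dots> = ennreal (3 * C * ?t powr s)"
  proof -
    have "ennreal (C * ?t powr s) * 2 = ennreal (C * ?t powr s * 2)"
      using C by (simp add: ennreal_mult)
    moreover have "ennreal (C * ?t powr s / ?t) * ennreal ?t = ennreal (C * ?t powr s)"
      using C t by (simp add: ennreal_mult[symmetric])
    ultimately show ?thesis
      using C by (simp add: ennreal_plus[symmetric] del: ennreal_plus)
  qed
  finally show ?thesis .
qed

text \<open>The positive and the negative part of \<phi> are compared through the total variation
  measure, which is symmetric in the two states, once in each direction; the two errors recombine to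
  the integral of \<open>\<bar>\<phi>\<bar>\<close>.\<close>

lemma kernel_diff_le:
  assumes [measurable]: "\<phi> \<in> borel_measurable M" and b: "\<And>z. z \<in> space M \<Longrightarrow> \<bar>\<phi> z\<bar> \<le> C * V z powr s"
    and s: "0 < s" "s \<le> 1" and z: "z \<in> space M" "z' \<in> space M"
  shows "\<bar>(\<integral>x. \<phi> x \<partial>kernel_pow M Q k z) - (\<integral>x. \<phi> x \<partial>kernel_pow M Q k z')\<bar> \<le> 3 * C * rate k z z' powr s"
proof -
  have C: "0 \<le> C"
    using b[OF z(1)] V_pos[OF z(1)] by (smt (verit) mult_neg_pos powr_gt_zero)
  have le: "(\<integral>x. \<phi> x \<partial>kernel_pow M Q k z) - (\<integral>x. \<phi> x \<partial>kernel_pow M Q k z') \<le> 3 * C * rate k z z' powr s"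
    if m [measurable]: "\<phi> \<in> borel_measurable M" and b: "\<And>z. z \<in> space M \<Longrightarrow> \<bar>\<phi> z\<bar> \<le> C * V z powr s" for \<phi>
  proof -
    let ?p = "\<lambda>x. max 0 (\<phi> x)" and ?m = "\<lambda>x. max 0 (- \<phi> x)"
    let ?K = "kernel_pow M Q k z" and ?K' = "kernel_pow M Q k z'"
    have i: "integrable (kernel_pow M Q k y) ?p" "integrable (kernel_pow M Q k y) ?m" if "y \<in> space M" for y
      using bdd_kernel_int[OF m b s(2) that] by auto
    have eq: "(\<integral>x. \<phi> x \<partial>kernel_pow M Q k y) = (\<integral>x. ?p x \<partial>kernel_pow M Q k y) - (\<integral>x. ?m x \<partial>kernel_pow M Q k y)" if "y \<in> space M" for y
    proof -
      have "(\<integral>x. \<phi> x \<partial>kernel_pow M Q k y) = (\<integral>x. ?p x - ?m x \<partial>kernel_pow M Q k y)"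
        by (rule Bochner_Integration.integral_cong) (auto simp: max_def)
      then show ?thesis using Bochner_Integration.integral_diff[OF i[OF that]] by simp
    qed
    have nn: "(\<integral>\<^sup>+x. ennreal (h x) \<partial>kernel_pow M Q k y) = ennreal (\<integral>x. h x \<partial>kernel_pow M Q k y)"
      if "integrable (kernel_pow M Q k y) h" "\<And>x. 0 \<le> h x" for h y
      using that by (simp add: nn_integral_eq_integral)
    have n: "(\<integral>\<^sup>+x. ennreal (?p x) \<partial>?K) = ennreal (\<integral>x. ?p x \<partial>?K)" "(\<integral>\<^sup>+x. ennreal (?m x) \<partial>?K) = ennreal (\<integral>x. ?m x \<partial>?K)"
      "(\<integral>\<^sup>+x. ennreal (?p x) \<partial>?K') = ennreal (\<integral>x. ?p x \<partial>?K')" "(\<integral>\<^sup>+x. ennreal (?m x) \<partial>?K') = ennreal (\<integral>x. ?m x \<partial>?K')"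
      by (rule nn[OF i(1)[OF z(1)]] nn[OF i(2)[OF z(1)]] nn[OF i(1)[OF z(2)]] nn[OF i(2)[OF z(2)]], simp)+
    have n0: "0 \<le> (\<integral>x. ?p x \<partial>?K)" "0 \<le> (\<integral>x. ?m x \<partial>?K)" "0 \<le> (\<integral>x. ?p x \<partial>?K')" "0 \<le> (\<integral>x. ?m x \<partial>?K')"
      by (auto intro!: integral_nonneg_AE)
    have "ennreal ((\<integral>x. ?p x \<partial>?K) + (\<integral>x. ?m x \<partial>?K')) = (\<integral>\<^sup>+x. ennreal (?p x) \<partial>?K) + (\<integral>\<^sup>+x. ennreal (?m x) \<partial>?K')"
      unfolding n using n0 by simp
    also have "\<dots> \<le> ((\<integral>\<^sup>+x. ennreal (?p x) \<partial>?K') + (\<integral>\<^sup>+x. ennreal (?p x) \<partial>TV k z z'))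
        + ((\<integral>\<^sup>+x. ennreal (?m x) \<partial>?K) + (\<integral>\<^sup>+x. ennreal (?m x) \<partial>TV k z' z))"
      by (intro add_mono nn_integral_kernel_le_TV z) measurable
    also have "TV k z' z = TV k z z'" by (simp add: TV_def total_variation_def abs_minus_commute)
    also have "((\<integral>\<^sup>+x. ennreal (?p x) \<partial>?K') + (\<integral>\<^sup>+x. ennreal (?p x) \<partial>TV k z z'))
        + ((\<integral>\<^sup>+x. ennreal (?m x) \<partial>?K) + (\<integral>\<^sup>+x. ennreal (?m x) \<partial>TV k z z'))
      = ((\<integral>\<^sup>+x. ennreal (?p x) \<partial>?K') + (\<integral>\<^sup>+x. ennreal (?m x) \<partial>?K)) + (\<integral>\<^sup>+x. ennreal (?p x) + ennreal (?m x) \<partial>TV k z z')"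
      by (subst nn_integral_add) (auto simp: add_ac)
    also have "(\<integral>\<^sup>+x. ennreal (?p x) + ennreal (?m x) \<partial>TV k z z') = (\<integral>\<^sup>+x. ennreal \<bar>\<phi> x\<bar> \<partial>TV k z z')"
      by (intro nn_integral_cong) (auto simp: max_def ennreal_neg)
    also have "((\<integral>\<^sup>+x. ennreal (?p x) \<partial>?K') + (\<integral>\<^sup>+x. ennreal (?m x) \<partial>?K)) + (\<integral>\<^sup>+x. ennreal \<bar>\<phi> x\<bar> \<partial>TV k z z')
        \<le> ((\<integral>\<^sup>+x. ennreal (?p x) \<partial>?K') + (\<integral>\<^sup>+x. ennreal (?m x) \<partial>?K)) + ennreal (3 * C * rate k z z' powr s)"
      by (intro add_left_mono nn_integral_powr_V_TV[OF z s C b])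
    also have "((\<integral>\<^sup>+x. ennreal (?p x) \<partial>?K') + (\<integral>\<^sup>+x. ennreal (?m x) \<partial>?K)) + ennreal (3 * C * rate k z z' powr s)
        = ennreal ((\<integral>x. ?p x \<partial>?K') + (\<integral>x. ?m x \<partial>?K) + 3 * C * rate k z z' powr s)"
      unfolding n using n0 C by simp
    finally have "(\<integral>x. ?p x \<partial>?K) + (\<integral>x. ?m x \<partial>?K') \<le> (\<integral>x. ?p x \<partial>?K') + (\<integral>x. ?m x \<partial>?K) + 3 * C * rate k z z' powr s"
      by (subst (asm) ennreal_le_iff) (use C n0 in auto)
    then show ?thesis using eq[OF z(1)] eq[OF z(2)] by simp
  qed
  have "(\<integral>x. - \<phi> x \<partial>kernel_pow M Q k z) - (\<integral>x. - \<phi> x \<partial>kernel_pow M Q k z') \<le> 3 * C * rate k z z' powr s"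
    by (rule le) (use b in auto)
  with le[of \<phi>] b show ?thesis by auto
qed

end

section \<open>Decay of centered averages and the Poisson equation\<close>

lemma geometric_div_series:
  fixes r :: real
  assumes r: "0 \<le> r" "r < 1" and t: "0 < (\<tau>::nat)"
  shows "summable (\<lambda>j. r ^ (j div \<tau>))" and "(\<Sum>j<n. r ^ (j div \<tau>)) \<le> real \<tau> / (1 - r)"
    and "(\<Sum>j. r ^ (j div \<tau>)) \<le> real \<tau> / (1 - r)"
proof -
  show b: "(\<Sum>j<n. r ^ (j div \<tau>)) \<le> real \<tau> / (1 - r)" for n
  proof -
    \<comment> \<open>Extending the sum to \<open>n * \<tau>\<close> terms makes it split into full
      stretches of length \<tau>, on each of which the exponent is constant.\<close>
    have "n \<le> n * \<tau>" using t by simp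
    then have "(\<Sum>j<n. r ^ (j div \<tau>)) \<le> (\<Sum>j<n * \<tau>. r ^ (j div \<tau>))"
      using r by (intro sum_mono2) auto
    also have "\<dots> = (\<Sum>m<n. \<Sum>j=m * \<tau>..<m * \<tau> + \<tau>. r ^ (j div \<tau>))"
      by (rule sum.nat_group[symmetric])
    also have "\<dots> = (\<Sum>m<n. \<Sum>j=m * \<tau>..<m * \<tau> + \<tau>. r ^ m)"
    proof (intro sum.cong refl)
      fix m j assume "j \<in> {m * \<tau>..<m * \<tau> + \<tau>}"
      then have "j div \<tau> = m" using t by (intro div_nat_eqI) (auto simp: mult.commute)
      then show "r ^ (j div \<tau>) = r ^ m" by simp
    qed
    also have "\<dots> = real \<tau> * (\<Sum>m<n. r ^ m)" by (simp add: sum_distrib_left)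
    also have "\<dots> \<le> real \<tau> * (1 / (1 - r))"
    proof (rule mult_left_mono)
      have "(\<Sum>m<n. r ^ m) \<le> (\<Sum>m. r ^ m)" using r by (intro sum_le_suminf summable_geometric) auto
      then show "(\<Sum>m<n. r ^ m) \<le> 1 / (1 - r)" using r by (simp add: suminf_geometric)
    qed simp
    finally show ?thesis by simp
  qed
  show s: "summable (\<lambda>j. r ^ (j div \<tau>))"
    by (rule summableI_nonneg_bounded[OF _ b]) (use r in auto)
  show "(\<Sum>j. r ^ (j div \<tau>)) \<le> real \<tau> / (1 - r)"
    by (rule suminf_le_const[OF s b])
qed

context vge_chain
begin

definition A :: real where "A = \<kappa> * v"

lemma A_ge2: "2 \<le> A"
  using mult_mono[of 1 \<kappa> 2 v] kappa v_ge2 by (simp add: A_def)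

lemma v_le_A: "v \<le> A"
  using mult_right_mono[of 1 \<kappa> v] kappa v_ge2 by (simp add: A_def)

text \<open>Jensen's inequality with the tangent taken at \<open>v\<close>, the mean of
  \<open>V\<close>.\<close>

lemma pi_powr_V:
  assumes s: "0 < s" "s \<le> 1"
  shows "integrable \<pi> (\<lambda>z. V z powr s)" and "(\<integral>z. V z powr s \<partial>\<pi>) \<le> v powr s"
proof -
  show i: "integrable \<pi> (\<lambda>z. V z powr s)"
    by (rule bdd_pi_int[where C=1 and s=s]) (use s in auto)
  have "(\<integral>z. V z powr s \<partial>\<pi>) \<le> (\<integral>z. v powr s * (1 - s) + (v powr s * s / v) * V z \<partial>\<pi>)"
  proof (rule integral_mono[OF i])
    fix z assume "z \<in> space \<pi>"
    then have "V z powr s \<le> v powr s * (1 - s + s * (V z / v))"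
      using V_pos[of z] v_ge2 s by (intro powr_le_tangent) auto
    then show "V z powr s \<le> v powr s * (1 - s) + (v powr s * s / v) * V z" by (simp add: algebra_simps)
  qed simp
  also have "\<dots> = v powr s * (1 - s) + (v powr s * s / v) * v"
    using \<pi>.prob_space by (simp add: v_def[symmetric])
  also have "\<dots> = v powr s" using v_ge2 by (simp add: algebra_simps)
  finally show "(\<integral>z. V z powr s \<partial>\<pi>) \<le> v powr s" .
qed

lemma centered_measurable [measurable]: "\<phi> \<in> borel_measurable M \<Longrightarrow> centered \<pi> \<phi> \<in> borel_measurable M"
  unfolding centered_def[abs_def] by (intro borel_measurable_diff) simp_all

lemma bdd_const_nonneg:
  assumes "\<And>z. z \<in> space M \<Longrightarrow> \<bar>\<phi> z\<bar> \<le> C * V z powr s"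
  shows "0 \<le> (C::real)"
proof -
  obtain z where z: "z \<in> space M" using \<pi>.not_empty by auto
  have "0 \<le> C * V z powr s" using assms[OF z] by linarith
  then show ?thesis using V_pos[OF z] by (simp add: zero_le_mult_iff)
qed

lemma integral_pi_kernel_pow:
  fixes \<phi> :: "'a \<Rightarrow> real"
  assumes [measurable]: "\<phi> \<in> borel_measurable M" and b: "\<And>z. z \<in> space M \<Longrightarrow> \<bar>\<phi> z\<bar> \<le> C * V z powr s" and s: "s \<le> 1"
  shows "integrable \<pi> (\<lambda>z. \<integral>x. \<phi> x \<partial>kernel_pow M Q k z)"
    and "(\<integral>z. (\<integral>x. \<phi> x \<partial>kernel_pow M Q k z) \<partial>\<pi>) = (\<integral>z. \<phi> z \<partial>\<pi>)"
proof -
  have i: "integrable P (\<lambda>\<omega>. \<phi> (\<omega> (0 + k)))"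
    using bdd_pi_int[OF _ b s] by (simp add: integrable_coord)
  have f: "integrable (kernel_pow M Q k z) \<phi>" if "z \<in> space M" for z
    by (rule bdd_kernel_int[OF _ b s that]) auto
  have 1: "integrable P (\<lambda>\<omega>. \<integral>x. \<phi> x \<partial>kernel_pow M Q k (\<omega> 0))"
    and 2: "(\<integral>\<omega>. \<phi> (\<omega> (0 + k)) \<partial>P) = (\<integral>\<omega>. (\<integral>x. \<phi> x \<partial>kernel_pow M Q k (\<omega> 0)) \<partial>P)"
    using integral_P_markov[of "\<lambda>_. 1" 0 \<phi> k] i f by simp_all
  show "integrable \<pi> (\<lambda>z. \<integral>x. \<phi> x \<partial>kernel_pow M Q k z)"
    using 1 integrable_coord[of "\<lambda>z. \<integral>x. \<phi> x \<partial>kernel_pow M Q k z" 0] by simp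
  show "(\<integral>z. (\<integral>x. \<phi> x \<partial>kernel_pow M Q k z) \<partial>\<pi>) = (\<integral>z. \<phi> z \<partial>\<pi>)"
    using 2 integral_coord[of "\<lambda>z. \<integral>x. \<phi> x \<partial>kernel_pow M Q k z" 0] integral_coord[of \<phi> k] by simp
qed

lemma integral_centered_kernel:
  assumes "\<phi> \<in> borel_measurable M" "\<And>z. z \<in> space M \<Longrightarrow> \<bar>\<phi> z\<bar> \<le> C * V z powr s" "s \<le> 1" "z \<in> space M"
  shows "(\<integral>x. centered \<pi> \<phi> x \<partial>kernel_pow M Q k z) = (\<integral>x. \<phi> x \<partial>kernel_pow M Q k z) - (\<integral>x. \<phi> x \<partial>\<pi>)"
proof -
  interpret K: prob_space "kernel_pow M Q k z" by (rule prob_space_kernel_pow[OF assms(4)])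
  show ?thesis
    unfolding centered_def using bdd_kernel_int[OF assms] K.prob_space by simp
qed

text \<open>Invariance writes the centered average as the \<pi>-mean over \<open>z'\<close> of
  differences between the chains started in \<open>z\<close> and in \<open>z'\<close>. Each
  difference decays by the ergodicity bound, whose \<kappa> combines with the mean of
  \<open>V\<close> into \<open>A\<close>.\<close>

lemma centered_kernel_le:
  assumes [measurable]: "\<phi> \<in> borel_measurable M" and b: "\<And>z. z \<in> space M \<Longrightarrow> \<bar>\<phi> z\<bar> \<le> C * V z powr s"
    and s: "0 < s" "s \<le> 1" and z: "z \<in> space M"
  shows "\<bar>\<integral>x. centered \<pi> \<phi> x \<partial>kernel_pow M Q k z\<bar> \<le> 3 * C * A powr s * ((1/4) powr s) ^ (k div \<tau>) * V z powr s"
proof -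
  have C: "0 \<le> C" by (rule bdd_const_nonneg[OF b])
  let ?K = "\<lambda>z. \<integral>x. \<phi> x \<partial>kernel_pow M Q k z"
  have i: "integrable \<pi> ?K" and e: "(\<integral>z. ?K z \<partial>\<pi>) = (\<integral>z. \<phi> z \<partial>\<pi>)"
    by (rule integral_pi_kernel_pow[OF _ b s(2)]; simp)+
  have i': "integrable \<pi> (\<lambda>z'. ?K z - ?K z')" using i by simp
  have "(\<integral>x. centered \<pi> \<phi> x \<partial>kernel_pow M Q k z) = ?K z - (\<integral>z'. ?K z' \<partial>\<pi>)"
    unfolding e by (rule integral_centered_kernel[OF _ b s(2) z]) simp
  also have "\<dots> = (\<integral>z'. ?K z - ?K z' \<partial>\<pi>)" using i \<pi>.prob_space by simp
  finally have "\<bar>\<integral>x. centered \<pi> \<phi> x \<partial>kernel_pow M Q k z\<bar> = \<bar>\<integral>z'. ?K z - ?K z' \<partial>\<pi>\<bar>" by simp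
  also have "\<dots> \<le> (\<integral>z'. \<bar>?K z - ?K z'\<bar> \<partial>\<pi>)" by (rule integral_abs_bound)
  also have "\<dots> \<le> (\<integral>z'. (3 * C * \<kappa> powr s * ((1/4) powr s) ^ (k div \<tau>) * V z powr s) * V z' powr s \<partial>\<pi>)"
  proof (rule integral_mono)
    show "integrable \<pi> (\<lambda>z'. \<bar>?K z - ?K z'\<bar>)" using i' by simp
    fix z' assume "z' \<in> space \<pi>"
    then have z': "z' \<in> space M" by simp
    have "\<bar>?K z - ?K z'\<bar> \<le> 3 * C * rate k z z' powr s"
      by (rule kernel_diff_le[OF _ b s z z']) simp
    also have "rate k z z' powr s \<le> (\<kappa> * (1/4) ^ (k div \<tau>) * (V z * V z')) powr s"
    proof (rule powr_mono2)
      \<comment> \<open>Both values of \<open>V\<close> are at least 2, so their sum is at most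
        their product, and the integral over \<open>z'\<close> factors.\<close>
      have "0 \<le> (V z - 1) * (V z' - 1) - 1"
        using mult_mono[of 1 "V z - 1" 1 "V z' - 1"] V_ge2[OF z] V_ge2[OF z'] by simp
      then have "V z + V z' \<le> V z * V z'" by (simp add: algebra_simps)
      then show "rate k z z' \<le> \<kappa> * (1/4) ^ (k div \<tau>) * (V z * V z')"
        unfolding rate_def using kappa by (intro mult_left_mono) auto
    qed (use s rate_pos[OF z z', of k] in auto)
    also have "\<dots> = \<kappa> powr s * ((1/4) powr s) ^ (k div \<tau>) * V z powr s * V z' powr s"
    proof -
      have "((1/4) ^ (k div \<tau>)) powr s = ((1/4::real) powr s) ^ (k div \<tau>)"
        by (simp add: powr_realpow[symmetric] powr_powr mult.commute)
      then show ?thesis using kappa V_pos[OF z] V_pos[OF z'] by (simp add: powr_mult)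
    qed
    finally show "\<bar>?K z - ?K z'\<bar> \<le> (3 * C * \<kappa> powr s * ((1/4) powr s) ^ (k div \<tau>) * V z powr s) * V z' powr s"
      using C by (simp add: mult_left_mono mult.assoc)
  qed (intro integrable_mult_right pi_powr_V s)
  also have "\<dots> \<le> (3 * C * \<kappa> powr s * ((1/4) powr s) ^ (k div \<tau>) * V z powr s) * v powr s"
    using C pi_powr_V[OF s] by (simp add: mult_left_mono)
  also have "\<dots> = 3 * C * A powr s * ((1/4) powr s) ^ (k div \<tau>) * V z powr s"
    using kappa v_ge2 by (simp add: A_def powr_mult)
  finally show ?thesis .
qed

lemma centered_le:
  assumes [measurable]: "\<phi> \<in> borel_measurable M" and b: "\<And>z. z \<in> space M \<Longrightarrow> \<bar>\<phi> z\<bar> \<le> C * V z powr s"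
    and s: "0 < s" "s \<le> 1" and z: "z \<in> space M"
  shows "\<bar>centered \<pi> \<phi> z\<bar> \<le> 3 * C * A powr s * V z powr s"
proof -
  have "(\<integral>x. centered \<pi> \<phi> x \<partial>kernel_pow M Q 0 z) = centered \<pi> \<phi> z"
    using z by (simp add: integral_return)
  with centered_kernel_le[OF assms, of 0] show ?thesis by simp
qed

text \<open>\<open>4 = 3 + 1\<close>: the deviation from the stationary mean, and the mean itself,
  which is at most \<open>A powr s\<close>.\<close>

lemma kernel_powr_V:
  assumes s: "0 < s" "s \<le> 1" and z: "z \<in> space M"
  shows "(\<integral>x. V x powr s \<partial>kernel_pow M Q k z) \<le> 4 * A powr s * V z powr s"
proof -
  have "\<bar>(\<integral>x. V x powr s \<partial>kernel_pow M Q k z) - (\<integral>x. V x powr s \<partial>\<pi>)\<bar>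
      \<le> 3 * 1 * A powr s * ((1/4) powr s) ^ (k div \<tau>) * V z powr s"
    using centered_kernel_le[of "\<lambda>x. V x powr s" 1 s z k] integral_centered_kernel[of "\<lambda>x. V x powr s" 1 s z k] s z by simp
  also have "\<dots> \<le> 3 * 1 * A powr s * 1 * V z powr s"
    using s by (intro mult_right_mono mult_left_mono power_le_one) (auto intro!: powr_le1)
  finally have 1: "\<bar>(\<integral>x. V x powr s \<partial>kernel_pow M Q k z) - (\<integral>x. V x powr s \<partial>\<pi>)\<bar> \<le> 3 * A powr s * V z powr s" by simp
  have "(\<integral>x. V x powr s \<partial>\<pi>) \<le> v powr s" by (rule pi_powr_V[OF s])
  also have "\<dots> \<le> A powr s" using v_le_A v_ge2 s by (intro powr_mono2) auto
  also have "\<dots> \<le> A powr s * V z powr s"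
    using mult_left_mono[of 1 "V z powr s" "A powr s"] V_ge1[OF z] s by (simp add: ge_one_powr_ge_zero)
  finally show ?thesis using 1 by linarith
qed

lemma kernel_bdd_le:
  assumes m: "\<phi> \<in> borel_measurable M" and b: "\<And>z. z \<in> space M \<Longrightarrow> \<bar>\<phi> z\<bar> \<le> C * V z powr s"
    and s: "0 < s" "s \<le> 1" and z: "z \<in> space M"
  shows "\<bar>\<integral>x. \<phi> x \<partial>kernel_pow M Q k z\<bar> \<le> 4 * C * A powr s * V z powr s"
proof -
  have C: "0 \<le> C" by (rule bdd_const_nonneg[OF b])
  have "\<bar>\<integral>x. \<phi> x \<partial>kernel_pow M Q k z\<bar> \<le> (\<integral>x. \<bar>\<phi> x\<bar> \<partial>kernel_pow M Q k z)" by (rule integral_abs_bound)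
  also have "\<dots> \<le> (\<integral>x. C * V x powr s \<partial>kernel_pow M Q k z)"
  proof (rule integral_mono)
    show "integrable (kernel_pow M Q k z) (\<lambda>x. \<bar>\<phi> x\<bar>)"
      using bdd_kernel_int[OF m b s(2) z, of k] by simp
    show "integrable (kernel_pow M Q k z) (\<lambda>x. C * V x powr s)"
      by (rule bdd_kernel_int[OF _ _ s(2) z, where C=C]) (use C in \<open>auto simp: abs_mult\<close>)
  qed (use b z in auto)
  also have "\<dots> = C * (\<integral>x. V x powr s \<partial>kernel_pow M Q k z)" by simp
  also have "\<dots> \<le> C * (4 * A powr s * V z powr s)" by (intro mult_left_mono kernel_powr_V s z C)
  finally show ?thesis by simp
qed

text \<open>The series solution for the chain observed every \<open>b\<close> steps:
  \<open>b = 1\<close> serves \<open>f\<close>, the block length serves \<open>H\<close>.\<close>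

definition poisson :: "nat \<Rightarrow> ('a \<Rightarrow> real) \<Rightarrow> 'a \<Rightarrow> real" where
  "poisson b \<phi> z = (\<Sum>j. \<integral>x. centered \<pi> \<phi> x \<partial>kernel_pow M Q (j * b) z)"

context
  fixes \<phi> :: "'a \<Rightarrow> real" and C s \<sigma> :: real and b :: nat
  assumes \<phi> [measurable]: "\<phi> \<in> borel_measurable M" and bd: "\<And>z. z \<in> space M \<Longrightarrow> \<bar>\<phi> z\<bar> \<le> C * V z powr s"
    and s: "0 < s" "s \<le> 1"
    and sum: "summable (\<lambda>j. ((1/4) powr s) ^ (j * b div \<tau>) :: real)"
      "(\<Sum>j. ((1/4) powr s) ^ (j * b div \<tau>)) \<le> \<sigma>"
begin

private definition pterm where "pterm j z = (\<integral>x. centered \<pi> \<phi> x \<partial>kernel_pow M Q (j * b) z)"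

private lemma C0: "0 \<le> C"
  by (rule bdd_const_nonneg[OF bd])

private lemma pterm_measurable [measurable]: "pterm j \<in> borel_measurable M"
  unfolding pterm_def[abs_def] by measurable

private lemma pterm_le: "z \<in> space M \<Longrightarrow> \<bar>pterm j z\<bar> \<le> (3 * C * A powr s * ((1/4) powr s) ^ (j * b div \<tau>)) * V z powr s"
  unfolding pterm_def by (rule centered_kernel_le[OF \<phi> bd s])

private lemma pterm_summable: "z \<in> space M \<Longrightarrow> summable (\<lambda>j. \<bar>pterm j z\<bar>)"
  by (rule summable_comparison_test'[where N=0, OF summable_mult2[OF summable_mult[OF sum(1)]]]) (use pterm_le in auto)

private lemma pterm_suminf_le: "z \<in> space M \<Longrightarrow> (\<Sum>j. \<bar>pterm j z\<bar>) \<le> 3 * C * \<sigma> * A powr s * V z powr s"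
proof -
  assume z: "z \<in> space M"
  have "(\<Sum>j. \<bar>pterm j z\<bar>) \<le> (\<Sum>j. (3 * C * A powr s * ((1/4) powr s) ^ (j * b div \<tau>)) * V z powr s)"
    by (intro suminf_le pterm_le pterm_summable z summable_mult2 summable_mult sum(1))
  also have "\<dots> = 3 * C * A powr s * (\<Sum>j. ((1/4) powr s) ^ (j * b div \<tau>)) * V z powr s"
    by (simp add: suminf_mult2[symmetric] suminf_mult summable_mult sum(1))
  also have "\<dots> \<le> 3 * C * A powr s * \<sigma> * V z powr s"
    using C0 by (intro mult_right_mono mult_left_mono sum(2)) auto
  finally show ?thesis by (simp add: mult_ac)
qed

lemma poisson_measurable: "poisson b \<phi> \<in> borel_measurable M"
proof -
  have "(\<lambda>z. \<Sum>j. pterm j z) \<in> borel_measurable M" by measurable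
  then show ?thesis by (simp add: poisson_def[abs_def] pterm_def)
qed

lemma poisson_le: "z \<in> space M \<Longrightarrow> \<bar>poisson b \<phi> z\<bar> \<le> 3 * C * \<sigma> * A powr s * V z powr s"
  using summable_rabs[OF pterm_summable, of z] pterm_suminf_le[of z] by (simp add: poisson_def pterm_def)

text \<open>Applying \<open>b\<close> steps of the kernel shifts the series by one term. The shifted
  series is part of the same absolutely summable series, so the second bound keeps the constant of
  \<open>poisson_le\<close> instead of adding the size of the centered function.\<close>

lemma poisson_equation:
  assumes z: "z \<in> space M"
  shows "(\<integral>y. poisson b \<phi> y \<partial>kernel_pow M Q b z) = poisson b \<phi> z - centered \<pi> \<phi> z"
    and "\<bar>\<integral>y. poisson b \<phi> y \<partial>kernel_pow M Q b z\<bar> \<le> 3 * C * \<sigma> * A powr s * V z powr s"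
proof -
  let ?K = "kernel_pow M Q b z"
  have Hi: "integrable ?K (pterm j)" for j
    by (rule bdd_kernel_int[OF _ pterm_le s(2) z]) measurable
  have "summable (\<lambda>j. \<integral>y. norm (pterm j y) \<partial>?K)"
  proof (rule summable_comparison_test'[where N=0])
    show "summable (\<lambda>j. (3 * C * A powr s * ((1/4) powr s) ^ (j * b div \<tau>)) * (\<integral>y. V y powr s \<partial>?K))"
      by (intro summable_mult2 summable_mult sum(1))
    fix j
    have "(\<integral>y. \<bar>pterm j y\<bar> \<partial>?K) \<le> (\<integral>y. (3 * C * A powr s * ((1/4) powr s) ^ (j * b div \<tau>)) * V y powr s \<partial>?K)"
    proof (rule integral_mono)
      show "integrable ?K (\<lambda>y. (3 * C * A powr s * ((1/4) powr s) ^ (j * b div \<tau>)) * V y powr s)"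
        by (intro integrable_mult_right bdd_kernel_int[where C=1 and s=s]) (use s z in auto)
    qed (use Hi pterm_le z in auto)
    then show "norm (\<integral>y. norm (pterm j y) \<partial>?K) \<le> (3 * C * A powr s * ((1/4) powr s) ^ (j * b div \<tau>)) * (\<integral>y. V y powr s \<partial>?K)"
      by (simp add: integral_nonneg_AE)
  qed
  then have "(\<integral>y. (\<Sum>j. pterm j y) \<partial>?K) = (\<Sum>j. \<integral>y. pterm j y \<partial>?K)"
    using Hi pterm_summable z by (intro integral_suminf) auto
  also have "\<dots> = (\<Sum>j. pterm (Suc j) z)"
  proof -
    have ci: "integrable (kernel_pow M Q k y) (centered \<pi> \<phi>)" if "y \<in> space M" for k y
      by (rule bdd_kernel_int[OF _ centered_le[OF \<phi> bd s] s(2) that]) measurable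
    have "(\<integral>y. pterm j y \<partial>?K) = pterm (Suc j) z" for j
      unfolding pterm_def using integral_kernel_pow_add(2)[OF _ z ci, of b "j * b"] by simp
    then show ?thesis by simp
  qed
  finally have e: "(\<integral>y. poisson b \<phi> y \<partial>?K) = (\<Sum>j. pterm (Suc j) z)"
    by (simp add: poisson_def[abs_def] pterm_def)
  have "(\<Sum>j. pterm (Suc j) z) = (\<Sum>j. pterm j z) - pterm 0 z"
    by (rule suminf_split_head) (rule summable_rabs_cancel[OF pterm_summable[OF z]])
  also have "pterm 0 z = centered \<pi> \<phi> z"
    using z by (simp add: pterm_def integral_return)
  finally show "(\<integral>y. poisson b \<phi> y \<partial>?K) = poisson b \<phi> z - centered \<pi> \<phi> z"
    unfolding e by (simp add: poisson_def pterm_def)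
  have "\<bar>\<Sum>j. pterm (Suc j) z\<bar> \<le> (\<Sum>j. \<bar>pterm (Suc j) z\<bar>)"
    by (rule summable_rabs) (use pterm_summable[OF z] in \<open>simp add: summable_Suc_iff[of "\<lambda>j. \<bar>pterm j z\<bar>"]\<close>)
  also have "\<dots> = (\<Sum>j. \<bar>pterm j z\<bar>) - \<bar>pterm 0 z\<bar>"
    by (rule suminf_split_head[OF pterm_summable[OF z]])
  also have "\<dots> \<le> 3 * C * \<sigma> * A powr s * V z powr s"
    using pterm_suminf_le[OF z] by simp
  finally show "\<bar>\<integral>y. poisson b \<phi> y \<partial>?K\<bar> \<le> 3 * C * \<sigma> * A powr s * V z powr s"
    unfolding e .
qed

text \<open>Dominated exchange of series and integral; \<open>s + s' \<le> 1\<close> makes the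
  product of the two weights integrable. This is how the covariance series of the asymptotic
  variance appears.\<close>

lemma integral_mult_poisson:
  assumes [measurable]: "\<psi> \<in> borel_measurable M" and \<psi>: "\<And>z. z \<in> space M \<Longrightarrow> \<bar>\<psi> z\<bar> \<le> C' * V z powr s'"
    and s': "s + s' \<le> 1"
  shows "summable (\<lambda>j. \<integral>z. \<psi> z * (\<integral>x. centered \<pi> \<phi> x \<partial>kernel_pow M Q (j * b) z) \<partial>\<pi>)"
    and "(\<integral>z. \<psi> z * poisson b \<phi> z \<partial>\<pi>) = (\<Sum>j. \<integral>z. \<psi> z * (\<integral>x. centered \<pi> \<phi> x \<partial>kernel_pow M Q (j * b) z) \<partial>\<pi>)"
proof -
  let ?c = "\<lambda>j. C' * (3 * C * A powr s * ((1/4) powr s) ^ (j * b div \<tau>))"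
  have C': "0 \<le> C'" by (rule bdd_const_nonneg[OF \<psi>])
  have bj: "\<bar>\<psi> z * pterm j z\<bar> \<le> ?c j * V z powr (s + s')" if z: "z \<in> space M" for j z
  proof -
    have "\<bar>\<psi> z\<bar> * \<bar>pterm j z\<bar> \<le> (C' * V z powr s') * ((3 * C * A powr s * ((1/4) powr s) ^ (j * b div \<tau>)) * V z powr s)"
      using C' by (intro mult_mono \<psi> pterm_le z) auto
    then show ?thesis by (simp add: abs_mult powr_add mult_ac)
  qed
  have Hi: "integrable \<pi> (\<lambda>z. \<psi> z * pterm j z)" for j
    by (rule bdd_pi_int[OF _ bj s']) measurable
  have Vi: "integrable \<pi> (\<lambda>z. V z powr (s + s'))"
    by (rule bdd_pi_int[OF _ _ s', where C=1]) auto
  have le: "(\<integral>z. \<bar>\<psi> z * pterm j z\<bar> \<partial>\<pi>) \<le> ?c j * (\<integral>z. V z powr (s + s') \<partial>\<pi>)" for j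
  proof -
    have "(\<integral>z. \<bar>\<psi> z * pterm j z\<bar> \<partial>\<pi>) \<le> (\<integral>z. ?c j * V z powr (s + s') \<partial>\<pi>)"
      using Hi Vi bj by (intro integral_mono) auto
    then show ?thesis by simp
  qed
  have sc: "summable (\<lambda>j. ?c j * (\<integral>z. V z powr (s + s') \<partial>\<pi>))"
    by (intro summable_mult2 summable_mult sum(1))
  have sn: "summable (\<lambda>j. \<integral>z. norm (\<psi> z * pterm j z) \<partial>\<pi>)"
    by (rule summable_comparison_test'[where N=0, OF sc]) (use le in \<open>simp add: integral_nonneg_AE\<close>)
  show "summable (\<lambda>j. \<integral>z. \<psi> z * (\<integral>x. centered \<pi> \<phi> x \<partial>kernel_pow M Q (j * b) z) \<partial>\<pi>)"
    unfolding pterm_def[symmetric]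
  proof (rule summable_comparison_test'[where N=0, OF sn])
    show "norm (\<integral>z. \<psi> z * pterm j z \<partial>\<pi>) \<le> (\<integral>z. norm (\<psi> z * pterm j z) \<partial>\<pi>)" for j
      by (rule integral_norm_bound)
  qed
  have as: "AE z in \<pi>. summable (\<lambda>j. norm (\<psi> z * pterm j z))"
    using pterm_summable by (intro AE_I2) (auto simp: abs_mult intro!: summable_mult)
  have "(\<integral>z. \<psi> z * poisson b \<phi> z \<partial>\<pi>) = (\<integral>z. (\<Sum>j. \<psi> z * pterm j z) \<partial>\<pi>)"
    by (intro Bochner_Integration.integral_cong)
       (auto simp: poisson_def pterm_def[symmetric] intro!: suminf_mult[symmetric] summable_rabs_cancel[OF pterm_summable])
  also have "\<dots> = (\<Sum>j. \<integral>z. \<psi> z * pterm j z \<partial>\<pi>)"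
    by (rule integral_suminf[OF Hi as sn])
  finally show "(\<integral>z. \<psi> z * poisson b \<phi> z \<partial>\<pi>) = (\<Sum>j. \<integral>z. \<psi> z * (\<integral>x. centered \<pi> \<phi> x \<partial>kernel_pow M Q (j * b) z) \<partial>\<pi>)"
    by (simp add: pterm_def)
qed

end

end

section \<open>The stationary chain\<close>

text \<open>Stationarity makes the moment independent of \<open>i\<close>, and Jensen's inequality
  under \<pi> turns \<open>V powr (s * r)\<close> into \<open>v powr (s * r)\<close>.\<close>

lemma (in vge_chain) moment_coord:
  assumes [measurable]: "\<phi> \<in> borel_measurable M" and le: "\<And>z. z \<in> space M \<Longrightarrow> \<bar>\<phi> z\<bar> \<le> B * V z powr s"
    and r: "0 < r" and rs: "0 < s" "s * r \<le> 1"
  shows "integrable P (\<lambda>\<omega>. \<bar>\<phi> (\<omega> i)\<bar> powr r)"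
    and "(\<integral>\<omega>. \<bar>\<phi> (\<omega> i)\<bar> powr r \<partial>P) \<le> B powr r * v powr (s * r)"
proof -
  have B: "0 \<le> B" by (rule bdd_const_nonneg[OF le])
  have sr: "0 < s * r" using r rs by simp
  have le: "\<bar>\<phi> z\<bar> powr r \<le> B powr r * V z powr (s * r)" if z: "z \<in> space M" for z
  proof -
    have "\<bar>\<phi> z\<bar> powr r \<le> (B * V z powr s) powr r"
      using r le[OF z] by (intro powr_mono2) auto
    also have "\<dots> = B powr r * V z powr (s * r)"
      using B by (simp add: powr_mult powr_powr)
    finally show ?thesis .
  qed
  have i: "integrable \<pi> (\<lambda>z. \<bar>\<phi> z\<bar> powr r)"
    by (rule bdd_pi_int[OF _ _ rs(2), where C="B powr r"]) (use le in auto)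
  then show "integrable P (\<lambda>\<omega>. \<bar>\<phi> (\<omega> i)\<bar> powr r)"
    using integrable_coord[of "\<lambda>z. \<bar>\<phi> z\<bar> powr r" i] by simp
  have "(\<integral>\<omega>. \<bar>\<phi> (\<omega> i)\<bar> powr r \<partial>P) = (\<integral>z. \<bar>\<phi> z\<bar> powr r \<partial>\<pi>)"
    using integral_coord[of "\<lambda>z. \<bar>\<phi> z\<bar> powr r" i] by simp
  also have "\<dots> \<le> (\<integral>z. B powr r * V z powr (s * r) \<partial>\<pi>)"
    by (rule integral_mono[OF i]) (use le in \<open>auto intro!: integrable_mult_right pi_powr_V(1)[OF sr rs(2)]\<close>)
  also have "\<dots> \<le> B powr r * v powr (s * r)"
    using pi_powr_V(2)[OF sr rs(2)] by (simp add: mult_left_mono)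
  finally show "(\<integral>\<omega>. \<bar>\<phi> (\<omega> i)\<bar> powr r \<partial>P) \<le> B powr r * v powr (s * r)" .
qed

section \<open>Martingale increments and their conditional variance\<close>

locale vge_rosenthal = vge_chain +
  fixes f :: "'a \<Rightarrow> real" and p F :: real
  assumes f [measurable]: "f \<in> borel_measurable M" and p: "2 \<le> p" and F: "0 < F"
    and f_le: "\<And>z. z \<in> space M \<Longrightarrow> \<bar>f z\<bar> \<le> F * V z powr (1 / (2 * p))"
begin

declare kernel_pow.simps(2) [simp del]

lemma a01: "0 < 1 / (2 * p)" "1 / (2 * p) \<le> 1" and q01: "0 < 1 / p" "1 / p \<le> 1"
  using p by auto

abbreviation "fb \<equiv> centered \<pi> f"

definition g where "g = poisson 1 f"
definition Kg where "Kg z = (\<integral>x. g x \<partial>kernel_pow M Q (Suc 0) z)"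
text \<open>The general Poisson bound \<open>3 * C * \<sigma>\<close> with \<open>C = F\<close> and
  the series bound \<open>\<sigma> = 2 * p * \<tau>\<close>.\<close>

definition G where "G = 6 * p * real \<tau> * F * A powr (1 / (2 * p))"
text \<open>A block consists of \<open>c\<close> stretches of length \<tau>. A multiple of \<tau>
  makes the exponents \<open>j * b div \<tau>\<close> exact; rounding \<open>p\<close> up makes the
  sampled chain contract by at least 1/4 per block at exponent \<open>1 / p\<close>, and costs at
  most the factor 3/2.\<close>

definition c where "c = nat \<lceil>p\<rceil>"
definition b where "b = c * \<tau>"

lemma c_bounds: "p \<le> real c" "real c \<le> 3/2 * p" and c_pos: "0 < c"
proof -
  have "real c = of_int \<lceil>p\<rceil>" using p by (simp add: c_def)
  then show "p \<le> real c" "real c \<le> 3/2 * p" using p by linarith+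
  then show "0 < c" using p by (cases c) auto
qed

lemma b_pos: "0 < b" using c_pos tau by (simp add: b_def)

lemma b_bounds: "p * real \<tau> \<le> real b" "real b \<le> 3/2 * p * real \<tau>"
  using mult_right_mono[OF c_bounds(1), of "real \<tau>"] mult_right_mono[OF c_bounds(2), of "real \<tau>"]
  by (simp_all add: b_def)

lemma tau_pos: "0 < \<tau>" using tau by simp

lemma A_pos: "0 < A" using A_ge2 by simp

lemma G_pos: "0 < G" using p F tau A_pos by (simp add: G_def)

text \<open>The gap \<open>1 - (1/4) powr (1 / (2 * p))\<close> is at least
  \<open>1 / (2 * p)\<close>, and each power of the ratio occurs \<tau> times.\<close>

lemma sums_f:
  "summable (\<lambda>j. ((1/4) powr (1 / (2 * p))) ^ (j * 1 div \<tau>) :: real)"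
  "(\<Sum>j. ((1/4) powr (1 / (2 * p))) ^ (j * 1 div \<tau>)) \<le> 2 * p * real \<tau>"
proof -
  let ?r = "(1/4) powr (1 / (2 * p)) :: real"
  have r: "?r \<le> 1 - 1 / (2 * p)" using p by (intro quarter_powr_le) auto
  then have r1: "?r < 1" using p by (smt (verit) a01(1))
  show "summable (\<lambda>j. ?r ^ (j * 1 div \<tau>))"
    using geometric_div_series(1)[OF _ r1 tau_pos] by simp
  have "(\<Sum>j. ?r ^ (j * 1 div \<tau>)) \<le> real \<tau> / (1 - ?r)"
    using geometric_div_series(3)[OF _ r1 tau_pos] by simp
  also have "\<dots> \<le> real \<tau> / (1 / (2 * p))"
    using r r1 p by (intro divide_left_mono) auto
  finally show "(\<Sum>j. ?r ^ (j * 1 div \<tau>)) \<le> 2 * p * real \<tau>" by (simp add: mult_ac)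
qed

text \<open>Since \<open>(1/4) powr (c / p) \<le> 1/4\<close>, the series for the sampled chain is
  dominated by a fixed geometric one: its bound contains no power of \<open>p\<close> or \<tau>.
  This is the gain from the blocks.\<close>

lemma sums_H:
  "summable (\<lambda>j. ((1/4) powr (1 / p)) ^ (j * b div \<tau>) :: real)"
  "(\<Sum>j. ((1/4) powr (1 / p)) ^ (j * b div \<tau>)) \<le> (4/3 :: real)"
proof -
  let ?r = "((1/4) powr (1 / p)) ^ c :: real"
  have "?r = (1/4) powr (real c / p)" by (simp add: powr_realpow[symmetric] powr_powr)
  also have "\<dots> \<le> (1/4) powr 1" using c_bounds p by (intro powr_mono') auto
  finally have r: "0 \<le> ?r" "?r \<le> 1/4" by simp_all
  have e: "((1/4) powr (1 / p)) ^ (j * b div \<tau>) = ?r ^ j" for j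
  proof -
    have "j * b div \<tau> = c * j" using tau_pos by (simp add: b_def mult.assoc[symmetric] mult.commute[of j])
    then show ?thesis by (simp only: power_mult)
  qed
  have s: "summable (\<lambda>j. ?r ^ j)" using r by (intro summable_geometric) auto
  show "summable (\<lambda>j. ((1/4) powr (1 / p)) ^ (j * b div \<tau>) :: real)" unfolding e by (rule s)
  have "(\<Sum>j. ?r ^ j) \<le> (\<Sum>j. (1/4) ^ j)"
    using r by (intro suminf_le s summable_geometric power_mono) auto
  also have "\<dots> = 4/3" by (subst suminf_geometric) auto
  finally show "(\<Sum>j. ((1/4) powr (1 / p)) ^ (j * b div \<tau>)) \<le> (4/3 :: real)" unfolding e .
qed

lemma fb_measurable [measurable]: "fb \<in> borel_measurable M" by measurable

lemma g_measurable [measurable]: "g \<in> borel_measurable M"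
  unfolding g_def by (rule poisson_measurable[OF f f_le a01 sums_f])

lemma Kg_measurable [measurable]: "Kg \<in> borel_measurable M"
  unfolding Kg_def[abs_def] by measurable

lemma fb_le: "z \<in> space M \<Longrightarrow> \<bar>fb z\<bar> \<le> 3 * F * A powr (1 / (2 * p)) * V z powr (1 / (2 * p))"
  by (rule centered_le[OF f f_le a01])

lemma g_le: "z \<in> space M \<Longrightarrow> \<bar>g z\<bar> \<le> G * V z powr (1 / (2 * p))"
  using poisson_le[OF f f_le a01 sums_f, of z] by (simp add: g_def G_def mult_ac)

lemma Kg_eq: "z \<in> space M \<Longrightarrow> Kg z = g z - fb z"
  using poisson_equation(1)[OF f f_le a01 sums_f] by (simp add: Kg_def g_def)

lemma Kg_le: "z \<in> space M \<Longrightarrow> \<bar>Kg z\<bar> \<le> G * V z powr (1 / (2 * p))"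
  using poisson_equation(2)[OF f f_le a01 sums_f, of z] by (simp add: g_def Kg_def G_def mult_ac)

lemma V_sq: "z \<in> space M \<Longrightarrow> V z powr (1 / (2 * p)) * V z powr (1 / (2 * p)) = V z powr (1 / p)"
  by (simp add: powr_add[symmetric])

lemma prod_le:
  assumes "z \<in> space M" "\<bar>x\<bar> \<le> B * V z powr (1 / (2 * p))" "\<bar>y\<bar> \<le> B' * V z powr (1 / (2 * p))" "0 \<le> B"
  shows "\<bar>x * y\<bar> \<le> B * B' * V z powr (1 / p)"
proof -
  have "\<bar>x\<bar> * \<bar>y\<bar> \<le> (B * V z powr (1 / (2 * p))) * (B' * V z powr (1 / (2 * p)))"
    using assms by (intro mult_mono) auto
  also have "\<dots> = B * B' * V z powr (1 / p)"
    using V_sq[OF assms(1)] by (simp add: mult_ac)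
  finally show ?thesis by (simp add: abs_mult)
qed

lemma g2_le: "z \<in> space M \<Longrightarrow> \<bar>(g z)\<^sup>2\<bar> \<le> G\<^sup>2 * V z powr (1 / p)"
  using prod_le[OF _ g_le g_le, of z] G_pos by (simp add: power2_eq_square)

lemma Kg2_le: "z \<in> space M \<Longrightarrow> \<bar>(Kg z)\<^sup>2\<bar> \<le> G\<^sup>2 * V z powr (1 / p)"
  using prod_le[OF _ Kg_le Kg_le, of z] G_pos by (simp add: power2_eq_square)

lemma g_int: "z \<in> space M \<Longrightarrow> integrable (kernel_pow M Q k z) g"
  by (rule bdd_kernel_int[OF _ g_le a01(2)]) measurable

lemma g2_int: "z \<in> space M \<Longrightarrow> integrable (kernel_pow M Q k z) (\<lambda>x. (g x)\<^sup>2)"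
  by (rule bdd_kernel_int[OF _ g2_le q01(2)]) measurable

text \<open>Conditional variance of a martingale increment given the current state;
  \<open>Kg\<close> is the conditional mean of \<open>g\<close> at the next state.\<close>

definition h where "h z = (\<integral>x. (g x)\<^sup>2 \<partial>kernel_pow M Q (Suc 0) z) - (Kg z)\<^sup>2"

lemma h_measurable [measurable]: "h \<in> borel_measurable M"
  unfolding h_def[abs_def] by measurable

lemma h_nonneg:
  assumes z: "z \<in> space M"
  shows "0 \<le> h z"
proof -
  interpret K: prob_space "kernel_pow M Q (Suc 0) z" by (rule prob_space_kernel_pow[OF z])
  have "0 \<le> (\<integral>x. (g x - Kg z)\<^sup>2 \<partial>kernel_pow M Q (Suc 0) z)" by simp
  also have "\<dots> = (\<integral>x. (g x)\<^sup>2 - 2 * Kg z * g x + (Kg z)\<^sup>2 \<partial>kernel_pow M Q (Suc 0) z)"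
    by (simp add: power2_eq_square algebra_simps)
  also have "\<dots> = h z"
    using g_int[OF z, of "Suc 0"] g2_int[OF z, of "Suc 0"] K.prob_space
    by (simp add: h_def Kg_def[symmetric] power2_eq_square)
  finally show ?thesis .
qed

lemma h_le: "z \<in> space M \<Longrightarrow> \<bar>h z\<bar> \<le> 4 * G\<^sup>2 * A powr (1 / p) * V z powr (1 / p)"
proof -
  assume z: "z \<in> space M"
  have "\<bar>\<integral>x. (g x)\<^sup>2 \<partial>kernel_pow M Q (Suc 0) z\<bar> \<le> 4 * G\<^sup>2 * A powr (1 / p) * V z powr (1 / p)"
    by (rule kernel_bdd_le[OF _ g2_le q01 z]) measurable
  then show ?thesis using h_nonneg[OF z] zero_le_power2[of "Kg z"] unfolding h_def by linarith
qed

text \<open>\<open>Kg = g - fb\<close> and invariance reduce the mean of \<open>h\<close> to twice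
  the mean of \<open>fb * g\<close> minus the mean of \<open>fb\<^sup>2\<close>. Expanding
  \<open>g\<close> as its series counts the zeroth covariance twice; subtracting it once leaves the
  asymptotic variance.\<close>

lemma pi_h: "(\<integral>z. h z \<partial>\<pi>) = asymp_var M Q \<pi> f"
proof -
  have gg: "integrable \<pi> (\<lambda>z. (g z)\<^sup>2)" by (rule bdd_pi_int[OF _ g2_le q01(2)]) measurable
  have KK: "integrable \<pi> (\<lambda>z. (Kg z)\<^sup>2)" by (rule bdd_pi_int[OF _ Kg2_le q01(2)]) measurable
  have fg: "integrable \<pi> (\<lambda>z. fb z * g z)"
    by (rule bdd_pi_int[OF _ prod_le[OF _ fb_le g_le] q01(2)]) (use F in auto)
  have ff: "integrable \<pi> (\<lambda>z. (fb z)\<^sup>2)"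
    using bdd_pi_int[OF _ prod_le[OF _ fb_le fb_le] q01(2)] F by (simp add: power2_eq_square)
  have i1: "integrable \<pi> (\<lambda>z. \<integral>x. (g x)\<^sup>2 \<partial>kernel_pow M Q (Suc 0) z)"
    and e1: "(\<integral>z. (\<integral>x. (g x)\<^sup>2 \<partial>kernel_pow M Q (Suc 0) z) \<partial>\<pi>) = (\<integral>z. (g z)\<^sup>2 \<partial>\<pi>)"
    by (rule integral_pi_kernel_pow[OF _ g2_le q01(2)]; measurable)+
  have "(\<integral>z. h z \<partial>\<pi>) = (\<integral>z. (g z)\<^sup>2 \<partial>\<pi>) - (\<integral>z. (Kg z)\<^sup>2 \<partial>\<pi>)"
    unfolding h_def using i1 KK by (simp add: e1)
  also have "(\<integral>z. (Kg z)\<^sup>2 \<partial>\<pi>) = (\<integral>z. (g z)\<^sup>2 - 2 * (fb z * g z) + (fb z)\<^sup>2 \<partial>\<pi>)"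
    by (intro Bochner_Integration.integral_cong) (auto simp: Kg_eq power2_eq_square algebra_simps)
  also have "\<dots> = (\<integral>z. (g z)\<^sup>2 \<partial>\<pi>) - 2 * (\<integral>z. fb z * g z \<partial>\<pi>) + (\<integral>z. (fb z)\<^sup>2 \<partial>\<pi>)"
    using gg fg ff by simp
  finally have 1: "(\<integral>z. h z \<partial>\<pi>) = 2 * (\<integral>z. fb z * g z \<partial>\<pi>) - (\<integral>z. (fb z)\<^sup>2 \<partial>\<pi>)" by simp
  let ?u = "\<lambda>j. \<integral>z. fb z * (\<integral>x. fb x \<partial>kernel_pow M Q (j * 1) z) \<partial>\<pi>"
  have ss: "1 / (2 * p) + 1 / (2 * p) \<le> 1" using p by simp
  have su: "summable ?u" by (rule integral_mult_poisson(1)[OF f f_le a01 sums_f _ fb_le ss]) measurable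
  have "(\<integral>z. fb z * g z \<partial>\<pi>) = (\<Sum>j. ?u j)"
    unfolding g_def by (rule integral_mult_poisson(2)[OF f f_le a01 sums_f _ fb_le ss]) measurable
  also have "\<dots> = ?u 0 + (\<Sum>j. ?u (Suc j))" using suminf_split_head[OF su] by simp
  also have "?u 0 = (\<integral>z. (fb z)\<^sup>2 \<partial>\<pi>)"
    by (intro Bochner_Integration.integral_cong) (auto simp: integral_return power2_eq_square)
  finally show ?thesis unfolding 1 by (simp add: asymp_var_def)
qed

lemma asymp_var_nonneg: "0 \<le> asymp_var M Q \<pi> f"
proof -
  have "0 \<le> (\<integral>z. h z \<partial>\<pi>)" using h_nonneg by (intro integral_nonneg_AE) auto
  then show ?thesis by (simp only: pi_h)
qed

text \<open>Conditional variance of a block started in \<open>z\<close>: the increments are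
  orthogonal, and the one after \<open>l\<close> steps contributes the mean of \<open>h\<close> at
  that time.\<close>

definition H where "H z = (\<Sum>l<b. \<integral>x. h x \<partial>kernel_pow M Q l z)"

text \<open>\<open>10 = 4 + 6\<close>: the 4 stems from the telescoping part, and
  \<open>6 = 4 * 3/2\<close> from the mixed terms, which add up to a multiple \<open>3/2\<close> of
  \<open>G\<^sup>2\<close> over a block.\<close>

definition CH where "CH = 10 * A powr (1 / p) * G\<^sup>2"

lemma H_measurable [measurable]: "H \<in> borel_measurable M"
  unfolding H_def[abs_def] by measurable

lemma H_nonneg: "z \<in> space M \<Longrightarrow> 0 \<le> H z"
  unfolding H_def using h_nonneg by (intro sum_nonneg integral_nonneg_AE AE_I2) auto

lemma h_int: "z \<in> space M \<Longrightarrow> integrable (kernel_pow M Q k z) h"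
  by (rule bdd_kernel_int[OF _ h_le q01(2)]) measurable

text \<open>
  Since \<open>h = Q g\<^sup>2 - g\<^sup>2 + 2 g f - f\<^sup>2\<close> (with \<open>f\<close> centered), the first part of the block sum telescopes; this is what keeps
  \<open>H\<close> of the order of \<open>G\<^sup>2\<close> instead of \<open>b * G\<^sup>2\<close>.
\<close>

lemma H_le:
  assumes z: "z \<in> space M"
  shows "\<bar>H z\<bar> \<le> CH * V z powr (1 / p)"
proof -
  let ?w = "\<lambda>x. 2 * (g x * fb x) - (fb x)\<^sup>2"
  let ?I = "\<lambda>l \<phi>. \<integral>x. \<phi> x \<partial>kernel_pow M Q l z"
  define B where "B = 3 * F * A powr (1 / (2 * p)) * G"
  have B0: "0 \<le> B" using F G_pos by (simp add: B_def)
  have gf_le: "\<bar>g x * fb x\<bar> \<le> B * V x powr (1 / p)" if "x \<in> space M" for x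
    using prod_le[OF that g_le[OF that] fb_le[OF that]] G_pos by (simp add: B_def mult_ac)
  have gf_i: "integrable (kernel_pow M Q l z) (\<lambda>x. g x * fb x)" for l
    by (rule bdd_kernel_int[OF _ gf_le q01(2) z]) measurable
  have ff_i: "integrable (kernel_pow M Q l z) (\<lambda>x. (fb x)\<^sup>2)" for l
    using bdd_kernel_int[OF _ prod_le[OF _ fb_le fb_le] q01(2) z] F by (simp add: power2_eq_square)
  have step: "?I l h \<le> ?I (Suc l) (\<lambda>x. (g x)\<^sup>2) - ?I l (\<lambda>x. (g x)\<^sup>2) + 2 * (4 * B * A powr (1 / p) * V z powr (1 / p))" for l
  proof -
    have i: "integrable (kernel_pow M Q l z) (\<lambda>y. \<integral>x. (g x)\<^sup>2 \<partial>kernel_pow M Q (Suc 0) y)"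
      and e: "?I (l + Suc 0) (\<lambda>x. (g x)\<^sup>2) = ?I l (\<lambda>y. \<integral>x. (g x)\<^sup>2 \<partial>kernel_pow M Q (Suc 0) y)"
      by (rule integral_kernel_pow_add[OF _ z g2_int]; measurable)+
    have "?I l h = ?I l (\<lambda>y. (\<integral>x. (g x)\<^sup>2 \<partial>kernel_pow M Q (Suc 0) y) - (g y)\<^sup>2 + 2 * (g y * fb y) - (fb y)\<^sup>2)"
      using z by (intro Bochner_Integration.integral_cong)
        (auto simp: h_def Kg_eq power2_eq_square algebra_simps)
    also have "\<dots> = ?I (Suc l) (\<lambda>x. (g x)\<^sup>2) - ?I l (\<lambda>x. (g x)\<^sup>2) + 2 * ?I l (\<lambda>y. g y * fb y) - ?I l (\<lambda>y. (fb y)\<^sup>2)"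
      using i g2_int[OF z, of l] gf_i[of l] ff_i[of l] e by simp
    also have "\<dots> \<le> ?I (Suc l) (\<lambda>x. (g x)\<^sup>2) - ?I l (\<lambda>x. (g x)\<^sup>2) + 2 * \<bar>?I l (\<lambda>y. g y * fb y)\<bar>"
    proof -
      have "0 \<le> ?I l (\<lambda>y. (fb y)\<^sup>2)" by simp
      then show ?thesis by linarith
    qed
    also have "\<bar>?I l (\<lambda>y. g y * fb y)\<bar> \<le> 4 * B * A powr (1 / p) * V z powr (1 / p)"
      by (rule kernel_bdd_le[OF _ gf_le q01 z]) measurable
    finally show ?thesis by simp
  qed
  have "H z \<le> (\<Sum>l<b. ?I (Suc l) (\<lambda>x. (g x)\<^sup>2) - ?I l (\<lambda>x. (g x)\<^sup>2) + 2 * (4 * B * A powr (1 / p) * V z powr (1 / p)))"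
    unfolding H_def by (intro sum_mono step)
  also have "\<dots> = ?I b (\<lambda>x. (g x)\<^sup>2) - ?I 0 (\<lambda>x. (g x)\<^sup>2) + real b * (2 * (4 * B * A powr (1 / p) * V z powr (1 / p)))"
    using sum_lessThan_telescope[of "\<lambda>l. ?I l (\<lambda>x. (g x)\<^sup>2)" b] by (simp add: sum.distrib)
  also have "\<dots> \<le> 4 * G\<^sup>2 * A powr (1 / p) * V z powr (1 / p) + (2 * B * real b) * (4 * A powr (1 / p) * V z powr (1 / p))"
  proof -
    have "0 \<le> ?I 0 (\<lambda>x. (g x)\<^sup>2)" by (rule integral_nonneg_AE) simp
    moreover have "\<bar>?I b (\<lambda>x. (g x)\<^sup>2)\<bar> \<le> 4 * G\<^sup>2 * A powr (1 / p) * V z powr (1 / p)"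
      by (rule kernel_bdd_le[OF _ g2_le q01 z]) measurable
    moreover have "real b * (2 * (4 * B * A powr (1 / p) * V z powr (1 / p))) = (2 * B * real b) * (4 * A powr (1 / p) * V z powr (1 / p))"
      by (simp add: mult_ac)
    ultimately show ?thesis by linarith
  qed
  also have "\<dots> \<le> 4 * G\<^sup>2 * A powr (1 / p) * V z powr (1 / p) + (3/2 * G\<^sup>2) * (4 * A powr (1 / p) * V z powr (1 / p))"
  proof (intro add_left_mono mult_right_mono)
    \<comment> \<open>\<open>B\<close> equals \<open>G\<^sup>2 / (2 * p * \<tau>)\<close>, because
      \<open>fb\<close> is smaller than \<open>g\<close> by the factor of the Poisson series; a
      block of length at most \<open>3/2 * p * \<tau>\<close> just compensates this.\<close>
    have "2 * B * real b \<le> 2 * B * (3/2 * p * real \<tau>)"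
      using B0 b_bounds by (intro mult_left_mono) auto
    also have "\<dots> = 3/2 * G\<^sup>2" by (simp add: B_def G_def power2_eq_square)
    finally show "2 * B * real b \<le> 3/2 * G\<^sup>2" .
  qed auto
  also have "\<dots> = CH * V z powr (1 / p)" by (simp add: CH_def)
  finally show ?thesis using H_nonneg[OF z] by simp
qed

lemma pi_H: "(\<integral>z. H z \<partial>\<pi>) = real b * asymp_var M Q \<pi> f"
proof -
  have "(\<integral>z. H z \<partial>\<pi>) = (\<Sum>l<b. \<integral>z. (\<integral>x. h x \<partial>kernel_pow M Q l z) \<partial>\<pi>)"
    unfolding H_def
    by (intro Bochner_Integration.integral_sum integral_pi_kernel_pow(1)[OF _ h_le q01(2)]) auto
  also have "\<dots> = (\<Sum>l<b. \<integral>z. h z \<partial>\<pi>)"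
    by (intro sum.cong refl integral_pi_kernel_pow(2)[OF _ h_le q01(2)]) auto
  finally show ?thesis by (simp add: pi_h)
qed

definition d :: "nat \<Rightarrow> (nat \<Rightarrow> 'a) \<Rightarrow> real" where
  "d i \<omega> = g (\<omega> (Suc i)) - Kg (\<omega> i)"

lemma d_measurable [measurable]: "d i \<in> borel_measurable P"
  unfolding d_def[abs_def] by measurable

lemma d_Fil:
  assumes "i < k"
  shows "d i \<in> borel_measurable (Fil k)"
proof -
  have [measurable]: "(\<lambda>\<omega>. \<omega> (Suc i)) \<in> Fil k \<rightarrow>\<^sub>M M" "(\<lambda>\<omega>. \<omega> i) \<in> Fil k \<rightarrow>\<^sub>M M"
    using assms by (auto intro: measurable_coord_Fil)
  show ?thesis unfolding d_def[abs_def] by measurable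
qed

lemma int_2p_coord:
  assumes m: "\<phi> \<in> borel_measurable M" and le: "\<And>z. z \<in> space M \<Longrightarrow> \<bar>\<phi> z\<bar> \<le> B * V z powr (1 / (2 * p))"
  shows "integrable P (\<lambda>\<omega>. \<bar>\<phi> (\<omega> i)\<bar> powr (2 * p))"
    and "(\<integral>\<omega>. \<bar>\<phi> (\<omega> i)\<bar> powr (2 * p) \<partial>P) \<le> B powr (2 * p) * v"
  using moment_coord[OF m le, of "2 * p" i] p v_ge2 by simp_all

lemmas g_2p = int_2p_coord[OF g_measurable g_le]
lemmas Kg_2p = int_2p_coord[OF Kg_measurable Kg_le]

lemma d_2p: "integrable P (\<lambda>\<omega>. \<bar>d i \<omega>\<bar> powr (2 * p))"
proof -
  have "integrable P (\<lambda>\<omega>. \<bar>g (\<omega> (Suc i)) + (-1) * Kg (\<omega> i)\<bar> powr (2 * p))"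
    using p by (intro P.integrable_powr_add P.integrable_powr_cmult g_2p Kg_2p) auto
  then show ?thesis by (simp add: d_def)
qed

lemma sum_d_2p: "integrable P (\<lambda>\<omega>. \<bar>\<Sum>l<m. d (k + l) \<omega>\<bar> powr (2 * p))"
  using p by (intro P.integrable_powr_sum d_2p) auto

lemma p2: "2 \<le> 2 * p" using p by simp

context
  fixes U X :: "(nat \<Rightarrow> 'a) \<Rightarrow> real" and k :: nat and B :: real
  assumes U: "U \<in> borel_measurable (Fil k)" and U_le: "\<And>\<omega>. \<omega> \<in> space P \<Longrightarrow> \<bar>U \<omega>\<bar> \<le> B * \<bar>X \<omega>\<bar> powr (2 * p - 2)"
    and X [measurable]: "X \<in> borel_measurable P" and Xi: "integrable P (\<lambda>\<omega>. \<bar>X \<omega>\<bar> powr (2 * p))"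
begin

private lemma UP: "U \<in> borel_measurable P"
  by (rule measurable_Fil_P[OF U])

private lemma int3:
  assumes "Y \<in> borel_measurable P" "Z \<in> borel_measurable P"
    and "integrable P (\<lambda>\<omega>. \<bar>Y \<omega>\<bar> powr (2 * p))" "integrable P (\<lambda>\<omega>. \<bar>Z \<omega>\<bar> powr (2 * p))"
  shows "integrable P (\<lambda>\<omega>. U \<omega> * (Y \<omega> * Z \<omega>))"
  by (rule P.integrable_powr_prod[OF p2 U_le Xi assms(3,4)]) (use assms UP in auto)

text \<open>Conditioning at time \<open>i\<close> replaces \<open>g\<close> at the next state by
  \<open>Kg\<close>. The factor \<open>Y\<close> may depend on times up to \<open>i\<close>, later
  than the weight \<open>U\<close>; with a partial block sum for \<open>Y\<close> this kills the
  cross terms in the variance of a block.\<close>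

lemma martingale_increment_orthogonal:
  assumes Y: "Y \<in> borel_measurable (Fil i)" and ki: "k \<le> i" and Yi: "integrable P (\<lambda>\<omega>. \<bar>Y \<omega>\<bar> powr (2 * p))"
  shows "(\<integral>\<omega>. U \<omega> * (Y \<omega> * d i \<omega>) \<partial>P) = 0"
proof -
  have YP [measurable]: "Y \<in> borel_measurable P" by (rule measurable_Fil_P[OF Y])
  have UY: "(\<lambda>\<omega>. U \<omega> * Y \<omega>) \<in> borel_measurable (Fil i)"
    using measurable_Fil_mono[OF U ki] Y by simp
  have i1: "integrable P (\<lambda>\<omega>. U \<omega> * (Y \<omega> * g (\<omega> (Suc i))))"
    by (intro int3 Yi g_2p) auto
  have i2: "integrable P (\<lambda>\<omega>. U \<omega> * (Y \<omega> * Kg (\<omega> i)))"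
    by (intro int3 Yi Kg_2p) auto
  have "integrable P (\<lambda>\<omega>. g (\<omega> (i + Suc 0)))"
    using bdd_pi_int[OF g_measurable g_le a01(2)] by (subst integrable_coord) auto
  then have "(\<integral>\<omega>. U \<omega> * Y \<omega> * g (\<omega> (i + Suc 0)) \<partial>P) = (\<integral>\<omega>. U \<omega> * Y \<omega> * (\<integral>y. g y \<partial>kernel_pow M Q (Suc 0) (\<omega> i)) \<partial>P)"
    by (rule integral_P_markov(2)[OF UY g_measurable _ _ g_int]) (use i1 in \<open>auto simp: mult.assoc\<close>)
  then have e: "(\<integral>\<omega>. U \<omega> * (Y \<omega> * g (\<omega> (Suc i))) \<partial>P) = (\<integral>\<omega>. U \<omega> * (Y \<omega> * Kg (\<omega> i)) \<partial>P)"
    by (simp add: Kg_def mult.assoc)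
  have "(\<integral>\<omega>. U \<omega> * (Y \<omega> * d i \<omega>) \<partial>P) = (\<integral>\<omega>. U \<omega> * (Y \<omega> * g (\<omega> (Suc i))) - U \<omega> * (Y \<omega> * Kg (\<omega> i)) \<partial>P)"
    by (simp add: d_def algebra_simps)
  also have "\<dots> = 0" using i1 i2 e by simp
  finally show ?thesis .
qed

lemma block_orthogonal:
  assumes Y: "Y \<in> borel_measurable (Fil k)" and Yi: "integrable P (\<lambda>\<omega>. \<bar>Y \<omega>\<bar> powr (2 * p))"
  shows "(\<integral>\<omega>. U \<omega> * (Y \<omega> * (\<Sum>l<m. d (k + l) \<omega>)) \<partial>P) = 0"
proof -
  have "(\<integral>\<omega>. U \<omega> * (Y \<omega> * (\<Sum>l<m. d (k + l) \<omega>)) \<partial>P) = (\<Sum>l<m. \<integral>\<omega>. U \<omega> * (Y \<omega> * d (k + l) \<omega>) \<partial>P)"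
    unfolding sum_distrib_left
    by (intro Bochner_Integration.integral_sum int3 Yi d_2p) (use measurable_Fil_P[OF Y] in auto)
  also have "\<dots> = 0"
    by (intro sum.neutral ballI martingale_increment_orthogonal Yi measurable_Fil_mono[OF Y]) auto
  finally show ?thesis .
qed

text \<open>Induction on the block length: the cross term of the new increment with the earlier ones
  vanishes, and only its square remains. Integrability is carried along because the next step has to
  add the integrals.\<close>

lemma block_variance:
  "(\<integral>\<omega>. U \<omega> * (\<Sum>l<m. d (k + l) \<omega>)\<^sup>2 \<partial>P) = (\<integral>\<omega>. U \<omega> * (\<Sum>l<m. \<integral>x. h x \<partial>kernel_pow M Q l (\<omega> k)) \<partial>P)
   \<and> integrable P (\<lambda>\<omega>. U \<omega> * (\<Sum>l<m. \<integral>x. h x \<partial>kernel_pow M Q l (\<omega> k)))"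
proof (induction m)
  case (Suc m)
  let ?S = "\<lambda>\<omega>. \<Sum>l<m. d (k + l) \<omega>" and ?e = "d (k + m)"
  have SF: "?S \<in> borel_measurable (Fil (k + m))"
    using d_Fil[of _ "k + m"] by (intro borel_measurable_sum) auto
  have UF: "U \<in> borel_measurable (Fil (k + m))" by (rule measurable_Fil_mono[OF U]) simp
  have i1: "integrable P (\<lambda>\<omega>. U \<omega> * (?S \<omega> * ?S \<omega>))" by (intro int3 sum_d_2p) auto
  have i2: "integrable P (\<lambda>\<omega>. U \<omega> * (?S \<omega> * ?e \<omega>))" by (intro int3 sum_d_2p d_2p) auto
  have i3: "integrable P (\<lambda>\<omega>. U \<omega> * (?e \<omega> * ?e \<omega>))" by (intro int3 d_2p) auto
  have "(\<integral>\<omega>. U \<omega> * (\<Sum>l<Suc m. d (k + l) \<omega>)\<^sup>2 \<partial>P)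
      = (\<integral>\<omega>. U \<omega> * (?S \<omega> * ?S \<omega>) + 2 * (U \<omega> * (?S \<omega> * ?e \<omega>)) + U \<omega> * (?e \<omega> * ?e \<omega>) \<partial>P)"
    by (intro Bochner_Integration.integral_cong refl) (simp add: power2_eq_square algebra_simps)
  also have "\<dots> = (\<integral>\<omega>. U \<omega> * (?S \<omega> * ?S \<omega>) \<partial>P) + (\<integral>\<omega>. U \<omega> * (?e \<omega> * ?e \<omega>) \<partial>P)"
    using i1 i2 i3 martingale_increment_orthogonal[OF SF _ sum_d_2p] by simp
  also have "(\<integral>\<omega>. U \<omega> * (?S \<omega> * ?S \<omega>) \<partial>P) = (\<integral>\<omega>. U \<omega> * (\<Sum>l<m. \<integral>x. h x \<partial>kernel_pow M Q l (\<omega> k)) \<partial>P)"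
    using Suc by (simp add: power2_eq_square)
  also have "(\<integral>\<omega>. U \<omega> * (?e \<omega> * ?e \<omega>) \<partial>P) = (\<integral>\<omega>. U \<omega> * (\<integral>x. h x \<partial>kernel_pow M Q m (\<omega> k)) \<partial>P)"
    and "integrable P (\<lambda>\<omega>. U \<omega> * (\<integral>x. h x \<partial>kernel_pow M Q m (\<omega> k)))"
  proof -
    let ?g = "\<lambda>\<omega>. g (\<omega> (Suc (k + m)))" and ?K = "\<lambda>\<omega>. Kg (\<omega> (k + m))"
    have j1: "integrable P (\<lambda>\<omega>. U \<omega> * (?g \<omega> * ?g \<omega>))" by (intro int3 g_2p) auto
    have j2: "integrable P (\<lambda>\<omega>. U \<omega> * (?K \<omega> * ?g \<omega>))" by (intro int3 g_2p Kg_2p) auto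
    have j3: "integrable P (\<lambda>\<omega>. U \<omega> * (?K \<omega> * ?K \<omega>))" by (intro int3 Kg_2p) auto
    have gi: "integrable P (\<lambda>\<omega>. g (\<omega> (k + m + Suc 0)))"
      using bdd_pi_int[OF g_measurable g_le a01(2)] by (subst integrable_coord) auto
    have g2i: "integrable P (\<lambda>\<omega>. (g (\<omega> (k + m + Suc 0)))\<^sup>2)"
      using bdd_pi_int[OF _ g2_le q01(2)] integrable_coord[of "\<lambda>z. (g z)\<^sup>2" "k + m + Suc 0"] by simp
    have k1: "integrable P (\<lambda>\<omega>. U \<omega> * (\<integral>x. (g x)\<^sup>2 \<partial>kernel_pow M Q (Suc 0) (\<omega> (k + m))))"
      and e1: "(\<integral>\<omega>. U \<omega> * (g (\<omega> (k + m + Suc 0)))\<^sup>2 \<partial>P) = (\<integral>\<omega>. U \<omega> * (\<integral>x. (g x)\<^sup>2 \<partial>kernel_pow M Q (Suc 0) (\<omega> (k + m))) \<partial>P)"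
      using integral_P_markov[OF UF _ g2i _ g2_int] j1 by (simp_all add: power2_eq_square)
    have UK: "(\<lambda>\<omega>. U \<omega> * ?K \<omega>) \<in> borel_measurable (Fil (k + m))"
      by (intro borel_measurable_times UF measurable_compose[OF measurable_coord_Fil[OF order_refl] Kg_measurable])
    have e2: "(\<integral>\<omega>. U \<omega> * ?K \<omega> * g (\<omega> (k + m + Suc 0)) \<partial>P) = (\<integral>\<omega>. U \<omega> * ?K \<omega> * (\<integral>x. g x \<partial>kernel_pow M Q (Suc 0) (\<omega> (k + m))) \<partial>P)"
      by (rule integral_P_markov(2)[OF UK g_measurable gi _ g_int]) (use j2 in \<open>auto simp: mult.assoc\<close>)
    \<comment> \<open>The square of one increment: conditioning at time \<open>k + m\<close> turns
      it into \<open>h\<close>, and conditioning at time \<open>k\<close> then turns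
      \<open>h\<close> into its average under \<open>m\<close> steps.\<close>
    have "(\<integral>\<omega>. U \<omega> * (?e \<omega> * ?e \<omega>) \<partial>P)
        = (\<integral>\<omega>. U \<omega> * (?g \<omega> * ?g \<omega>) - 2 * (U \<omega> * (?K \<omega> * ?g \<omega>)) + U \<omega> * (?K \<omega> * ?K \<omega>) \<partial>P)"
      by (intro Bochner_Integration.integral_cong refl) (simp add: d_def algebra_simps)
    also have "\<dots> = (\<integral>\<omega>. U \<omega> * (?g \<omega> * ?g \<omega>) \<partial>P) - 2 * (\<integral>\<omega>. U \<omega> * (?K \<omega> * ?g \<omega>) \<partial>P) + (\<integral>\<omega>. U \<omega> * (?K \<omega> * ?K \<omega>) \<partial>P)"
      using j1 j2 j3 by simp
    also have "(\<integral>\<omega>. U \<omega> * (?K \<omega> * ?g \<omega>) \<partial>P) = (\<integral>\<omega>. U \<omega> * (?K \<omega> * ?K \<omega>) \<partial>P)"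
      using e2 by (simp add: Kg_def[symmetric] mult.assoc)
    also have "(\<integral>\<omega>. U \<omega> * (?g \<omega> * ?g \<omega>) \<partial>P) = (\<integral>\<omega>. U \<omega> * (\<integral>x. (g x)\<^sup>2 \<partial>kernel_pow M Q (Suc 0) (\<omega> (k + m))) \<partial>P)"
      using e1 by (simp add: power2_eq_square)
    also have "\<dots> - 2 * (\<integral>\<omega>. U \<omega> * (?K \<omega> * ?K \<omega>) \<partial>P) + (\<integral>\<omega>. U \<omega> * (?K \<omega> * ?K \<omega>) \<partial>P)
        = (\<integral>\<omega>. U \<omega> * (\<integral>x. (g x)\<^sup>2 \<partial>kernel_pow M Q (Suc 0) (\<omega> (k + m))) - U \<omega> * (?K \<omega> * ?K \<omega>) \<partial>P)"
      using k1 j3 by simp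
    also have "\<dots> = (\<integral>\<omega>. U \<omega> * h (\<omega> (k + m)) \<partial>P)"
      by (intro Bochner_Integration.integral_cong refl) (simp add: h_def power2_eq_square algebra_simps)
    finally have e3: "(\<integral>\<omega>. U \<omega> * (?e \<omega> * ?e \<omega>) \<partial>P) = (\<integral>\<omega>. U \<omega> * h (\<omega> (k + m)) \<partial>P)" .
    have i4: "integrable P (\<lambda>\<omega>. U \<omega> * h (\<omega> (k + m)))"
      using Bochner_Integration.integrable_diff[OF k1 j3]
      by (simp add: h_def power2_eq_square right_diff_distrib)
    have hi: "integrable P (\<lambda>\<omega>. h (\<omega> (k + m)))"
      using bdd_pi_int[OF h_measurable h_le q01(2)] by (subst integrable_coord) auto
    show "(\<integral>\<omega>. U \<omega> * (?e \<omega> * ?e \<omega>) \<partial>P) = (\<integral>\<omega>. U \<omega> * (\<integral>x. h x \<partial>kernel_pow M Q m (\<omega> k)) \<partial>P)"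
      unfolding e3 by (rule integral_P_markov(2)[OF U h_measurable hi i4 h_int])
    show "integrable P (\<lambda>\<omega>. U \<omega> * (\<integral>x. h x \<partial>kernel_pow M Q m (\<omega> k)))"
      by (rule integral_P_markov(1)[OF U h_measurable hi i4 h_int])
  qed
  ultimately show ?case
    using Suc by (simp add: distrib_left)
qed simp

end

end

section \<open>Fluctuation of the block variances along the sampled chain\<close>

context vge_rosenthal
begin

definition GH where "GH = poisson b H"
definition KH where "KH z = (\<integral>x. GH x \<partial>kernel_pow M Q b z)"
text \<open>The general Poisson bound \<open>3 * C * \<sigma>\<close> with \<open>C = CH\<close> and
  the series bound \<open>\<sigma> = 4/3\<close>.\<close>

definition \<Gamma> where "\<Gamma> = 4 * CH * A powr (1 / p)"
text \<open>The cruder martingale inequality demands an exponent of at least 2, while the quadratic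
  variation enters with \<open>p / 2\<close>, which may be smaller. Since \<open>q \<le> p\<close>,
  functions bounded by \<open>V powr (1 / p)\<close> still have \<open>q\<close> moments.\<close>

definition q where "q = max (p / 2) 2"
definition \<sigma>2 where "\<sigma>2 = asymp_var M Q \<pi> f"

lemma q_bounds: "2 \<le> q" "p / 2 \<le> q" "q + 1 \<le> 3/2 * p" and qp: "0 < 1 / p" "1 / p * q \<le> 1"
proof -
  show "2 \<le> q" "p / 2 \<le> q" "q + 1 \<le> 3/2 * p" using p by (simp_all add: q_def max_def)
  have "q \<le> p" using p by (simp add: q_def)
  then show "0 < 1 / p" "1 / p * q \<le> 1" using p by simp_all
qed

lemma \<Gamma>_pos: "0 < \<Gamma>" using A_pos G_pos by (simp add: \<Gamma>_def CH_def)

lemma GH_measurable [measurable]: "GH \<in> borel_measurable M"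
  unfolding GH_def by (rule poisson_measurable[OF H_measurable H_le q01 sums_H])

lemma KH_measurable [measurable]: "KH \<in> borel_measurable M"
  unfolding KH_def[abs_def] by (rule measurable_lebesgue_kernel_pow[OF GH_measurable])

lemma GH_le: "z \<in> space M \<Longrightarrow> \<bar>GH z\<bar> \<le> \<Gamma> * V z powr (1 / p)"
  using poisson_le[OF H_measurable H_le q01 sums_H, of z] by (simp add: GH_def \<Gamma>_def mult_ac)

lemma KH_le: "z \<in> space M \<Longrightarrow> \<bar>KH z\<bar> \<le> \<Gamma> * V z powr (1 / p)"
  using poisson_equation(2)[OF H_measurable H_le q01 sums_H, of z] by (simp add: GH_def KH_def \<Gamma>_def mult_ac)

lemma KH_eq: "z \<in> space M \<Longrightarrow> KH z = GH z - (H z - real b * \<sigma>2)"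
  using poisson_equation(1)[OF H_measurable H_le q01 sums_H, of z] pi_H
  unfolding KH_def GH_def centered_def \<sigma>2_def by simp

lemma GH_int: "z \<in> space M \<Longrightarrow> integrable (kernel_pow M Q k z) GH"
  by (rule bdd_kernel_int[OF GH_measurable GH_le q01(2)])

text \<open>Martingale increments of the chain sampled at block starts; \<open>Suc j * b\<close> is
  the start of the next block.\<close>

definition e where "e j \<omega> = GH (\<omega> (Suc j * b)) - KH (\<omega> (j * b))"
definition N where "N m \<omega> = (\<Sum>j<m. H (\<omega> (j * b)) - real b * \<sigma>2)"

lemma e_measurable [measurable]: "e j \<in> borel_measurable P"
  unfolding e_def[abs_def]
  by (intro borel_measurable_diff measurable_compose[OF coord_measurable GH_measurable]
      measurable_compose[OF coord_measurable KH_measurable])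

lemma N_measurable [measurable]: "N m \<in> borel_measurable P"
  unfolding N_def[abs_def]
  by (intro borel_measurable_sum borel_measurable_diff borel_measurable_const
      measurable_compose[OF coord_measurable H_measurable])

lemma GH_q: "integrable P (\<lambda>\<omega>. \<bar>GH (\<omega> i)\<bar> powr q)"
    "(\<integral>\<omega>. \<bar>GH (\<omega> i)\<bar> powr q \<partial>P) \<le> \<Gamma> powr q * v powr (1 / p * q)"
    "(\<lambda>\<omega>. GH (\<omega> i)) \<in> borel_measurable P"
proof -
  have q0: "0 < q" using q_bounds(1) by linarith
  show "integrable P (\<lambda>\<omega>. \<bar>GH (\<omega> i)\<bar> powr q)"
    by (rule moment_coord(1)[OF GH_measurable GH_le q0 qp])
  show "(\<integral>\<omega>. \<bar>GH (\<omega> i)\<bar> powr q \<partial>P) \<le> \<Gamma> powr q * v powr (1 / p * q)"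
    by (rule moment_coord(2)[OF GH_measurable GH_le q0 qp])
  show "(\<lambda>\<omega>. GH (\<omega> i)) \<in> borel_measurable P"
    by (rule measurable_compose[OF coord_measurable GH_measurable])
qed

lemma KH_q: "integrable P (\<lambda>\<omega>. \<bar>KH (\<omega> i)\<bar> powr q)"
    "(\<integral>\<omega>. \<bar>KH (\<omega> i)\<bar> powr q \<partial>P) \<le> \<Gamma> powr q * v powr (1 / p * q)"
    "(\<lambda>\<omega>. KH (\<omega> i)) \<in> borel_measurable P"
proof -
  have q0: "0 < q" using q_bounds(1) by linarith
  show "integrable P (\<lambda>\<omega>. \<bar>KH (\<omega> i)\<bar> powr q)"
    by (rule moment_coord(1)[OF KH_measurable KH_le q0 qp])
  show "(\<integral>\<omega>. \<bar>KH (\<omega> i)\<bar> powr q \<partial>P) \<le> \<Gamma> powr q * v powr (1 / p * q)"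
    by (rule moment_coord(2)[OF KH_measurable KH_le q0 qp])
  show "(\<lambda>\<omega>. KH (\<omega> i)) \<in> borel_measurable P"
    by (rule measurable_compose[OF coord_measurable KH_measurable])
qed

definition E_jump where "E_jump = 2 * (2 * \<Gamma>) powr q * v powr (1 / p * q)"

text \<open>One bound covers both the martingale increments \<open>e\<close> and the boundary term
  \<open>GH (\<omega> 0) - GH (\<omega> (m * b))\<close>, as each is a difference of two quantities
  of size \<Gamma>.\<close>

lemma coboundary_q:
  assumes [measurable]: "X \<in> borel_measurable P" "Y \<in> borel_measurable P"
    and "integrable P (\<lambda>\<omega>. \<bar>X \<omega>\<bar> powr q)" "integrable P (\<lambda>\<omega>. \<bar>Y \<omega>\<bar> powr q)"
    and "(\<integral>\<omega>. \<bar>X \<omega>\<bar> powr q \<partial>P) \<le> \<Gamma> powr q * v powr (1 / p * q)" "(\<integral>\<omega>. \<bar>Y \<omega>\<bar> powr q \<partial>P) \<le> \<Gamma> powr q * v powr (1 / p * q)"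
  shows "integrable P (\<lambda>\<omega>. \<bar>X \<omega> - Y \<omega>\<bar> powr q)" "(\<integral>\<omega>. \<bar>X \<omega> - Y \<omega>\<bar> powr q \<partial>P) \<le> E_jump"
proof -
  have q0: "0 \<le> q" using q_bounds by simp
  have "integrable P (\<lambda>\<omega>. \<bar>X \<omega> + (-1) * Y \<omega>\<bar> powr q)"
    by (rule P.integrable_powr_add[OF assms(3) P.integrable_powr_cmult[OF assms(4)] q0]) measurable
  then show i: "integrable P (\<lambda>\<omega>. \<bar>X \<omega> - Y \<omega>\<bar> powr q)" by simp
  have "(\<integral>\<omega>. \<bar>X \<omega> - Y \<omega>\<bar> powr q \<partial>P) \<le> (\<integral>\<omega>. 2 powr q * (\<bar>X \<omega>\<bar> powr q + \<bar>Y \<omega>\<bar> powr q) \<partial>P)"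
    by (rule integral_mono[OF i _ abs_diff_powr_le[OF q0]]) (use assms(3,4) in simp)
  also have "\<dots> = 2 powr q * ((\<integral>\<omega>. \<bar>X \<omega>\<bar> powr q \<partial>P) + (\<integral>\<omega>. \<bar>Y \<omega>\<bar> powr q \<partial>P))"
    using assms(3,4) by simp
  also have "\<dots> \<le> 2 powr q * (\<Gamma> powr q * v powr (1 / p * q) + \<Gamma> powr q * v powr (1 / p * q))"
    by (intro mult_left_mono add_mono assms(5,6)) simp
  also have "\<dots> = E_jump" using \<Gamma>_pos by (simp add: E_jump_def powr_mult)
  finally show "(\<integral>\<omega>. \<bar>X \<omega> - Y \<omega>\<bar> powr q \<partial>P) \<le> E_jump" .
qed

lemma e_q: "integrable P (\<lambda>\<omega>. \<bar>e j \<omega>\<bar> powr q)" "(\<integral>\<omega>. \<bar>e j \<omega>\<bar> powr q \<partial>P) \<le> E_jump"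
  unfolding e_def by (rule coboundary_q GH_q KH_q)+

lemma e_orthogonal:
  "(\<integral>\<omega>. sgn (\<Sum>i<j. e i \<omega>) * \<bar>\<Sum>i<j. e i \<omega>\<bar> powr (q - 1) * e j \<omega> \<partial>P) = 0"
proof -
  let ?X = "\<lambda>\<omega>. \<Sum>i<j. e i \<omega>" and ?k = "j * b"
  let ?U = "\<lambda>\<omega>. \<bar>?X \<omega>\<bar> powr (q - 2)"
  have XF: "?X \<in> borel_measurable (Fil ?k)"
  proof (rule borel_measurable_sum)
    fix i assume "i \<in> {..<j}"
    then have "Suc i * b \<le> ?k" "i * b \<le> ?k" using mult_le_mono1[of "Suc i" j b] by auto
    then have [measurable]: "(\<lambda>\<omega>. \<omega> (Suc i * b)) \<in> Fil ?k \<rightarrow>\<^sub>M M" "(\<lambda>\<omega>. \<omega> (i * b)) \<in> Fil ?k \<rightarrow>\<^sub>M M"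
      by (auto intro: measurable_coord_Fil)
    show "e i \<in> borel_measurable (Fil ?k)" unfolding e_def[abs_def] by measurable
  qed
  have Xq: "integrable P (\<lambda>\<omega>. \<bar>?X \<omega>\<bar> powr q)"
    using q_bounds by (intro P.integrable_powr_sum e_q) auto
  have i3: "integrable P (\<lambda>\<omega>. ?U \<omega> * (?X \<omega> * \<phi> \<omega>))"
    if "integrable P (\<lambda>\<omega>. \<bar>\<phi> \<omega>\<bar> powr q)" "\<phi> \<in> borel_measurable P" for \<phi>
    by (rule P.integrable_powr_prod[OF q_bounds(1), where X="?X" and c=1]) (use Xq that in auto)
  have iG: "integrable P (\<lambda>\<omega>. ?U \<omega> * (?X \<omega> * GH (\<omega> (?k + b))))"
    by (intro i3 GH_q)
  have iK: "integrable P (\<lambda>\<omega>. ?U \<omega> * (?X \<omega> * KH (\<omega> ?k)))"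
    by (intro i3 KH_q)
  have UX: "(\<lambda>\<omega>. ?U \<omega> * ?X \<omega>) \<in> borel_measurable (Fil ?k)"
    using XF by measurable
  have Gi: "integrable P (\<lambda>\<omega>. GH (\<omega> (?k + b)))"
    using bdd_pi_int[OF GH_measurable GH_le q01(2)] by (subst integrable_coord) auto
  have "(\<integral>\<omega>. ?U \<omega> * ?X \<omega> * GH (\<omega> (?k + b)) \<partial>P) = (\<integral>\<omega>. ?U \<omega> * ?X \<omega> * (\<integral>y. GH y \<partial>kernel_pow M Q b (\<omega> ?k)) \<partial>P)"
    by (rule integral_P_markov(2)[OF UX GH_measurable Gi _ GH_int]) (use iG in \<open>auto simp: mult.assoc\<close>)
  then have "(\<integral>\<omega>. ?U \<omega> * (?X \<omega> * GH (\<omega> (?k + b))) - ?U \<omega> * (?X \<omega> * KH (\<omega> ?k)) \<partial>P) = 0"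
    using iG iK by (simp add: KH_def mult.assoc)
  moreover have "sgn (?X \<omega>) * \<bar>?X \<omega>\<bar> powr (q - 1) * e j \<omega> = ?U \<omega> * (?X \<omega> * GH (\<omega> (?k + b))) - ?U \<omega> * (?X \<omega> * KH (\<omega> ?k))" for \<omega>
  proof -
    have sg: "sgn x * \<bar>x\<bar> powr (q - 1) = \<bar>x\<bar> powr (q - 2) * x" for x :: real
      by (cases "x = 0") (auto simp: powr_diff power2_eq_square sgn_if)
    have ej: "e j \<omega> = GH (\<omega> (?k + b)) - KH (\<omega> ?k)" by (simp add: e_def add.commute)
    show ?thesis unfolding sg ej by (simp add: right_diff_distrib mult.assoc)
  qed
  ultimately show ?thesis by simp
qed

lemma N_eq: "\<omega> \<in> space P \<Longrightarrow> N m \<omega> = (\<Sum>j<m. e j \<omega>) + (GH (\<omega> 0) - GH (\<omega> (m * b)))"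
  by (induction m) (auto simp: N_def e_def KH_eq)

text \<open>\<open>30 = 5 * 4 * 3/2\<close>: the 5 bounds \<open>20 powr (1 / q)\<close>, the 4
  comes from splitting a power of a sum twice, and \<open>q + 1 \<le> 3/2 * p\<close> supplies the
  rest.\<close>

definition TN where "TN m = 30 * p * \<Gamma> * A powr (1 / p) * sqrt (real m)"

text \<open>By \<open>N_eq\<close> the fluctuation is a martingale plus a boundary term. Both have
  \<open>q\<close> moments, and Jensen's inequality descends from \<open>q\<close> to the exponent
  \<open>p / 2\<close>.\<close>

lemma N_moment:
  "integrable P (\<lambda>\<omega>. \<bar>N m \<omega>\<bar> powr (p / 2))" "(\<integral>\<omega>. \<bar>N m \<omega>\<bar> powr (p / 2) \<partial>P) \<le> TN m powr (p / 2)"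
proof -
  have "integrable P (\<lambda>\<omega>. \<bar>N m \<omega>\<bar> powr (p / 2)) \<and> (\<integral>\<omega>. \<bar>N m \<omega>\<bar> powr (p / 2) \<partial>P) \<le> TN m powr (p / 2)"
  proof (cases "m = 0")
    case True
    then show ?thesis using p by (simp add: N_def TN_def)
  next
    case False
    then have m: "0 < m" by simp
    let ?X = "\<lambda>j \<omega>. \<Sum>i<j. e i \<omega>"
    have q0: "0 \<le> q" using q_bounds by simp
    have Xi: "integrable P (\<lambda>\<omega>. \<bar>?X m \<omega>\<bar> powr q)"
      and Xb: "(\<integral>\<omega>. \<bar>?X m \<omega>\<bar> powr q \<partial>P) \<le> 9 * (q + 1) powr q * real m powr (q / 2) * E_jump"
      by (rule P.martingale_moment_le[where X="?X" and D=e, OF q_bounds(1) _ _ _ _ e_q e_orthogonal m]; simp)+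
    have Ci: "integrable P (\<lambda>\<omega>. \<bar>GH (\<omega> 0) - GH (\<omega> (m * b))\<bar> powr q)"
      and Cb: "(\<integral>\<omega>. \<bar>GH (\<omega> 0) - GH (\<omega> (m * b))\<bar> powr q \<partial>P) \<le> E_jump"
      by (rule coboundary_q GH_q)+
    have Ej: "0 < E_jump" using \<Gamma>_pos v_ge2 by (simp add: E_jump_def)
    have cong: "integrable P (\<lambda>\<omega>. \<bar>N m \<omega>\<bar> powr q) = integrable P (\<lambda>\<omega>. \<bar>?X m \<omega> + (GH (\<omega> 0) - GH (\<omega> (m * b)))\<bar> powr q)"
      by (rule Bochner_Integration.integrable_cong) (simp_all add: N_eq)
    have Ni: "integrable P (\<lambda>\<omega>. \<bar>N m \<omega>\<bar> powr q)"
      unfolding cong using Xi Ci q0 by (intro P.integrable_powr_add) auto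
    \<comment> \<open>The bound for the \<open>q\<close>-th moment, written as a \<open>q\<close>-th
      power. \<open>20 = (9 + 1) * 2\<close>: the 9 belongs to the martingale, the 1 to the boundary
      term, and the 2 is the one in \<open>E_jump\<close>.\<close>
    define t where "t = (20 powr (1 / q) * (4 * (q + 1) * \<Gamma> * v powr (1 / p)) * sqrt (real m)) powr q"
    have tpos: "0 < t" using m \<Gamma>_pos q_bounds v_ge2 by (simp add: t_def)
    have "(\<integral>\<omega>. \<bar>N m \<omega>\<bar> powr q \<partial>P) \<le> (\<integral>\<omega>. 2 powr q * (\<bar>?X m \<omega>\<bar> powr q + \<bar>GH (\<omega> 0) - GH (\<omega> (m * b))\<bar> powr q) \<partial>P)"
    proof (rule integral_mono[OF Ni])
      fix \<omega> assume w: "\<omega> \<in> space P"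
      have "\<bar>N m \<omega>\<bar> powr q \<le> (\<bar>?X m \<omega>\<bar> + \<bar>GH (\<omega> 0) - GH (\<omega> (m * b))\<bar>) powr q"
        using q0 by (intro powr_mono2) (auto simp: N_eq[OF w])
      also have "\<dots> \<le> 2 powr q * (\<bar>?X m \<omega>\<bar> powr q + \<bar>GH (\<omega> 0) - GH (\<omega> (m * b))\<bar> powr q)"
        using q0 by (intro powr_add_le) auto
      finally show "\<bar>N m \<omega>\<bar> powr q \<le> 2 powr q * (\<bar>?X m \<omega>\<bar> powr q + \<bar>GH (\<omega> 0) - GH (\<omega> (m * b))\<bar> powr q)" .
    qed (use Xi Ci in auto)
    also have "\<dots> = 2 powr q * ((\<integral>\<omega>. \<bar>?X m \<omega>\<bar> powr q \<partial>P) + (\<integral>\<omega>. \<bar>GH (\<omega> 0) - GH (\<omega> (m * b))\<bar> powr q \<partial>P))"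
      using Xi Ci by simp
    also have "\<dots> \<le> 2 powr q * (9 * (q + 1) powr q * real m powr (q / 2) * E_jump + 1 * E_jump)"
      using Xb Cb by (intro mult_left_mono add_mono) auto
    also have "\<dots> \<le> 2 powr q * (9 * (q + 1) powr q * real m powr (q / 2) * E_jump + ((q + 1) powr q * real m powr (q / 2)) * E_jump)"
    proof (intro mult_left_mono add_left_mono mult_right_mono)
      have "1 * 1 \<le> (q + 1) powr q * real m powr (q / 2)"
        using q_bounds m by (intro mult_mono ge_one_powr_ge_zero) auto
      then show "1 \<le> (q + 1) powr q * real m powr (q / 2)" by simp
    qed (use Ej in auto)
    also have "\<dots> = 20 * (2 powr q * (2 * \<Gamma>) powr q) * (q + 1) powr q * v powr (1 / p * q) * real m powr (q / 2)"
      by (simp add: E_jump_def algebra_simps)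
    also have "\<dots> = t"
    proof -
      have "sqrt (real m) powr q = real m powr (q / 2)"
        by (simp add: powr_half_sqrt[symmetric] powr_powr)
      moreover have "(20 powr (1 / q)) powr q = 20" using q_bounds by (simp add: powr_powr)
      moreover have "(v powr (1 / p)) powr q = v powr (1 / p * q)" by (simp add: powr_powr)
      moreover have "(4::real) powr q = 2 powr q * 2 powr q" by (simp add: powr_mult[symmetric])
      ultimately show ?thesis by (simp only: t_def powr_mult mult_ac)
    qed
    finally have Nt: "(\<integral>\<omega>. \<bar>N m \<omega>\<bar> powr q \<partial>P) \<le> t" .
    \<comment> \<open>Descent from \<open>q\<close> to \<open>p / 2\<close>: the tangent at
      \<open>t\<close> plays Jensen's inequality, and \<open>\<theta> \<le> 1\<close> because
      \<open>p / 2 \<le> q\<close>.\<close>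
    define \<theta> where "\<theta> = p / 2 / q"
    have th: "0 < \<theta>" "\<theta> \<le> 1" using q_bounds p by (auto simp: \<theta>_def)
    have pw: "\<bar>N m \<omega>\<bar> powr (p / 2) \<le> t powr \<theta> * (1 - \<theta> + \<theta> * (\<bar>N m \<omega>\<bar> powr q / t))" for \<omega>
    proof -
      have "\<bar>N m \<omega>\<bar> powr (p / 2) = (\<bar>N m \<omega>\<bar> powr q) powr \<theta>"
        using q_bounds by (simp add: powr_powr \<theta>_def)
      also have "\<dots> \<le> t powr \<theta> * (1 - \<theta> + \<theta> * (\<bar>N m \<omega>\<bar> powr q / t))"
        by (rule powr_le_tangent) (use tpos th in auto)
      finally show ?thesis .
    qed
    have i2: "integrable P (\<lambda>\<omega>. t powr \<theta> * (1 - \<theta> + \<theta> * (\<bar>N m \<omega>\<bar> powr q / t)))"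
      using Ni by simp
    have i1: "integrable P (\<lambda>\<omega>. \<bar>N m \<omega>\<bar> powr (p / 2))"
      by (rule Bochner_Integration.integrable_bound[OF i2]) (use order_trans[OF pw abs_ge_self] in \<open>auto intro!: AE_I2\<close>)
    have "(\<integral>\<omega>. \<bar>N m \<omega>\<bar> powr (p / 2) \<partial>P) \<le> (\<integral>\<omega>. t powr \<theta> * (1 - \<theta> + \<theta> * (\<bar>N m \<omega>\<bar> powr q / t)) \<partial>P)"
      by (rule integral_mono[OF i1 i2 pw])
    also have "\<dots> = t powr \<theta> * (1 - \<theta> + \<theta> * ((\<integral>\<omega>. \<bar>N m \<omega>\<bar> powr q \<partial>P) / t))"
      using Ni P.prob_space by simp
    also have "\<dots> \<le> t powr \<theta> * (1 - \<theta> + \<theta> * 1)"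
      using Nt tpos th by (intro mult_left_mono add_left_mono) auto
    also have "\<dots> = (20 powr (1 / q) * (4 * (q + 1) * \<Gamma> * v powr (1 / p)) * sqrt (real m)) powr (p / 2)"
      using q_bounds by (simp add: t_def powr_powr \<theta>_def)
    also have "\<dots> \<le> TN m powr (p / 2)"
    proof (rule powr_mono2)
      have "20 powr (1 / q) \<le> (20::real) powr (1 / 2)"
        using q_bounds by (intro powr_mono) (auto simp: field_simps)
      also have "\<dots> = sqrt 20" by (simp add: powr_half_sqrt)
      also have "\<dots> \<le> 5" by (rule real_le_lsqrt) auto
      finally have "20 powr (1 / q) * (4 * (q + 1) * \<Gamma> * v powr (1 / p)) * sqrt (real m)
          \<le> 5 * (4 * (3/2 * p) * \<Gamma> * A powr (1 / p)) * sqrt (real m)"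
        using q_bounds \<Gamma>_pos v_le_A v_ge2 p
        by (intro mult_right_mono mult_mono powr_mono2) auto
      then show "20 powr (1 / q) * (4 * (q + 1) * \<Gamma> * v powr (1 / p)) * sqrt (real m) \<le> TN m"
        by (simp add: TN_def)
    qed (use q_bounds \<Gamma>_pos p in auto)
    finally show ?thesis using i1 by simp
  qed
  then show "integrable P (\<lambda>\<omega>. \<bar>N m \<omega>\<bar> powr (p / 2))" "(\<integral>\<omega>. \<bar>N m \<omega>\<bar> powr (p / 2) \<partial>P) \<le> TN m powr (p / 2)"
    by auto
qed

lemma sum_fb: "\<omega> \<in> space P \<Longrightarrow> (\<Sum>l<m. fb (\<omega> (k + l))) = (\<Sum>l<m. d (k + l) \<omega>) + g (\<omega> k) - g (\<omega> (k + m))"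
  by (induction m) (auto simp: d_def Kg_eq)

text \<open>The crude power mean inequality costs a factor \<open>j\<close>, harmless because of the factor \<open>n powr (1 / p)\<close> in the last term of the bound.\<close>

lemma remainder_moment:
  assumes r: "0 < r" "r \<le> 2 * p" and j: "j \<le> b"
  shows "integrable P (\<lambda>\<omega>. \<bar>(\<Sum>l<j. fb (\<omega> (k + l))) + g (\<omega> i) - g (\<omega> i')\<bar> powr r)"
    and "(\<integral>\<omega>. \<bar>(\<Sum>l<j. fb (\<omega> (k + l))) + g (\<omega> i) - g (\<omega> i')\<bar> powr r \<partial>P)
      \<le> (real j + 2) * (3 * G) powr r * v powr (1 / (2 * p) * r)"
proof -
  let ?S = "\<lambda>\<omega>. \<Sum>l<j. fb (\<omega> (k + l))"
  let ?B = "3 * F * A powr (1 / (2 * p))" and ?w = "v powr (1 / (2 * p) * r)"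
  have rs: "1 / (2 * p) * r \<le> 1" using r p by (simp add: field_simps)
  note fm = moment_coord[OF fb_measurable fb_le r(1) a01(1) rs]
  note gm = moment_coord[OF g_measurable g_le r(1) a01(1) rs]
  have Si: "integrable P (\<lambda>\<omega>. \<bar>?S \<omega>\<bar> powr r)"
    using r by (intro P.integrable_powr_sum fm) auto
  have "integrable P (\<lambda>\<omega>. \<bar>(?S \<omega> + g (\<omega> i)) + (-1) * g (\<omega> i')\<bar> powr r)"
    using r by (intro P.integrable_powr_add P.integrable_powr_cmult Si gm) auto
  then show I: "integrable P (\<lambda>\<omega>. \<bar>?S \<omega> + g (\<omega> i) - g (\<omega> i')\<bar> powr r)" by simp
  have "(\<integral>\<omega>. \<bar>?S \<omega> + g (\<omega> i) - g (\<omega> i')\<bar> powr r \<partial>P)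
     \<le> (\<integral>\<omega>. 3 powr r * (real j powr r * (\<Sum>l<j. \<bar>fb (\<omega> (k + l))\<bar> powr r) + \<bar>g (\<omega> i)\<bar> powr r + \<bar>g (\<omega> i')\<bar> powr r) \<partial>P)"
  proof (rule integral_mono[OF I])
    fix \<omega>
    have "\<bar>?S \<omega> + g (\<omega> i) - g (\<omega> i')\<bar> powr r \<le> ((\<Sum>l<j. \<bar>fb (\<omega> (k + l))\<bar>) + \<bar>g (\<omega> i)\<bar> + \<bar>g (\<omega> i')\<bar>) powr r"
    proof (rule powr_mono2)
      show "\<bar>?S \<omega> + g (\<omega> i) - g (\<omega> i')\<bar> \<le> (\<Sum>l<j. \<bar>fb (\<omega> (k + l))\<bar>) + \<bar>g (\<omega> i)\<bar> + \<bar>g (\<omega> i')\<bar>"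
        using sum_abs[of "\<lambda>l. fb (\<omega> (k + l))" "{..<j}"] by linarith
    qed (use r in auto)
    also have "\<dots> \<le> 3 powr r * ((\<Sum>l<j. \<bar>fb (\<omega> (k + l))\<bar>) powr r + \<bar>g (\<omega> i)\<bar> powr r + \<bar>g (\<omega> i')\<bar> powr r)"
      using r by (intro powr_add3_le) (auto intro: sum_nonneg)
    also have "\<dots> \<le> 3 powr r * (real j powr r * (\<Sum>l<j. \<bar>fb (\<omega> (k + l))\<bar> powr r) + \<bar>g (\<omega> i)\<bar> powr r + \<bar>g (\<omega> i')\<bar> powr r)"
      using r by (intro mult_left_mono add_right_mono sum_powr_le) auto
    finally show "\<bar>?S \<omega> + g (\<omega> i) - g (\<omega> i')\<bar> powr r
      \<le> 3 powr r * (real j powr r * (\<Sum>l<j. \<bar>fb (\<omega> (k + l))\<bar> powr r) + \<bar>g (\<omega> i)\<bar> powr r + \<bar>g (\<omega> i')\<bar> powr r)" .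
  qed (use fm gm in auto)
  also have "\<dots> = 3 powr r * (real j powr r * (\<Sum>l<j. \<integral>\<omega>. \<bar>fb (\<omega> (k + l))\<bar> powr r \<partial>P) + (\<integral>\<omega>. \<bar>g (\<omega> i)\<bar> powr r \<partial>P) + (\<integral>\<omega>. \<bar>g (\<omega> i')\<bar> powr r \<partial>P))"
    using fm gm by simp
  also have "\<dots> \<le> 3 powr r * (real j powr r * (\<Sum>l<j. ?B powr r * ?w) + G powr r * ?w + G powr r * ?w)"
    by (intro mult_left_mono add_mono sum_mono fm gm) auto
  also have "real j powr r * (\<Sum>l<j. ?B powr r * ?w) = (real j * ?B) powr r * (real j * ?w)"
    using F A_pos by (simp add: powr_mult)
  also have "3 powr r * ((real j * ?B) powr r * (real j * ?w) + G powr r * ?w + G powr r * ?w)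
      \<le> 3 powr r * (G powr r * (real j * ?w) + G powr r * ?w + G powr r * ?w)"
  proof (intro mult_left_mono add_right_mono mult_right_mono powr_mono2)
    \<comment> \<open>A sum of at most \<open>b\<close> terms \<open>fb\<close> has the size of
      \<open>g\<close>: the product on the right is three quarters of \<open>G\<close>.\<close>
    have "real j * ?B \<le> (3/2 * p * real \<tau>) * ?B"
      using j b_bounds F by (intro mult_right_mono) auto
    also have "\<dots> \<le> G" using p F tau A_pos by (simp add: G_def field_simps)
    finally show "real j * ?B \<le> G" .
  qed (use r F in auto)
  also have "\<dots> = (real j + 2) * (3 * G) powr r * ?w"
    using G_pos by (simp add: powr_mult algebra_simps)
  finally show "(\<integral>\<omega>. \<bar>?S \<omega> + g (\<omega> i) - g (\<omega> i')\<bar> powr r \<partial>P) \<le> (real j + 2) * (3 * G) powr r * ?w" .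
qed

section \<open>The block martingale and its quadratic variation\<close>

context
  fixes n :: nat
  assumes n: "0 < n"
begin

definition m where "m = n div b"
text \<open>Calibrated so that \<open>(8 * p) powr p * \<rho> powr p\<close> equals
  \<open>(200 * (p\<^sup>2 * G\<^sup>2)) powr p * (n * A)\<close>; here \<open>200 = 8 * 25\<close>
  exceeds the constant \<open>675/4\<close> produced by the block increments. The power
  \<open>1 / p\<close> of \<open>n * A\<close> is what a sum of moments over all blocks leaves after
  a \<open>p\<close>-th root.\<close>

definition \<rho> where "\<rho> = 25 * p * G\<^sup>2 * (real n * A) powr (1 / p)"
definition X where "X j \<omega> = (\<Sum>i<j * b. d i \<omega>)"
definition D where "D j \<omega> = (\<Sum>l<b. d (j * b + l) \<omega>)"
text \<open>Predictable quadratic variation over the first \<open>j\<close> blocks, raised by \<rho>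
  to stay away from 0.\<close>

definition R where "R j \<omega> = \<rho> + (\<Sum>i<j. H (\<omega> (i * b)))"

lemma \<rho>_pos: "0 < \<rho>" using p G_pos n A_pos by (simp add: \<rho>_def)

lemma mb: "m * b \<le> n" "real m * real b \<le> real n"
proof -
  show "m * b \<le> n" by (simp add: m_def)
  then have "real (m * b) \<le> real n" by (rule of_nat_mono)
  then show "real m * real b \<le> real n" by simp
qed

lemma X_measurable [measurable]: "X j \<in> borel_measurable P"
  unfolding X_def[abs_def] by measurable

lemma D_measurable [measurable]: "D j \<in> borel_measurable P"
  unfolding D_def[abs_def] by measurable

lemma X_Suc: "X (Suc j) \<omega> = X j \<omega> + D j \<omega>"
proof -
  have "(\<Sum>i<j * b + k. d i \<omega>) = (\<Sum>i<j * b. d i \<omega>) + (\<Sum>l<k. d (j * b + l) \<omega>)" for k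
    by (induction k) auto
  from this[of b] show ?thesis by (simp add: X_def D_def add.commute)
qed

lemma X_Fil: "X j \<in> borel_measurable (Fil (j * b))"
  unfolding X_def[abs_def] by (intro borel_measurable_sum d_Fil) auto

text \<open>The last summand of \<open>R (Suc j)\<close> is \<open>H\<close> at time
  \<open>j * b\<close>, already known when block \<open>j\<close> starts. The weight may therefore
  include the variance of the block that it multiplies.\<close>

lemma R_Fil: "R (Suc j) \<in> borel_measurable (Fil (j * b))"
  unfolding R_def[abs_def]
proof (intro borel_measurable_add borel_measurable_sum borel_measurable_const)
  fix i assume "i \<in> {..<Suc j}"
  then have "i * b \<le> j * b" by (auto intro!: mult_le_mono1)
  from measurable_compose[OF measurable_coord_Fil[OF this] H_measurable]
  show "(\<lambda>\<omega>. H (\<omega> (i * b))) \<in> borel_measurable (Fil (j * b))" .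
qed

lemma R_ge: "\<omega> \<in> space P \<Longrightarrow> \<rho> \<le> R j \<omega>"
  unfolding R_def using H_nonneg by (simp add: sum_nonneg)

lemma X_2p: "integrable P (\<lambda>\<omega>. \<bar>X j \<omega>\<bar> powr (2 * p))"
  using sum_d_2p[where k=0] by (simp add: X_def)

lemma D_2p: "integrable P (\<lambda>\<omega>. \<bar>D j \<omega>\<bar> powr (2 * p))"
  unfolding D_def by (rule sum_d_2p)

text \<open>The weighted power that multiplies block \<open>j\<close> is of the form required for
  the orthogonality and variance identities: it is known at the start of the block and grows like
  \<open>\<bar>X j\<bar> powr (2 * p - 2)\<close>.\<close>

lemma U_facts:
  defines "U \<equiv> \<lambda>j \<omega>. R (Suc j) \<omega> powr (- (p / 2)) * \<bar>X j \<omega>\<bar> powr (2 * p - 2)"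
  shows "U j \<in> borel_measurable (Fil (j * b))"
    and "\<omega> \<in> space P \<Longrightarrow> \<bar>U j \<omega>\<bar> \<le> \<rho> powr (- (p / 2)) * \<bar>X j \<omega>\<bar> powr (2 * p - 2)"
proof -
  show "U j \<in> borel_measurable (Fil (j * b))"
    unfolding U_def using R_Fil[of j] X_Fil[of j] by measurable
  assume w: "\<omega> \<in> space P"
  have "R (Suc j) \<omega> powr (- (p / 2)) \<le> \<rho> powr (- (p / 2))"
    using R_ge[OF w] \<rho>_pos p by (intro powr_mono2') auto
  then show "\<bar>U j \<omega>\<bar> \<le> \<rho> powr (- (p / 2)) * \<bar>X j \<omega>\<bar> powr (2 * p - 2)"
    unfolding U_def by (simp add: abs_mult mult_right_mono)
qed

lemma block_eq: "\<omega> \<in> space P \<Longrightarrow> D j \<omega> = (\<Sum>l<b. fb (\<omega> (j * b + l))) + g (\<omega> (j * b + b)) - g (\<omega> (j * b))"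
  unfolding D_def using sum_fb[of \<omega> "j * b" b] by simp

text \<open>This inequality dictates \<rho>. The blocks contribute at most
  \<open>m * (b + 2) \<le> 3 * n\<close> moments of size \<open>(3 * G) powr (2 * p) * v\<close>;
  then \<open>2 * p + 1 \<le> 5/2 * p\<close>, and \<open>6 \<le> 3 powr p\<close> moves the
  remaining constant under the power.\<close>

lemma block_jumps:
  "2 * (2 * p + 1) powr (2 * p) * (\<Sum>j<m. \<integral>\<omega>. \<bar>D j \<omega>\<bar> powr (2 * p) \<partial>P) \<le> (8 * p) powr p * \<rho> powr p"
proof -
  have "(\<integral>\<omega>. \<bar>D j \<omega>\<bar> powr (2 * p) \<partial>P) \<le> (real b + 2) * (3 * G) powr (2 * p) * v" for j
  proof -
    have "(\<integral>\<omega>. \<bar>D j \<omega>\<bar> powr (2 * p) \<partial>P) = (\<integral>\<omega>. \<bar>(\<Sum>l<b. fb (\<omega> (j * b + l))) + g (\<omega> (j * b + b)) - g (\<omega> (j * b))\<bar> powr (2 * p) \<partial>P)"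
      by (intro Bochner_Integration.integral_cong) (auto simp: block_eq)
    also have "\<dots> \<le> (real b + 2) * (3 * G) powr (2 * p) * v powr (1 / (2 * p) * (2 * p))"
      using p by (intro remainder_moment) auto
    finally show ?thesis using p v_ge2 by simp
  qed
  then have "(\<Sum>j<m. \<integral>\<omega>. \<bar>D j \<omega>\<bar> powr (2 * p) \<partial>P) \<le> (\<Sum>j<m. (real b + 2) * (3 * G) powr (2 * p) * v)"
    by (intro sum_mono)
  also have "\<dots> = (real m * (real b + 2)) * ((3 * G) powr (2 * p) * v)" by simp
  also have "\<dots> \<le> (3 * real n) * ((3 * G) powr (2 * p) * A)"
  proof (rule mult_mono)
    have "real m * (real b + 2) \<le> real m * (3 * real b)"
      using b_pos by (intro mult_left_mono) auto
    then show "real m * (real b + 2) \<le> 3 * real n" using mb(2) by linarith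
  qed (use v_le_A v_ge2 in \<open>auto intro!: mult_left_mono\<close>)
  finally have "2 * (2 * p + 1) powr (2 * p) * (\<Sum>j<m. \<integral>\<omega>. \<bar>D j \<omega>\<bar> powr (2 * p) \<partial>P)
      \<le> 2 * (5/2 * p) powr (2 * p) * ((3 * real n) * ((3 * G) powr (2 * p) * A))"
    using p A_pos by (intro mult_mono powr_mono2) (auto intro!: sum_nonneg)
  also have "\<dots> = 6 * ((5/2 * p) * (3 * G)) powr (2 * p) * (real n * A)"
    unfolding powr_mult[of "5/2 * p" "3 * G"] by simp
  also have "\<dots> = 6 * (225/4 * (p\<^sup>2 * G\<^sup>2)) powr p * (real n * A)"
  proof -
    have "((5/2 * p) * (3 * G)) powr (2 * p) = (((5/2 * p) * (3 * G)) powr 2) powr p"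
      by (simp add: powr_powr)
    also have "((5/2 * p) * (3 * G)) powr 2 = 225/4 * (p\<^sup>2 * G\<^sup>2)"
      using p G_pos by (simp add: power2_eq_square)
    finally show ?thesis by simp
  qed
  also have "\<dots> \<le> ((3::real) powr p * (225/4 * (p\<^sup>2 * G\<^sup>2)) powr p) * (real n * A)"
  proof (intro mult_right_mono)
    have "(6::real) \<le> 3 powr 2" by simp
    also have "\<dots> \<le> 3 powr p" using p by (intro powr_mono) auto
    finally show "(6::real) \<le> 3 powr p" .
  qed (use A_pos in auto)
  also have "\<dots> = (675/4 * (p\<^sup>2 * G\<^sup>2)) powr p * (real n * A)"
    by (simp add: powr_mult[symmetric])
  also have "\<dots> \<le> (200 * (p\<^sup>2 * G\<^sup>2)) powr p * (real n * A)"
    using p A_pos by (intro mult_right_mono powr_mono2 mult_right_mono) auto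
  also have "\<dots> = (8 * p) powr p * \<rho> powr p"
  proof -
    have "\<rho> powr p = (25 * p * G\<^sup>2) powr p * (real n * A)"
      using p G_pos n A_pos by (simp add: \<rho>_def powr_mult powr_powr)
    moreover have "200 * (p\<^sup>2 * G\<^sup>2) = (8 * p) * (25 * p * G\<^sup>2)" by (simp add: power2_eq_square)
    ultimately show ?thesis using p G_pos by (simp only: powr_mult mult.assoc)
  qed
  finally show ?thesis .
qed

lemma X_moment:
  "integrable P (\<lambda>\<omega>. \<bar>X m \<omega>\<bar> powr p)"
  "(\<integral>\<omega>. \<bar>X m \<omega>\<bar> powr p \<partial>P) \<le> (16 * p) powr (p / 2) * (\<integral>\<omega>. R m \<omega> powr (p / 2) \<partial>P)"
  "integrable P (\<lambda>\<omega>. R m \<omega> powr (p / 2))"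
proof -
  have hs: "integrable P (\<lambda>\<omega>. \<bar>H (\<omega> (j * b))\<bar> powr (p / 2))" for j
    using moment_coord(1)[OF H_measurable H_le, of "p / 2"] p by simp
  have orth: "(\<integral>\<omega>. R (Suc j) \<omega> powr (- (p / 2)) * (sgn (X j \<omega>) * \<bar>X j \<omega>\<bar> powr (2 * p - 1)) * D j \<omega> \<partial>P) = 0" for j
  proof -
    have "sgn x * \<bar>x\<bar> powr (2 * p - 1) = \<bar>x\<bar> powr (2 * p - 2) * x" for x :: real
      by (cases "x = 0") (auto simp: powr_diff power2_eq_square sgn_if)
    then show ?thesis
      using block_orthogonal[OF U_facts X_measurable X_2p X_Fil X_2p, of j b]
      by (simp add: D_def mult.assoc)
  qed
  have var: "(\<integral>\<omega>. R (Suc j) \<omega> powr (- (p / 2)) * \<bar>X j \<omega>\<bar> powr (2 * p - 2) * (D j \<omega>)\<^sup>2 \<partial>P)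
     = (\<integral>\<omega>. R (Suc j) \<omega> powr (- (p / 2)) * \<bar>X j \<omega>\<bar> powr (2 * p - 2) * H (\<omega> (j * b)) \<partial>P)" for j
    using block_variance[OF U_facts X_measurable X_2p, of j b] by (simp add: D_def H_def)
  note ros = P.martingale_rosenthal[where X=X and D=D and R=R and s="\<lambda>j \<omega>. H (\<omega> (j * b))",
      OF p \<rho>_pos _ _ _ _ X_Suc R_def _ hs D_2p orth var block_jumps]
  have X0: "X 0 \<omega> = 0" for \<omega> by (simp add: X_def)
  show "integrable P (\<lambda>\<omega>. \<bar>X m \<omega>\<bar> powr p)"
    by (rule ros(2)) (use X0 H_nonneg in auto)
  show "(\<integral>\<omega>. \<bar>X m \<omega>\<bar> powr p \<partial>P) \<le> (16 * p) powr (p / 2) * (\<integral>\<omega>. R m \<omega> powr (p / 2) \<partial>P)"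
    by (rule ros(3)) (use X0 H_nonneg in auto)
  show "integrable P (\<lambda>\<omega>. R m \<omega> powr (p / 2))"
    by (rule ros(1)) (use X0 H_nonneg in auto)
qed

lemma \<sigma>2_nonneg: "0 \<le> \<sigma>2" by (simp add: \<sigma>2_def asymp_var_nonneg)

lemma TN_nonneg: "0 \<le> TN j" using p \<Gamma>_pos by (simp add: TN_def)

text \<open>Beyond \<rho>, the quadratic variation over \<open>m\<close> blocks is its stationary
  mean \<open>m * b * \<sigma>2\<close>, at most \<open>n * \<sigma>2\<close>, plus the fluctuation
  \<open>N m\<close>.\<close>

lemma R_moment:
  "(\<integral>\<omega>. R m \<omega> powr (p / 2) \<partial>P) \<le> 3 powr (p / 2) * (\<rho> powr (p / 2) + (real n * \<sigma>2) powr (p / 2) + TN m powr (p / 2))"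
proof -
  have "(\<integral>\<omega>. R m \<omega> powr (p / 2) \<partial>P)
      \<le> (\<integral>\<omega>. 3 powr (p / 2) * (\<rho> powr (p / 2) + (real n * \<sigma>2) powr (p / 2) + \<bar>N m \<omega>\<bar> powr (p / 2)) \<partial>P)"
  proof (rule integral_mono[OF X_moment(3)])
    show "integrable P (\<lambda>\<omega>. 3 powr (p / 2) * (\<rho> powr (p / 2) + (real n * \<sigma>2) powr (p / 2) + \<bar>N m \<omega>\<bar> powr (p / 2)))"
      using N_moment(1) by simp
    fix \<omega> assume w: "\<omega> \<in> space P"
    have "R m \<omega> = \<rho> + real m * real b * \<sigma>2 + N m \<omega>"
      by (simp add: R_def N_def sum_subtractf)
    also have "\<dots> \<le> \<rho> + real n * \<sigma>2 + \<bar>N m \<omega>\<bar>"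
      using mult_right_mono[OF mb(2) \<sigma>2_nonneg] by simp
    finally have "R m \<omega> powr (p / 2) \<le> (\<rho> + real n * \<sigma>2 + \<bar>N m \<omega>\<bar>) powr (p / 2)"
      using R_ge[OF w, of m] \<rho>_pos p by (intro powr_mono2) auto
    also have "\<dots> \<le> 3 powr (p / 2) * (\<rho> powr (p / 2) + (real n * \<sigma>2) powr (p / 2) + \<bar>N m \<omega>\<bar> powr (p / 2))"
      using \<rho>_pos \<sigma>2_nonneg p by (intro powr_add3_le) auto
    finally show "R m \<omega> powr (p / 2) \<le> 3 powr (p / 2) * (\<rho> powr (p / 2) + (real n * \<sigma>2) powr (p / 2) + \<bar>N m \<omega>\<bar> powr (p / 2))" .
  qed
  also have "\<dots> = 3 powr (p / 2) * (\<rho> powr (p / 2) + (real n * \<sigma>2) powr (p / 2) + (\<integral>\<omega>. \<bar>N m \<omega>\<bar> powr (p / 2) \<partial>P))"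
    using N_moment(1) P.prob_space by simp
  also have "\<dots> \<le> 3 powr (p / 2) * (\<rho> powr (p / 2) + (real n * \<sigma>2) powr (p / 2) + TN m powr (p / 2))"
    using N_moment(2) by (intro mult_left_mono add_left_mono) auto
  finally show ?thesis .
qed

text \<open>\<open>48 = 16 * 3\<close> combines the constant of the Rosenthal bound with the
  three-term split of \<open>R m\<close>, and 7 exceeds its root. The outer power
  \<open>1 / p\<close> is subadditive, so the three contributions separate without further
  loss.\<close>

lemma X_norm:
  "(\<integral>\<omega>. \<bar>X m \<omega>\<bar> powr p \<partial>P) powr (1 / p) \<le> 7 * sqrt p * (sqrt \<rho> + sqrt (real n * \<sigma>2) + sqrt (TN m))"
proof -
  have half: "(x powr (p / 2)) powr (1 / p) = sqrt x" if "0 \<le> x" for x :: real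
    using p that by (simp add: powr_powr powr_half_sqrt)
  let ?y = "\<rho> powr (p / 2) + (real n * \<sigma>2) powr (p / 2) + TN m powr (p / 2)"
  have "(\<integral>\<omega>. \<bar>X m \<omega>\<bar> powr p \<partial>P) \<le> (16 * p) powr (p / 2) * (3 powr (p / 2) * ?y)"
    using X_moment(2) mult_left_mono[OF R_moment, of "(16 * p) powr (p / 2)"] by simp
  also have "\<dots> = (48 * p) powr (p / 2) * ?y" using p by (simp add: powr_mult[symmetric] mult.assoc[symmetric])
  finally have "(\<integral>\<omega>. \<bar>X m \<omega>\<bar> powr p \<partial>P) powr (1 / p) \<le> ((48 * p) powr (p / 2) * ?y) powr (1 / p)"
    using p by (intro powr_mono2) auto
  also have "\<dots> = sqrt (48 * p) * ?y powr (1 / p)"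
  proof -
    have "((48 * p) powr (p / 2) * ?y) powr (1 / p) = ((48 * p) powr (p / 2)) powr (1 / p) * ?y powr (1 / p)"
      by (rule powr_mult)
    then show ?thesis using half[of "48 * p"] p by simp
  qed
  finally have le: "(\<integral>\<omega>. \<bar>X m \<omega>\<bar> powr p \<partial>P) powr (1 / p) \<le> sqrt (48 * p) * ?y powr (1 / p)" .
  have "?y powr (1 / p) \<le> sqrt \<rho> + sqrt (real n * \<sigma>2) + sqrt (TN m)"
  proof -
    have "?y powr (1 / p) \<le> (\<rho> powr (p / 2) + (real n * \<sigma>2) powr (p / 2)) powr (1 / p) + (TN m powr (p / 2)) powr (1 / p)"
      using p by (intro powr_subadditive) auto
    also have "(\<rho> powr (p / 2) + (real n * \<sigma>2) powr (p / 2)) powr (1 / p) \<le> (\<rho> powr (p / 2)) powr (1 / p) + ((real n * \<sigma>2) powr (p / 2)) powr (1 / p)"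
      using p by (intro powr_subadditive) auto
    finally show ?thesis using \<rho>_pos \<sigma>2_nonneg TN_nonneg[of m] by (simp add: half)
  qed
  moreover have "sqrt (48 * p) \<le> 7 * sqrt p"
  proof -
    have "sqrt 48 \<le> (7::real)" by (rule real_le_lsqrt) auto
    then show ?thesis using p by (simp add: real_sqrt_mult)
  qed
  ultimately show ?thesis
    using p by (intro order_trans[OF le] mult_mono) auto
qed

end

end

section \<open>Numerical constants and the stationary bound\<close>

lemma D1_ge: "19200 \<le> D1" and D2_ge: "9600 \<le> D2" and C1_ge: "60 \<le> C1"
proof -
  \<comment> \<open>Coarse lower bounds suffice for the final comparison, so \<open>exp 1\<close>,
    \<open>sqrt 2\<close> and \<open>sqrt C2\<close> are rounded down to 1.\<close>
  have e: "1 \<le> exp (1::real)" by simp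
  then show c: "60 \<le> C1" by (simp add: C1_def)
  have c2: "3600 \<le> C1\<^sup>2" using power_mono[OF c, of 2] by simp
  have s: "1 \<le> sqrt C2" "1 \<le> sqrt 2" by (simp_all add: C2_def)
  have s3: "2 \<le> sqrt (16/3)" by (rule real_le_rsqrt) (simp add: power2_eq_square)
  have "8/3 * 2 * 3600 * 1 \<le> D1"
    unfolding D1_def using s s3 c2 by (intro mult_mono) auto
  then show "19200 \<le> D1" by simp
  have "1 * 3600 * 1 \<le> sqrt 2 * C1\<^sup>2 * sqrt C2" using s c2 by (intro mult_mono) auto
  then have "3600 \<le> sqrt 2 * C1\<^sup>2 * sqrt C2 + C2" by (simp add: C2_def)
  then have "8 * 1 / 3 * 3600 \<le> D2" unfolding D2_def using e by (intro mult_mono divide_right_mono) auto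
  then show "9600 \<le> D2" by simp
qed

context vge_rosenthal
begin

lemma G_sq: "G\<^sup>2 = 36 * (p * real \<tau> * F)\<^sup>2 * A powr (1 / p)"
proof -
  have "(A powr (1 / (2 * p)))\<^sup>2 = A powr (1 / p)" by (simp add: power2_eq_square powr_add[symmetric])
  then show ?thesis by (simp add: G_def power_mult_distrib)
qed

lemma TN_le:
  assumes "real j * real \<tau> \<le> real n"
  shows "sqrt p * sqrt (TN j) \<le> 208 * (p\<^sup>2 * real n powr (1/4) * real \<tau> powr (3/4) * F * A powr (2 / p))"
proof -
  have "p * TN j = 43200 * (p\<^sup>2 * real \<tau> * F)\<^sup>2 * (A powr (1 / p) * A powr (1 / p) * A powr (1 / p) * A powr (1 / p)) * sqrt (real j)"
    by (simp add: TN_def \<Gamma>_def CH_def G_sq) (simp add: power2_eq_square)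
  also have "A powr (1 / p) * A powr (1 / p) * A powr (1 / p) * A powr (1 / p) = (A powr (2 / p))\<^sup>2"
    by (simp add: power2_eq_square powr_add[symmetric])
  also have "sqrt (real j) = (real j powr (1/4))\<^sup>2"
    by (simp add: power2_eq_square powr_add[symmetric] powr_half_sqrt)
  \<comment> \<open>\<open>43200 = 30 * 4 * 10 * 36\<close> collects the factors in
    \<open>TN\<close>, \<Gamma>, \<open>CH\<close> and \<open>G\<^sup>2\<close>; 43264 is the next
    square, that of 208.\<close>
  also have "43200 * (p\<^sup>2 * real \<tau> * F)\<^sup>2 * (A powr (2 / p))\<^sup>2 * (real j powr (1/4))\<^sup>2
      \<le> 43264 * (p\<^sup>2 * real \<tau> * F)\<^sup>2 * (A powr (2 / p))\<^sup>2 * (real j powr (1/4))\<^sup>2"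
    by (intro mult_right_mono) auto
  also have "\<dots> = (208 * (p\<^sup>2 * real \<tau> * F * A powr (2 / p) * real j powr (1/4)))\<^sup>2"
    by (simp add: power_mult_distrib)
  finally have "sqrt (p * TN j) \<le> 208 * (p\<^sup>2 * real \<tau> * F * A powr (2 / p) * real j powr (1/4))"
    using p F by (intro real_le_lsqrt) auto
  also have "\<dots> = 208 * (p\<^sup>2 * F * A powr (2 / p)) * (real \<tau> * real j powr (1/4))" by simp
  \<comment> \<open>Splitting off \<open>\<tau> powr (1/4)\<close> pairs the number of blocks with
    \<tau>, and the assumption \<open>j * \<tau> \<le> n\<close> trades the pair for
    \<open>n\<close>. This is the origin of the exponents \<open>3/4\<close> and
    \<open>1/4\<close>.\<close>
  also have "real \<tau> * real j powr (1/4) = real \<tau> powr (3/4) * (real j * real \<tau>) powr (1/4)"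
  proof -
    have "real \<tau> powr (3/4) * real \<tau> powr (1/4) = real \<tau>"
      using tau_pos by (simp add: powr_add[symmetric])
    then show ?thesis by (simp add: powr_mult mult.left_commute mult.commute)
  qed
  also have "208 * (p\<^sup>2 * F * A powr (2 / p)) * (real \<tau> powr (3/4) * (real j * real \<tau>) powr (1/4))
      \<le> 208 * (p\<^sup>2 * F * A powr (2 / p)) * (real \<tau> powr (3/4) * real n powr (1/4))"
    using assms F by (intro mult_left_mono powr_mono2) auto
  finally show ?thesis by (simp add: real_sqrt_mult mult_ac)
qed

lemma \<rho>_le:
  assumes n: "0 < n"
  shows "sqrt p * sqrt (\<rho> n) \<le> 30 * (p\<^sup>2 * real n powr (1 / p) * real \<tau> * F * A powr (1 / p))"
proof -
  have "p * \<rho> n = 900 * (p\<^sup>2 * real \<tau> * F)\<^sup>2 * (A powr (1 / p) * A powr (1 / p)) * real n powr (1 / p)"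
    using n A_pos by (simp add: \<rho>_def G_sq powr_mult) (simp add: power2_eq_square)
  \<comment> \<open>The factor is \<open>900 = 25 * 36\<close>. Under the root
    \<open>n powr (1 / p)\<close> is replaced by its square, to match the power of \<open>n\<close>
    in the last term of the theorem.\<close>
  also have "\<dots> \<le> 900 * (p\<^sup>2 * real \<tau> * F)\<^sup>2 * (A powr (1 / p) * A powr (1 / p)) * (real n powr (1 / p) * real n powr (1 / p))"
  proof (intro mult_left_mono)
    have "1 \<le> real n powr (1 / p)" using n p by (intro ge_one_powr_ge_zero) auto
    then show "real n powr (1 / p) \<le> real n powr (1 / p) * real n powr (1 / p)"
      using mult_left_mono[of 1 "real n powr (1 / p)" "real n powr (1 / p)"] by simp
  qed auto
  also have "\<dots> = (30 * (p\<^sup>2 * real n powr (1 / p) * real \<tau> * F * A powr (1 / p)))\<^sup>2"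
    by (simp add: power2_eq_square)
  finally have "sqrt (p * \<rho> n) \<le> 30 * (p\<^sup>2 * real n powr (1 / p) * real \<tau> * F * A powr (1 / p))"
    using p F by (intro real_le_lsqrt) auto
  then show ?thesis by (simp add: real_sqrt_mult)
qed

text \<open>After the \<open>p\<close>-th root the crude count \<open>j + 2 \<le> 3 * n\<close>
  becomes a factor of at most \<open>2 * n powr (1 / p)\<close>, and \<open>36 = 2 * 3 * 6\<close>
  with the 6 from \<open>G\<close>.\<close>

lemma remainder_norm:
  assumes n: "0 < n" and j: "j \<le> b" "j \<le> n"
  shows "(\<integral>\<omega>. \<bar>(\<Sum>l<j. fb (\<omega> (k + l))) + g (\<omega> i) - g (\<omega> i')\<bar> powr p \<partial>P) powr (1 / p)
     \<le> 36 * (p\<^sup>2 * real n powr (1 / p) * real \<tau> * F * A powr (1 / p))"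
proof -
  have "(\<integral>\<omega>. \<bar>(\<Sum>l<j. fb (\<omega> (k + l))) + g (\<omega> i) - g (\<omega> i')\<bar> powr p \<partial>P)
      \<le> (real j + 2) * (3 * G) powr p * v powr (1 / (2 * p) * p)"
    using p j by (intro remainder_moment) auto
  also have "\<dots> \<le> (3 * real n) * (3 * G) powr p * A powr (1 / (2 * p) * p)"
    using n j p v_le_A v_ge2 G_pos by (intro mult_mono powr_mono2) auto
  finally have "(\<integral>\<omega>. \<bar>(\<Sum>l<j. fb (\<omega> (k + l))) + g (\<omega> i) - g (\<omega> i')\<bar> powr p \<partial>P) powr (1 / p)
      \<le> ((3 * real n) * (3 * G) powr p * A powr (1 / (2 * p) * p)) powr (1 / p)"
    using p by (intro powr_mono2) auto
  also have "\<dots> = 3 powr (1 / p) * real n powr (1 / p) * (3 * G) * A powr (1 / (2 * p))"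
  proof -
    have "((3 * G) powr p) powr (1 / p) = 3 * G" using p G_pos by (simp add: powr_powr)
    moreover have "(A powr (1 / (2 * p) * p)) powr (1 / p) = A powr (1 / (2 * p))"
      using p by (simp only: powr_powr) simp
    ultimately show ?thesis by (simp only: powr_mult)
  qed
  also have "\<dots> \<le> 2 * real n powr (1 / p) * (3 * G) * A powr (1 / (2 * p))"
  proof -
    have "3 powr (1 / p) \<le> (3::real) powr (1 / 2)" using p by (intro powr_mono) auto
    also have "\<dots> = sqrt 3" by (simp add: powr_half_sqrt)
    also have "\<dots> \<le> 2" by (rule real_le_lsqrt) auto
    finally show ?thesis using G_pos by (intro mult_right_mono) auto
  qed
  also have "\<dots> = 36 * (p * real n powr (1 / p) * real \<tau> * F * (A powr (1 / (2 * p)) * A powr (1 / (2 * p))))"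
    by (simp add: G_def)
  also have "A powr (1 / (2 * p)) * A powr (1 / (2 * p)) = A powr (1 / p)" by (simp add: powr_add[symmetric])
  also have "36 * (p * real n powr (1 / p) * real \<tau> * F * A powr (1 / p)) \<le> 36 * (p\<^sup>2 * real n powr (1 / p) * real \<tau> * F * A powr (1 / p))"
    using p F by (intro mult_left_mono mult_right_mono) (auto simp: power2_eq_square)
  finally show ?thesis .
qed

lemma stationary_moment:
  assumes n: "0 < n"
  shows "integrable P (\<lambda>\<omega>. \<bar>chain_sum \<pi> f n \<omega>\<bar> powr p)"
    and "(\<integral>\<omega>. \<bar>chain_sum \<pi> f n \<omega>\<bar> powr p \<partial>P) powr (1 / p) \<le>
      C1 * sqrt 2 * p powr (1/2) * real n powr (1/2) * sqrt (asymp_var M Q \<pi> f)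
      + 4 * D1 * A powr (2 / p) * (p\<^sup>2 * log 2 (2 * p) * real n powr (1/4) * real \<tau> powr (3/4)) * F
      + 4 * D2 * A powr (1 / p) * (p\<^sup>2 * log 2 (2 * p) * real n powr (1 / p) * real \<tau>) * F"
proof -
  define k where "k = m n * b"
  \<comment> \<open>\<open>k\<close> is the end of the last complete block. \<open>Y\<close>
    collects the incomplete block and the boundary terms of the telescoping sum, the shape treated
    by \<open>remainder_moment\<close>.\<close>
  define Y where "Y \<omega> = (\<Sum>l<n - k. fb (\<omega> (k + l))) + g (\<omega> 0) - g (\<omega> k)" for \<omega>
  have kn: "k \<le> n" using mb(1)[OF n] by (simp add: k_def)
  have kb: "n - k \<le> b" using b_pos by (simp add: k_def m_def[OF n] minus_div_mult_eq_mod less_imp_le)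
  have [measurable]: "X (m n) \<in> borel_measurable P" by (rule X_measurable[OF n])
  have [measurable]: "Y \<in> borel_measurable P" unfolding Y_def[abs_def] by measurable
  have S: "chain_sum \<pi> f n \<omega> = X (m n) \<omega> + Y \<omega>" if w: "\<omega> \<in> space P" for \<omega>
  proof -
    have "(\<Sum>i<k + j. fb (\<omega> i)) = (\<Sum>i<k. fb (\<omega> i)) + (\<Sum>l<j. fb (\<omega> (k + l)))" for j
      by (induction j) auto
    from this[of "n - k"] have "chain_sum \<pi> f n \<omega> = (\<Sum>i<k. fb (\<omega> i)) + (\<Sum>l<n - k. fb (\<omega> (k + l)))"
      using kn by (simp add: chain_sum_def)
    also have "(\<Sum>i<k. fb (\<omega> i)) = X (m n) \<omega> + g (\<omega> 0) - g (\<omega> k)"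
      using sum_fb[OF w, of 0 k] by (simp add: X_def[OF n] k_def)
    finally show ?thesis by (simp add: Y_def)
  qed
  have Xi: "integrable P (\<lambda>\<omega>. \<bar>X (m n) \<omega>\<bar> powr p)" by (rule X_moment(1)[OF n])
  have Yi: "integrable P (\<lambda>\<omega>. \<bar>Y \<omega>\<bar> powr p)"
    unfolding Y_def using p kb by (intro remainder_moment) auto
  have p0: "0 \<le> p" using p by simp
  have "integrable P (\<lambda>\<omega>. \<bar>chain_sum \<pi> f n \<omega>\<bar> powr p) = integrable P (\<lambda>\<omega>. \<bar>X (m n) \<omega> + Y \<omega>\<bar> powr p)"
    by (rule Bochner_Integration.integrable_cong) (simp_all add: S)
  then show Si: "integrable P (\<lambda>\<omega>. \<bar>chain_sum \<pi> f n \<omega>\<bar> powr p)"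
    using P.integrable_powr_add[OF Xi Yi p0] by simp
  let ?x = "\<integral>\<omega>. \<bar>X (m n) \<omega>\<bar> powr p \<partial>P" and ?y = "\<integral>\<omega>. \<bar>Y \<omega>\<bar> powr p \<partial>P"
  have x0: "0 \<le> ?x" and y0: "0 \<le> ?y" by auto
  have "(\<integral>\<omega>. \<bar>chain_sum \<pi> f n \<omega>\<bar> powr p \<partial>P) \<le> (\<integral>\<omega>. 2 powr p * (\<bar>X (m n) \<omega>\<bar> powr p + \<bar>Y \<omega>\<bar> powr p) \<partial>P)"
  proof (rule integral_mono[OF Si])
    fix \<omega> assume w: "\<omega> \<in> space P"
    have "\<bar>chain_sum \<pi> f n \<omega>\<bar> powr p \<le> (\<bar>X (m n) \<omega>\<bar> + \<bar>Y \<omega>\<bar>) powr p"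
      using p by (intro powr_mono2) (auto simp: S[OF w])
    also have "\<dots> \<le> 2 powr p * (\<bar>X (m n) \<omega>\<bar> powr p + \<bar>Y \<omega>\<bar> powr p)"
      using p by (intro powr_add_le) auto
    finally show "\<bar>chain_sum \<pi> f n \<omega>\<bar> powr p \<le> 2 powr p * (\<bar>X (m n) \<omega>\<bar> powr p + \<bar>Y \<omega>\<bar> powr p)" .
  qed (use Xi Yi in simp)
  also have "\<dots> = 2 powr p * (?x + ?y)" using Xi Yi by simp
  finally have "(\<integral>\<omega>. \<bar>chain_sum \<pi> f n \<omega>\<bar> powr p \<partial>P) powr (1 / p) \<le> (2 powr p * (?x + ?y)) powr (1 / p)"
    using p by (intro powr_mono2) auto
  also have "\<dots> = 2 * (?x + ?y) powr (1 / p)" using p by (simp add: powr_mult powr_powr)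
  also have "\<dots> \<le> 2 * (?x powr (1 / p) + ?y powr (1 / p))"
    using p x0 y0 by (intro mult_left_mono powr_subadditive) auto
  finally have 1: "(\<integral>\<omega>. \<bar>chain_sum \<pi> f n \<omega>\<bar> powr p \<partial>P) powr (1 / p) \<le> 2 * (?x powr (1 / p) + ?y powr (1 / p))" .
  have 2: "?x powr (1 / p) \<le> 7 * (sqrt p * sqrt (\<rho> n)) + 7 * (sqrt p * sqrt (real n * \<sigma>2)) + 7 * (sqrt p * sqrt (TN (m n)))"
    using X_norm[OF n] by (simp add: algebra_simps)
  let ?t3 = "p\<^sup>2 * real n powr (1 / p) * real \<tau> * F * A powr (1 / p)"
  let ?t2 = "p\<^sup>2 * real n powr (1/4) * real \<tau> powr (3/4) * F * A powr (2 / p)"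
  have 3: "?y powr (1 / p) \<le> 36 * ?t3"
    unfolding Y_def by (rule remainder_norm[OF n kb]) simp
  have 4: "sqrt p * sqrt (\<rho> n) \<le> 30 * ?t3" by (rule \<rho>_le[OF n])
  have 5: "sqrt p * sqrt (TN (m n)) \<le> 208 * ?t2"
  proof (rule TN_le)
    have "real (m n) * real \<tau> \<le> real (m n) * real b"
      using c_pos mult_right_mono[of 1 "real c" "real \<tau>"] by (intro mult_left_mono) (auto simp: b_def)
    then show "real (m n) * real \<tau> \<le> real n" using mb(2)[OF n] by linarith
  qed
  have t0: "0 \<le> ?t2" "0 \<le> ?t3" using F by auto
  have lg: "1 \<le> log 2 (2 * p)" using p by simp
  \<comment> \<open>The numbers in this and the next two comparisons: \<open>14 = 2 * 7\<close>,
    \<open>2912 = 2 * 7 * 208\<close> and \<open>492 = 2 * (7 * 30 + 36)\<close>, where the leading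
    2 is the price of splitting off \<open>Y\<close>. As \<open>2 * p \<ge> 2\<close>, the logarithm
    is at least 1.\<close>
  have 6: "14 * (sqrt p * sqrt (real n * \<sigma>2)) \<le> C1 * sqrt 2 * (sqrt p * sqrt (real n * \<sigma>2))"
  proof (rule mult_right_mono)
    have "60 * 1 \<le> C1 * sqrt 2" using C1_ge by (intro mult_mono) auto
    then show "14 \<le> C1 * sqrt 2" by simp
  qed (use p \<sigma>2_nonneg[OF n] in auto)
  have 7: "2912 * ?t2 \<le> (4 * D1 * log 2 (2 * p)) * ?t2"
  proof (rule mult_right_mono)
    have "19200 * 1 \<le> D1 * log 2 (2 * p)" using D1_ge lg by (intro mult_mono) auto
    then show "2912 \<le> 4 * D1 * log 2 (2 * p)" by simp
  qed (use t0 in simp)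
  have 8: "492 * ?t3 \<le> (4 * D2 * log 2 (2 * p)) * ?t3"
  proof (rule mult_right_mono)
    have "9600 * 1 \<le> D2 * log 2 (2 * p)" using D2_ge lg by (intro mult_mono) auto
    then show "492 \<le> 4 * D2 * log 2 (2 * p)" by simp
  qed (use t0 in simp)
  have "(\<integral>\<omega>. \<bar>chain_sum \<pi> f n \<omega>\<bar> powr p \<partial>P) powr (1 / p)
      \<le> C1 * sqrt 2 * (sqrt p * sqrt (real n * \<sigma>2)) + (4 * D1 * log 2 (2 * p)) * ?t2 + (4 * D2 * log 2 (2 * p)) * ?t3"
    using 1[unfolded distrib_left] 2 3 4 5 6 7 8 by linarith
  also have "\<dots> = C1 * sqrt 2 * p powr (1/2) * real n powr (1/2) * sqrt (asymp_var M Q \<pi> f)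
      + 4 * D1 * A powr (2 / p) * (p\<^sup>2 * log 2 (2 * p) * real n powr (1/4) * real \<tau> powr (3/4)) * F
      + 4 * D2 * A powr (1 / p) * (p\<^sup>2 * log 2 (2 * p) * real n powr (1 / p) * real \<tau>) * F"
    using p by (simp add: \<sigma>2_def real_sqrt_mult powr_half_sqrt mult_ac)
  finally show "(\<integral>\<omega>. \<bar>chain_sum \<pi> f n \<omega>\<bar> powr p \<partial>P) powr (1 / p) \<le>
      C1 * sqrt 2 * p powr (1/2) * real n powr (1/2) * sqrt (asymp_var M Q \<pi> f)
      + 4 * D1 * A powr (2 / p) * (p\<^sup>2 * log 2 (2 * p) * real n powr (1/4) * real \<tau> powr (3/4)) * F
      + 4 * D2 * A powr (1 / p) * (p\<^sup>2 * log 2 (2 * p) * real n powr (1 / p) * real \<tau>) * F" .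
qed

end

section \<open>Dependence on the initial distribution\<close>

lemma ennreal_powr_top [simp]: "ennreal_powr \<top> a = \<top>"
  by (simp add: ennreal_powr_def)

lemma ennreal_powr_0 [simp]: "ennreal_powr 0 a = 0"
  by (simp add: ennreal_powr_def)

lemma ennreal_powr_ennreal [simp]: "0 \<le> r \<Longrightarrow> ennreal_powr (ennreal r) a = ennreal (r powr a)"
  by (simp add: ennreal_powr_def)

lemma ennreal_powr_mono:
  assumes "x \<le> y" "0 \<le> a"
  shows "ennreal_powr x a \<le> ennreal_powr y a"
proof (cases "y = \<top>")
  case False
  then have x: "x \<noteq> \<top>" using assms by (auto simp: top_unique)
  then have "enn2real x \<le> enn2real y" using assms False by (intro enn2real_mono) (auto simp: top.not_eq_extremum)
  then show ?thesis using x False assms by (simp add: ennreal_powr_def powr_mono2 ennreal_leI)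
qed simp

lemma ennreal_powr_powr_inverse:
  assumes "a \<noteq> 0"
  shows "ennreal_powr (ennreal_powr x a) (1 / a) = x" "ennreal_powr (ennreal_powr x (1 / a)) a = x"
  using assms by (cases x; simp add: powr_powr)+

lemma ennreal_powr_mult:
  assumes "0 < a"
  shows "ennreal_powr (x * y) a = ennreal_powr x a * ennreal_powr y a"
proof (cases "x = \<top> \<or> y = \<top>")
  case True
  have pos: "ennreal_powr z a \<noteq> 0" if "z \<noteq> 0" for z
    using that by (cases z) auto
  have "x = 0 \<or> y = 0 \<or> x * y = \<top>" using True by (auto simp: ennreal_mult_eq_top_iff)
  moreover have "ennreal_powr x a = \<top> \<or> ennreal_powr y a = \<top>" using True by auto
  ultimately show ?thesis using pos[of x] pos[of y] by (auto simp: ennreal_mult_eq_top_iff)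
next
  case False
  then obtain r s where "x = ennreal r" "0 \<le> r" "y = ennreal s" "0 \<le> s"
    by (cases x; cases y) auto
  then show ?thesis by (simp add: ennreal_mult[symmetric] powr_mult)
qed

lemma ennreal_powr_measurable [measurable]: "(\<lambda>x. ennreal_powr x a) \<in> borel_measurable borel"
  unfolding ennreal_powr_def by measurable

text \<open>The \<open>L\<^sup>p\<close> norm with extended values, since moments under an arbitrary
  initial law may be infinite. It is also applied to residual parts of laws, whose mass is below
  1.\<close>

definition Np :: "real \<Rightarrow> 'a measure \<Rightarrow> ('a \<Rightarrow> ennreal) \<Rightarrow> ennreal" where
  "Np p \<mu> h = ennreal_powr (\<integral>\<^sup>+x. ennreal_powr (h x) p \<partial>\<mu>) (1 / p)"

lemma Np_powr: "p \<noteq> 0 \<Longrightarrow> ennreal_powr (Np p \<mu> h) p = (\<integral>\<^sup>+x. ennreal_powr (h x) p \<partial>\<mu>)"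
  by (simp add: Np_def ennreal_powr_powr_inverse)

lemma Np_mono:
  assumes "0 < p" "\<And>x. x \<in> space \<mu> \<Longrightarrow> h x \<le> h' x"
  shows "Np p \<mu> h \<le> Np p \<mu> h'"
  unfolding Np_def using assms by (intro ennreal_powr_mono nn_integral_mono) auto

lemma Np_const:
  assumes "prob_space \<mu>" "0 < p"
  shows "Np p \<mu> (\<lambda>_. c) = c"
  using prob_space.emeasure_space_1[OF assms(1)] assms(2) by (simp add: Np_def ennreal_powr_powr_inverse)

text \<open>Convexity of the power function at the combination of \<open>u / x\<close> and
  \<open>w / y\<close> with weights proportional to \<open>x\<close> and \<open>y\<close>. When
  \<open>x\<close> and \<open>y\<close> bound the norms of two functions, integration gives
  Minkowski's inequality.\<close>

lemma powr_add_le_weighted: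
  fixes u w x y p :: real
  assumes "0 \<le> u" "0 \<le> w" "0 < x" "0 < y" "1 \<le> p"
  shows "(u + w) powr p \<le> (x + y) powr p * (x / (x + y)) / x powr p * u powr p + (x + y) powr p * (y / (x + y)) / y powr p * w powr p"
proof -
  define l where "l = x / (x + y)"
  have l: "0 < l" "l < 1" "y / (x + y) = 1 - l" using assms by (auto simp: l_def field_simps)
  define Z where "Z = l * (u / x) powr p + (1 - l) * (w / y) powr p"
  have Z0: "0 \<le> Z" using l by (simp add: Z_def)
  have "(u + w) powr p \<le> (x + y) powr p * Z"
  proof (cases "Z = 0")
    case True
    then have "u = 0" "w = 0"
      using l assms unfolding Z_def by (auto simp: add_nonneg_eq_0_iff)
    then show ?thesis using True by simp
  next
    case False
    then have Z: "0 < Z" using Z0 by simp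
    \<comment> \<open>\<open>s\<close> is the \<open>1 / p\<close> power of \<open>s powr p\<close>,
      so it lies below the tangent of this concave power at \<open>Z\<close>. Averaging the tangents
      with weights \<open>l\<close> and \<open>1 - l\<close> gives back the value at
      \<open>Z\<close>.\<close>
    have t: "s \<le> Z powr (1 / p) * (1 - 1 / p + 1 / p * (s powr p / Z))" if "0 \<le> s" for s
      using powr_le_tangent[of "s powr p" Z "1 / p"] that Z assms by (simp add: powr_powr)
    have "(u + w) / (x + y) = l * (u / x) + (1 - l) * (w / y)"
    proof -
      have "l * (u / x) = u / (x + y)" using assms by (simp add: l_def)
      moreover have "(1 - l) * (w / y) = w / (x + y)" using assms by (simp add: l(3)[symmetric])
      ultimately show ?thesis by (simp add: add_divide_distrib)
    qed
    also have "\<dots> \<le> l * (Z powr (1 / p) * (1 - 1 / p + 1 / p * ((u / x) powr p / Z))) + (1 - l) * (Z powr (1 / p) * (1 - 1 / p + 1 / p * ((w / y) powr p / Z)))"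
      using l assms by (intro add_mono mult_left_mono t) auto
    also have "\<dots> = Z powr (1 / p) * (1 - 1 / p + 1 / p * ((l * (u / x) powr p + (1 - l) * (w / y) powr p) / Z))"
      by (simp add: algebra_simps add_divide_distrib diff_divide_distrib)
    also have "\<dots> = Z powr (1 / p)" using Z by (simp add: Z_def[symmetric])
    finally have "((u + w) / (x + y)) powr p \<le> (Z powr (1 / p)) powr p"
      using assms by (intro powr_mono2) auto
    then show ?thesis using assms Z by (simp add: powr_powr powr_divide field_simps)
  qed
  also have "(x + y) powr p * Z = (x + y) powr p * (x / (x + y)) / x powr p * u powr p + (x + y) powr p * (y / (x + y)) / y powr p * w powr p"
    unfolding l(3) l_def[symmetric] Z_def using assms by (simp add: powr_divide algebra_simps)
  finally show ?thesis .
qed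

text \<open>The pointwise convexity bound is integrated with numbers slightly above the two norms,
  because its weights divide by them and a norm may be 0; the excess then tends to 0.\<close>

lemma Np_Minkowski:
  assumes p: "1 \<le> p" and [measurable]: "h \<in> borel_measurable \<mu>" "h' \<in> borel_measurable \<mu>"
  shows "Np p \<mu> (\<lambda>x. h x + h' x) \<le> Np p \<mu> h + Np p \<mu> h'"
proof (cases "Np p \<mu> h = \<top> \<or> Np p \<mu> h' = \<top>")
  case False
  then obtain a b where a: "Np p \<mu> h = ennreal a" "0 \<le> a" and b: "Np p \<mu> h' = ennreal b" "0 \<le> b"
    by (cases "Np p \<mu> h"; cases "Np p \<mu> h'") auto
  have le: "Np p \<mu> (\<lambda>x. h x + h' x) \<le> ennreal (x + y)" if xy: "a \<le> x" "b \<le> y" "0 < x" "0 < y" for x y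
  proof -
    define c where "c = (x + y) powr p * (x / (x + y)) / x powr p"
    define c' where "c' = (x + y) powr p * (y / (x + y)) / y powr p"
    have c0: "0 < c" "0 < c'" using xy by (auto simp: c_def c'_def)
    have i: "(\<integral>\<^sup>+z. ennreal_powr (h z) p \<partial>\<mu>) \<le> ennreal (x powr p)" "(\<integral>\<^sup>+z. ennreal_powr (h' z) p \<partial>\<mu>) \<le> ennreal (y powr p)"
      using p xy a b ennreal_powr_mono[of "Np p \<mu> h" "ennreal x" p] ennreal_powr_mono[of "Np p \<mu> h'" "ennreal y" p]
      by (simp_all add: Np_powr[symmetric] ennreal_leI powr_mono2)
    have "(\<integral>\<^sup>+z. ennreal_powr (h z + h' z) p \<partial>\<mu>) \<le> (\<integral>\<^sup>+z. ennreal c * ennreal_powr (h z) p + ennreal c' * ennreal_powr (h' z) p \<partial>\<mu>)"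
    proof (rule nn_integral_mono)
      fix z
      show "ennreal_powr (h z + h' z) p \<le> ennreal c * ennreal_powr (h z) p + ennreal c' * ennreal_powr (h' z) p"
      proof (cases "h z = \<top> \<or> h' z = \<top>")
        case True
        then show ?thesis using c0 by (auto simp: ennreal_mult_top)
      next
        case False
        then obtain u w where uw: "h z = ennreal u" "0 \<le> u" "h' z = ennreal w" "0 \<le> w"
          by (cases "h z"; cases "h' z") auto
        have "(u + w) powr p \<le> c * u powr p + c' * w powr p"
          unfolding c_def c'_def by (rule powr_add_le_weighted) (use uw xy p in auto)
        then show ?thesis
          using uw c0 by (simp add: ennreal_plus[symmetric] ennreal_mult[symmetric] ennreal_leI del: ennreal_plus)
      qed
    qed
    also have "\<dots> = ennreal c * (\<integral>\<^sup>+z. ennreal_powr (h z) p \<partial>\<mu>) + ennreal c' * (\<integral>\<^sup>+z. ennreal_powr (h' z) p \<partial>\<mu>)"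
      by (simp add: nn_integral_add nn_integral_cmult)
    also have "\<dots> \<le> ennreal c * ennreal (x powr p) + ennreal c' * ennreal (y powr p)"
      by (intro add_mono mult_left_mono i) auto
    also have "\<dots> = ennreal (c * x powr p + c' * y powr p)"
      using c0 by (simp add: ennreal_mult)
    also have "c * x powr p + c' * y powr p = (x + y) powr p"
    proof -
      have "c * x powr p + c' * y powr p = (x + y) powr p * (x / (x + y) + y / (x + y))"
        using xy by (simp add: c_def c'_def distrib_left)
      also have "x / (x + y) + y / (x + y) = 1" using xy by (simp add: add_divide_distrib[symmetric])
      finally show ?thesis by simp
    qed
    finally have "Np p \<mu> (\<lambda>x. h x + h' x) \<le> ennreal_powr (ennreal ((x + y) powr p)) (1 / p)"
      unfolding Np_def using p by (intro ennreal_powr_mono) auto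
    also have "\<dots> = ennreal (x + y)" using p xy by (simp add: powr_powr)
    finally show ?thesis .
  qed
  show ?thesis
  proof (rule ennreal_le_epsilon)
    fix e :: real assume e: "0 < e"
    have "Np p \<mu> (\<lambda>x. h x + h' x) \<le> ennreal ((a + e / 2) + (b + e / 2))"
      using a b e by (intro le) auto
    also have "\<dots> = Np p \<mu> h + Np p \<mu> h' + ennreal e"
      using a b e by (simp add: ennreal_plus[symmetric] del: ennreal_plus)
    finally show "Np p \<mu> (\<lambda>x. h x + h' x) \<le> Np p \<mu> h + Np p \<mu> h' + ennreal e" .
  qed
qed (auto simp: Np_def)

text \<open>Minkowski's inequality on a space with two points, one carrying the varying part and the
  other the fixed part \<open>c\<close>: a common contribution under the \<open>p\<close>-th power
  does not enlarge the error \<delta>.\<close>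

lemma ennreal_powr_two_point_Minkowski:
  assumes p: "1 \<le> p" and le: "a \<le> b + \<delta>"
  shows "ennreal_powr (ennreal_powr a p + c) (1 / p) \<le> ennreal_powr (ennreal_powr b p + c) (1 / p) + \<delta>"
proof -
  let ?\<mu> = "count_space (UNIV :: bool set)"
  let ?h = "\<lambda>t. if t then b else ennreal_powr c (1 / p)" and ?d = "\<lambda>t. if t then \<delta> else 0"
  have "Np p ?\<mu> (\<lambda>t. ?h t + ?d t) \<le> Np p ?\<mu> ?h + Np p ?\<mu> ?d"
    by (rule Np_Minkowski[OF p]) auto
  moreover have "Np p ?\<mu> (\<lambda>t. ?h t + ?d t) = ennreal_powr (ennreal_powr (b + \<delta>) p + c) (1 / p)"
    using p by (simp add: Np_def nn_integral_count_space_finite UNIV_bool ennreal_powr_powr_inverse add.commute)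
  moreover have "Np p ?\<mu> ?h = ennreal_powr (ennreal_powr b p + c) (1 / p)"
    using p by (simp add: Np_def nn_integral_count_space_finite UNIV_bool ennreal_powr_powr_inverse add.commute)
  moreover have "Np p ?\<mu> ?d = \<delta>"
    using p by (simp add: Np_def nn_integral_count_space_finite UNIV_bool ennreal_powr_powr_inverse)
  moreover have "ennreal_powr (ennreal_powr a p + c) (1 / p) \<le> ennreal_powr (ennreal_powr (b + \<delta>) p + c) (1 / p)"
    using p le by (intro ennreal_powr_mono add_right_mono) auto
  ultimately show ?thesis by simp
qed

text \<open>The inner root and the outer power cancel, so the norms compose just as the integrals
  do.\<close>

lemma Np_bind:
  assumes p: "0 < p" and Q: "Q \<in> M \<rightarrow>\<^sub>M subprob_algebra M" and s: "sets \<alpha> = sets M" and h [measurable]: "h \<in> borel_measurable M"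
  shows "Np p \<alpha> (\<lambda>y. Np p (Q y) h) = Np p (\<alpha> \<bind> Q) h"
proof -
  have "(\<integral>\<^sup>+y. ennreal_powr (Np p (Q y) h) p \<partial>\<alpha>) = (\<integral>\<^sup>+y. (\<integral>\<^sup>+x. ennreal_powr (h x) p \<partial>Q y) \<partial>\<alpha>)"
    using p by (simp add: Np_powr)
  also have "\<dots> = (\<integral>\<^sup>+x. ennreal_powr (h x) p \<partial>(\<alpha> \<bind> Q))"
    using Q s by (intro nn_integral_bind[symmetric, where B=M]) (auto cong: measurable_cong_sets)
  finally show ?thesis by (simp add: Np_def)
qed

text \<open>On the Hahn set \<open>Y\<close> the first measure dominates, off it the second. So
  \<gamma> is the minimum of the two measures, and \<alpha>' and \<beta>' are the positive and
  negative parts of their difference. The explicit values are recorded because they allow domination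
  by a total variation measure.\<close>

lemma Jordan_splitting:
  assumes "finite_measure \<alpha>" "finite_measure \<beta>" and sets: "sets \<alpha> = sets M" "sets \<beta> = sets M"
  obtains \<alpha>' \<beta>' \<gamma> Y where "sets \<alpha>' = sets M" "sets \<beta>' = sets M" "sets \<gamma> = sets M" "Y \<in> sets M"
    "\<And>A. A \<in> sets M \<Longrightarrow> emeasure \<alpha> A = emeasure \<alpha>' A + emeasure \<gamma> A"
    "\<And>A. A \<in> sets M \<Longrightarrow> emeasure \<beta> A = emeasure \<beta>' A + emeasure \<gamma> A"
    "\<And>A. A \<in> sets M \<Longrightarrow> emeasure \<alpha>' A = ennreal (measure \<alpha> (A \<inter> Y) - measure \<beta> (A \<inter> Y))"
    "\<And>A. A \<in> sets M \<Longrightarrow> emeasure \<beta>' A = ennreal (measure \<beta> (A - Y) - measure \<alpha> (A - Y))"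
proof -
  interpret a: finite_measure \<alpha> by fact
  interpret b: finite_measure \<beta> by fact
  obtain Y where Y0: "Y \<in> sets \<alpha>" and 1: "\<And>X. X \<in> sets \<alpha> \<Longrightarrow> X \<subseteq> Y \<Longrightarrow> emeasure \<beta> X \<le> emeasure \<alpha> X"
    and 2: "\<And>X. X \<in> sets \<alpha> \<Longrightarrow> X \<inter> Y = {} \<Longrightarrow> emeasure \<alpha> X \<le> emeasure \<beta> X"
    using finite_unsigned_Hahn_decomposition[OF assms(1,2)] sets by auto
  have Y: "Y \<in> sets M" using Y0 sets by simp
  have ind: "indicator B x * indicator A x = (indicator (A \<inter> B) x :: ennreal)" for A B x
    by (auto simp: indicator_def)
  have rs: "emeasure (density \<mu> (indicator B)) A = emeasure \<mu> (A \<inter> B)" if "sets \<mu> = sets M" "A \<in> sets M" "B \<in> sets M" for \<mu> A B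
    using that by (simp add: emeasure_density ind)
  have fin: "finite_measure (density \<mu> (indicator B))" if "sets \<mu> = sets M" "finite_measure \<mu>" "B \<in> sets M" for \<mu> B
  proof (rule finite_measureI)
    have "emeasure (density \<mu> (indicator B)) (space M) = emeasure \<mu> (space M \<inter> B)" by (rule rs) (use that in auto)
    then show "emeasure (density \<mu> (indicator B)) (space (density \<mu> (indicator B))) \<noteq> \<infinity>"
      using that finite_measure.emeasure_finite[OF that(2)] sets_eq_imp_space_eq[OF that(1)] by simp
  qed
  define \<alpha>' where "\<alpha>' = diff_measure (density \<alpha> (indicator Y)) (density \<beta> (indicator Y))"
  define \<beta>' where "\<beta>' = diff_measure (density \<beta> (indicator (space M - Y))) (density \<alpha> (indicator (space M - Y)))"
  have co: "A \<inter> (space M - Y) = A - Y" if "A \<in> sets M" for A using sets.sets_into_space[OF that] by auto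
  have al: "emeasure \<alpha>' A = ennreal (measure \<alpha> (A \<inter> Y) - measure \<beta> (A \<inter> Y))" if A: "A \<in> sets M" for A
  proof -
    have "emeasure \<alpha>' A = emeasure (density \<alpha> (indicator Y)) A - emeasure (density \<beta> (indicator Y)) A"
      unfolding \<alpha>'_def
    proof (rule emeasure_diff_measure)
      show "finite_measure (density \<alpha> (indicator Y))" "finite_measure (density \<beta> (indicator Y))"
        using fin sets Y assms by auto
      fix B assume "B \<in> sets (density \<alpha> (indicator Y))"
      then show "emeasure (density \<beta> (indicator Y)) B \<le> emeasure (density \<alpha> (indicator Y)) B"
        using sets Y 1[of "B \<inter> Y"] by (simp add: rs)
    qed (use sets A in auto)
    also have "\<dots> = ennreal (measure \<alpha> (A \<inter> Y) - measure \<beta> (A \<inter> Y))"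
      using sets A Y by (simp add: rs a.emeasure_eq_measure b.emeasure_eq_measure ennreal_minus)
    finally show ?thesis .
  qed
  have be: "emeasure \<beta>' A = ennreal (measure \<beta> (A - Y) - measure \<alpha> (A - Y))" if A: "A \<in> sets M" for A
  proof -
    have "emeasure \<beta>' A = emeasure (density \<beta> (indicator (space M - Y))) A - emeasure (density \<alpha> (indicator (space M - Y))) A"
      unfolding \<beta>'_def
    proof (rule emeasure_diff_measure)
      show "finite_measure (density \<beta> (indicator (space M - Y)))" "finite_measure (density \<alpha> (indicator (space M - Y)))"
        using fin sets Y assms by auto
      fix B assume "B \<in> sets (density \<beta> (indicator (space M - Y)))"
      then show "emeasure (density \<alpha> (indicator (space M - Y))) B \<le> emeasure (density \<beta> (indicator (space M - Y))) B"
        using sets Y 2[of "B \<inter> (space M - Y)"] by (simp add: rs Int_Diff) (metis Diff_disjoint Int_commute Int_Diff sets.Diff sets.Int sets.top co)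
    qed (use sets A in auto)
    also have "\<dots> = ennreal (measure \<beta> (A - Y) - measure \<alpha> (A - Y))"
      using sets A Y by (simp add: rs co a.emeasure_eq_measure b.emeasure_eq_measure ennreal_minus)
    finally show ?thesis .
  qed
  have s': "sets \<alpha>' = sets M" "sets \<beta>' = sets M" using sets by (simp_all add: \<alpha>'_def \<beta>'_def)
  define \<gamma> where "\<gamma> = diff_measure \<alpha> \<alpha>'"
  have nn: "measure \<beta> (A \<inter> Y) \<le> measure \<alpha> (A \<inter> Y)" "measure \<alpha> (A - Y) \<le> measure \<beta> (A - Y)" if "A \<in> sets M" for A
    using 1[of "A \<inter> Y"] 2[of "A - Y"] that sets Y by (auto simp: a.emeasure_eq_measure b.emeasure_eq_measure)
  have split: "measure \<mu> A = measure \<mu> (A \<inter> Y) + measure \<mu> (A - Y)" if "finite_measure \<mu>" "sets \<mu> = sets M" "A \<in> sets M" for \<mu> A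
  proof -
    interpret finite_measure \<mu> by fact
    have "measure \<mu> ((A \<inter> Y) \<union> (A - Y)) = measure \<mu> (A \<inter> Y) + measure \<mu> (A - Y)"
      by (rule finite_measure_Union) (use that Y in auto)
    moreover have "(A \<inter> Y) \<union> (A - Y) = A" by auto
    ultimately show ?thesis by simp
  qed
  have ga: "emeasure \<gamma> A = ennreal (measure \<alpha> (A - Y) + measure \<beta> (A \<inter> Y))" if A: "A \<in> sets M" for A
  proof -
    have "emeasure \<gamma> A = emeasure \<alpha> A - emeasure \<alpha>' A"
      unfolding \<gamma>_def
    proof (rule emeasure_diff_measure)
      show "finite_measure \<alpha>'"
        by (rule finite_measureI) (use al s' sets_eq_imp_space_eq[OF s'(1)] in auto)
      fix B assume "B \<in> sets \<alpha>"
      then have B: "B \<in> sets M" using sets by simp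
      show "emeasure \<alpha>' B \<le> emeasure \<alpha> B"
        unfolding al[OF B] a.emeasure_eq_measure split[OF assms(1) sets(1) B]
        using measure_nonneg[of \<alpha> "B - Y"] measure_nonneg[of \<beta> "B \<inter> Y"] by (intro ennreal_leI) linarith
    qed (use sets s' A assms in auto)
    also have "\<dots> = ennreal (measure \<alpha> A - (measure \<alpha> (A \<inter> Y) - measure \<beta> (A \<inter> Y)))"
      using nn[OF A] by (simp add: al[OF A] a.emeasure_eq_measure ennreal_minus)
    finally show ?thesis using split[OF assms(1) sets(1) A] by simp
  qed
  show thesis
  proof (rule that[OF s' _ Y _ _ al be])
    show "sets \<gamma> = sets M" using sets by (simp add: \<gamma>_def)
    fix A assume A: "A \<in> sets M"
    show "emeasure \<alpha> A = emeasure \<alpha>' A + emeasure \<gamma> A"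
      using nn[OF A] split[OF assms(1) sets(1) A]
      by (simp add: al[OF A] ga[OF A] a.emeasure_eq_measure ennreal_plus[symmetric] del: ennreal_plus)
    show "emeasure \<beta> A = emeasure \<beta>' A + emeasure \<gamma> A"
      using nn[OF A] split[OF assms(2) sets(2) A]
      by (simp add: be[OF A] ga[OF A] b.emeasure_eq_measure ennreal_plus[symmetric] del: ennreal_plus)
  qed
qed

lemma (in markov_chain) nn_integral_P_step_sum:
  fixes \<phi> :: "'a \<Rightarrow> real"
  assumes u [measurable]: "case_prod u \<in> borel_measurable (M \<Otimes>\<^sub>M borel)" and [measurable]: "\<phi> \<in> borel_measurable M"
  shows "(\<integral>\<^sup>+\<omega>. u (\<omega> (Suc k)) (\<Sum>l<Suc k. \<phi> (\<omega> l)) \<partial>P)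
    = (\<integral>\<^sup>+\<omega>. (\<integral>\<^sup>+z. u z ((\<Sum>l<k. \<phi> (\<omega> l)) + \<phi> (\<omega> k)) \<partial>Q (\<omega> k)) \<partial>P)"
proof -
  let ?v = "\<lambda>\<omega> z. u z (\<Sum>l<Suc k. \<phi> (\<omega> l))"
  have "(\<lambda>x. (snd x, \<Sum>l<Suc k. \<phi> (fst x l))) \<in> PiM {0..<Suc k} (\<lambda>_. M) \<Otimes>\<^sub>M M \<rightarrow>\<^sub>M M \<Otimes>\<^sub>M borel"
    by (intro measurable_Pair borel_measurable_sum) (auto intro!: measurable_compose[OF _ \<open>\<phi> \<in> borel_measurable M\<close>] measurable_compose[OF measurable_fst measurable_component_singleton])
  from measurable_compose[OF this u] have "case_prod ?v \<in> borel_measurable (PiM {0..<Suc k} (\<lambda>_. M) \<Otimes>\<^sub>M M)"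
    by (simp add: split_beta')
  from nn_integral_P_step[OF this] show ?thesis by (simp add: less_Suc_eq)
qed

section \<open>Comparison of two starting points\<close>

context vge_rosenthal
begin

text \<open>The \<open>L\<^sup>p\<close> norm of \<open>x\<close> plus the centered sum over
  \<open>n\<close> states, of which \<open>z\<close> is the first. The recursion conditions on the
  next state, so that two starting points can be compared by induction on \<open>n\<close>, without
  a law on pairs of paths.\<close>

primrec rn :: "nat \<Rightarrow> 'a \<Rightarrow> real \<Rightarrow> ennreal" where
  "rn 0 z x = ennreal \<bar>x\<bar>"
| "rn (Suc n) z x = Np p (Q z) (\<lambda>y. rn n y (x + fb z))"

lemma p_pos: "0 < p" "p \<noteq> 0" "1 \<le> p" "0 \<le> p" "0 \<le> 1 / p" using p by auto

lemma sets_Q [simp]: "z \<in> space M \<Longrightarrow> sets (Q z) = sets M"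
  using measurable_space[OF Q_sub, of z] by (simp add: space_subprob_algebra)

lemma space_Q [simp]: "z \<in> space M \<Longrightarrow> space (Q z) = space M"
  by (rule sets_eq_imp_space_eq) simp

lemma prob_Q: "z \<in> space M \<Longrightarrow> prob_space (Q z)"
  using measurable_space[OF Q, of z] by (simp add: space_prob_algebra)

lemma measurable_Q_eq: "z \<in> space M \<Longrightarrow> measurable (Q z) N' = measurable M N'"
  by (rule measurable_cong_sets) auto

lemma rn_measurable: "(\<lambda>(z, x). rn n z x) \<in> borel_measurable (M \<Otimes>\<^sub>M borel)"
proof (induction n)
  case 0
  then show ?case by simp
next
  case (Suc n)
  have 1: "(\<lambda>(zx, y). ennreal_powr (rn n y (snd zx + fb (fst zx))) p) \<in> borel_measurable ((M \<Otimes>\<^sub>M borel) \<Otimes>\<^sub>M M)"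
  proof -
    have "(\<lambda>w. (snd w, snd (fst w) + fb (fst (fst w)))) \<in> (M \<Otimes>\<^sub>M borel) \<Otimes>\<^sub>M M \<rightarrow>\<^sub>M M \<Otimes>\<^sub>M borel"
      by measurable
    from measurable_compose[OF measurable_compose[OF this Suc] ennreal_powr_measurable, of p]
    show ?thesis by (simp add: split_beta')
  qed
  have 2: "(\<lambda>zx. Q (fst zx)) \<in> M \<Otimes>\<^sub>M borel \<rightarrow>\<^sub>M subprob_algebra M" by measurable
  from measurable_compose[OF nn_integral_measurable_subprob_algebra2[OF 1 2] ennreal_powr_measurable, of "1 / p"]
  show ?case by (simp add: Np_def split_beta')
qed

lemma rn_measurable1 [measurable]: "(\<lambda>z. rn n z x) \<in> borel_measurable M"
  using measurable_compose[OF _ rn_measurable[of n], of "\<lambda>z. (z, x)" M] by simp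

text \<open>\<open>I k\<close> runs the chain for \<open>k\<close> steps and leaves the rest to the
  recursion; one transition shows that it does not depend on \<open>k\<close>. At
  \<open>k = n\<close> it is the moment on path space, at \<open>k = 0\<close> an integral over the
  initial law.\<close>

lemma rn_path:
  assumes \<xi>: "\<xi> \<in> space (prob_algebra M)"
  shows "chain_moment M Q \<xi> \<pi> f n p = Np p \<xi> (\<lambda>z. rn n z 0)"
proof -
  interpret X: markov_chain M Q \<xi> by unfold_locales (use Q \<xi> in auto)
  define I where "I k = (\<integral>\<^sup>+\<omega>. ennreal_powr (rn (n - k) (\<omega> k) (chain_sum \<pi> f k \<omega>)) p \<partial>X.P)" for k
  have step: "I k = I (Suc k)" if k: "k < n" for k
  proof -
    obtain j where j: "n - k = Suc j" "n - Suc k = j" using k by (metis Suc_diff_Suc)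
    have m: "(\<lambda>(z, x). ennreal_powr (rn j z x) p) \<in> borel_measurable (M \<Otimes>\<^sub>M borel)"
      using measurable_compose[OF rn_measurable[of j] ennreal_powr_measurable, of p] by (simp add: split_beta')
    have "I k = (\<integral>\<^sup>+\<omega>. (\<integral>\<^sup>+z. ennreal_powr (rn j z (chain_sum \<pi> f k \<omega> + fb (\<omega> k))) p \<partial>Q (\<omega> k)) \<partial>X.P)"
      by (simp add: I_def j Np_powr p_pos)
    also have "\<dots> = (\<integral>\<^sup>+\<omega>. ennreal_powr (rn j (\<omega> (Suc k)) (\<Sum>l<Suc k. fb (\<omega> l))) p \<partial>X.P)"
      unfolding chain_sum_def using X.nn_integral_P_step_sum[OF m fb_measurable, of k] by simp
    finally show ?thesis by (simp add: I_def j chain_sum_def)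
  qed
  have "I 0 = I k" if "k \<le> n" for k
    using that by (induction k) (auto simp: step)
  from this[of n] have "I n = I 0" by simp
  also have "I 0 = (\<integral>\<^sup>+\<omega>. ennreal_powr (rn n (\<omega> 0) 0) p \<partial>X.P)"
    by (simp add: I_def chain_sum_def)
  also have "\<dots> = (\<integral>\<^sup>+z. ennreal_powr (rn n z 0) p \<partial>\<xi>)"
    by (rule X.nn_integral_P_initial) measurable
  finally show ?thesis
    by (simp add: chain_moment_def Np_def I_def)
qed

text \<open>Minkowski's inequality under each transition; a constant keeps its value because the
  kernel has mass 1.\<close>

lemma rn_Lipschitz: "z \<in> space M \<Longrightarrow> rn n z (x + y) \<le> rn n z x + ennreal \<bar>y\<bar>"
proof (induction n arbitrary: z x)
  case 0
  show ?case by (simp add: ennreal_plus[symmetric] ennreal_leI del: ennreal_plus)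
next
  case (Suc n)
  have "rn (Suc n) z (x + y) \<le> Np p (Q z) (\<lambda>w. rn n w (x + fb z) + ennreal \<bar>y\<bar>)"
    unfolding rn.simps
  proof (rule Np_mono[OF p_pos(1)])
    fix w assume "w \<in> space (Q z)"
    then have "w \<in> space M" using Suc.prems by simp
    from Suc.IH[OF this, of "x + fb z"] show "rn n w (x + y + fb z) \<le> rn n w (x + fb z) + ennreal \<bar>y\<bar>"
      by (simp add: add_ac)
  qed
  also have "\<dots> \<le> Np p (Q z) (\<lambda>w. rn n w (x + fb z)) + Np p (Q z) (\<lambda>_. ennreal \<bar>y\<bar>)"
    by (rule Np_Minkowski[OF p_pos(3)]) (simp_all add: measurable_Q_eq Suc.prems)
  also have "Np p (Q z) (\<lambda>_. ennreal \<bar>y\<bar>) = ennreal \<bar>y\<bar>"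
    by (rule Np_const[OF prob_Q[OF Suc.prems] p_pos(1)])
  finally show ?case by simp
qed

text \<open>The shift \<open>x + fb z\<close> equals \<open>x' + f z\<close> with \<open>x'\<close>
  independent of \<open>z\<close>. Two chains are therefore compared at the same \<open>x'\<close>,
  and only \<open>f z\<close> itself, not its centered version, is charged as error.\<close>

lemma rn_Suc_le:
  fixes x :: real
  assumes z: "z \<in> space M"
  defines "x' \<equiv> x - (\<integral>y. f y \<partial>\<pi>)"
  shows "rn (Suc n) z x \<le> Np p (Q z) (\<lambda>w. rn n w x') + ennreal \<bar>f z\<bar>"
    and "Np p (Q z) (\<lambda>w. rn n w x') \<le> rn (Suc n) z x + ennreal \<bar>f z\<bar>"
proof -
  have e: "x + fb z = x' + f z" "x' = (x + fb z) + (- f z)" by (simp_all add: x'_def centered_def)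
  have le: "Np p (Q z) (\<lambda>w. rn n w (a + b)) \<le> Np p (Q z) (\<lambda>w. rn n w a) + ennreal \<bar>b\<bar>" for a b
  proof -
    have "Np p (Q z) (\<lambda>w. rn n w (a + b)) \<le> Np p (Q z) (\<lambda>w. rn n w a + ennreal \<bar>b\<bar>)"
      using z by (intro Np_mono p_pos rn_Lipschitz) simp
    also have "\<dots> \<le> Np p (Q z) (\<lambda>w. rn n w a) + Np p (Q z) (\<lambda>_. ennreal \<bar>b\<bar>)"
      by (rule Np_Minkowski[OF p_pos(3)]) (simp_all add: measurable_Q_eq z)
    finally show ?thesis by (simp add: Np_const[OF prob_Q[OF z] p_pos(1)])
  qed
  show "rn (Suc n) z x \<le> Np p (Q z) (\<lambda>w. rn n w x') + ennreal \<bar>f z\<bar>"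
    using le[of x' "f z"] by (simp add: e(1))
  show "Np p (Q z) (\<lambda>w. rn n w x') \<le> rn (Suc n) z x + ennreal \<bar>f z\<bar>"
    using le[of "x + fb z" "- f z"] unfolding e(2)[symmetric] by simp
qed

lemma Np_f_le_TV:
  assumes z: "z \<in> space M" "z' \<in> space M" and s: "sets \<alpha> = sets M"
    and le: "\<And>A. A \<in> sets M \<Longrightarrow> emeasure \<alpha> A \<le> emeasure (TV k z z') A"
  shows "Np p \<alpha> (\<lambda>y. ennreal \<bar>f y\<bar>) \<le> ennreal (F * rate k z z' powr (1 / p))"
proof -
  have "(\<integral>\<^sup>+y. ennreal_powr (ennreal \<bar>f y\<bar>) p \<partial>\<alpha>) \<le> (\<integral>\<^sup>+y. ennreal_powr (ennreal \<bar>f y\<bar>) p \<partial>TV k z z')"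
    by (rule nn_integral_mono_measure) (simp_all add: s le le_measure)
  also have "\<dots> \<le> (\<integral>\<^sup>+y. ennreal (F powr p) * ennreal (V y) \<partial>TV k z z')"
  proof (rule nn_integral_mono)
    fix y assume "y \<in> space (TV k z z')"
    then have y: "y \<in> space M" by simp
    have "\<bar>f y\<bar> powr p \<le> (F * V y powr (1 / (2 * p))) powr p"
      using f_le[OF y] p by (intro powr_mono2) auto
    also have "\<dots> = F powr p * V y powr (1 / 2)"
      using p by (simp add: powr_mult powr_powr)
    \<comment> \<open>The root of \<open>V\<close> is enlarged to \<open>V\<close>, to which the
      ergodicity bound applies directly; in norm this gives the ratio
      \<open>(1/4) powr (1 / p)\<close>.\<close>
    also have "\<dots> \<le> F powr p * V y"
      by (intro mult_left_mono powr_V_le y) auto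
    finally show "ennreal_powr (ennreal \<bar>f y\<bar>) p \<le> ennreal (F powr p) * ennreal (V y)"
      using V_pos[OF y] by (simp add: ennreal_mult[symmetric] ennreal_leI)
  qed
  also have "\<dots> = ennreal (F powr p) * (\<integral>\<^sup>+y. ennreal (V y) \<partial>TV k z z')"
    by (rule nn_integral_cmult) simp
  also have "\<dots> \<le> ennreal (F powr p) * ennreal (rate k z z')"
    by (intro mult_left_mono nn_integral_V_TV z) simp
  finally have "Np p \<alpha> (\<lambda>y. ennreal \<bar>f y\<bar>) \<le> ennreal_powr (ennreal (F powr p) * ennreal (rate k z z')) (1 / p)"
    unfolding Np_def by (intro ennreal_powr_mono p_pos)
  also have "\<dots> = ennreal (F * rate k z z' powr (1 / p))"
    using rate_pos[OF z, of k] F p by (simp add: ennreal_mult[symmetric] powr_mult powr_powr)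
  finally show ?thesis .
qed

lemma measurable_set_cong: "sets \<alpha> = sets M \<Longrightarrow> measurable \<alpha> N' = measurable M N'"
  by (rule measurable_cong_sets) auto

text \<open>The one-step comparison averaged over a measure \<alpha>: the composition with
  \<open>Q\<close> is the measure one step later, and the error is the norm of \<open>f\<close>
  under \<alpha>.\<close>

lemma Np_rn_Suc:
  fixes x :: real
  assumes s: "sets \<alpha> = sets M"
  defines "x' \<equiv> x - (\<integral>y. f y \<partial>\<pi>)"
  shows "Np p \<alpha> (\<lambda>y. rn (Suc n) y x) \<le> Np p (\<alpha> \<bind> Q) (\<lambda>w. rn n w x') + Np p \<alpha> (\<lambda>y. ennreal \<bar>f y\<bar>)"
    and "Np p (\<alpha> \<bind> Q) (\<lambda>w. rn n w x') \<le> Np p \<alpha> (\<lambda>y. rn (Suc n) y x) + Np p \<alpha> (\<lambda>y. ennreal \<bar>f y\<bar>)"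
proof -
  have sp: "space \<alpha> = space M" by (rule sets_eq_imp_space_eq[OF s])
  have b: "Np p (\<alpha> \<bind> Q) (\<lambda>w. rn n w x') = Np p \<alpha> (\<lambda>y. Np p (Q y) (\<lambda>w. rn n w x'))"
    by (rule Np_bind[OF p_pos(1) Q_sub s, symmetric]) measurable
  have mN: "(\<lambda>y. Np p (Q y) (\<lambda>w. rn n w x')) \<in> borel_measurable M"
    unfolding Np_def by measurable
  have "Np p \<alpha> (\<lambda>y. rn (Suc n) y x) \<le> Np p \<alpha> (\<lambda>y. Np p (Q y) (\<lambda>w. rn n w x') + ennreal \<bar>f y\<bar>)"
    unfolding x'_def by (intro Np_mono p_pos rn_Suc_le) (simp add: sp)
  also have "\<dots> \<le> Np p \<alpha> (\<lambda>y. Np p (Q y) (\<lambda>w. rn n w x')) + Np p \<alpha> (\<lambda>y. ennreal \<bar>f y\<bar>)"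
    by (rule Np_Minkowski[OF p_pos(3)]) (simp_all add: measurable_set_cong[OF s] mN)
  finally show "Np p \<alpha> (\<lambda>y. rn (Suc n) y x) \<le> Np p (\<alpha> \<bind> Q) (\<lambda>w. rn n w x') + Np p \<alpha> (\<lambda>y. ennreal \<bar>f y\<bar>)"
    unfolding b .
  have "Np p \<alpha> (\<lambda>y. Np p (Q y) (\<lambda>w. rn n w x')) \<le> Np p \<alpha> (\<lambda>y. rn (Suc n) y x + ennreal \<bar>f y\<bar>)"
    unfolding x'_def by (intro Np_mono p_pos rn_Suc_le) (simp add: sp)
  also have "\<dots> \<le> Np p \<alpha> (\<lambda>y. rn (Suc n) y x) + Np p \<alpha> (\<lambda>y. ennreal \<bar>f y\<bar>)"
    by (rule Np_Minkowski[OF p_pos(3)]) (simp_all add: measurable_set_cong[OF s] rn_measurable1 del: rn.simps)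
  finally show "Np p (\<alpha> \<bind> Q) (\<lambda>w. rn n w x') \<le> Np p \<alpha> (\<lambda>y. rn (Suc n) y x) + Np p \<alpha> (\<lambda>y. ennreal \<bar>f y\<bar>)"
    unfolding b .
qed

text \<open>
  A coupling argument without a coupling: at each step the common part of the two laws is split off, and
  the parts that remain are dominated by the total variation measure \<open>TV k z z'\<close>.
\<close>

lemma rn_two_starts:
  assumes z: "z \<in> space M" "z' \<in> space M"
    and "\<alpha> \<in> space (subprob_algebra M)" "\<beta> \<in> space (subprob_algebra M)"
    and "\<And>A. A \<in> sets M \<Longrightarrow> emeasure \<alpha> A + emeasure (kernel_pow M Q k z') A = emeasure \<beta> A + emeasure (kernel_pow M Q k z) A"
  shows "Np p \<alpha> (\<lambda>y. rn n y x) \<le> Np p \<beta> (\<lambda>y. rn n y x) + ennreal (\<Sum>j<n. 2 * F * rate (k + j) z z' powr (1 / p))"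
  using assms(3-)
\<comment> \<open>The balance hypothesis says that \<alpha> and \<beta> differ by the difference of
  the two kernel powers, written without subtraction. It survives the removal of a common part and
  one application of \<open>Q\<close>, which raises \<open>k\<close> by one; this is the invariant
  of the induction.\<close>
proof (induction n arbitrary: \<alpha> \<beta> k x)
  \<comment> \<open>At \<open>n = 0\<close> the integrand is the constant
    \<open>\<bar>x\<bar>\<close>, so only the total masses count, and these agree.\<close>
  case 0
  have s: "space \<alpha> = space M" "space \<beta> = space M"
    using 0 by (auto simp: space_subprob_algebra intro!: sets_eq_imp_space_eq)
  have one: "emeasure (kernel_pow M Q k y) (space M) = 1" if "y \<in> space M" for y
    using prob_space.emeasure_space_1[OF prob_space_kernel_pow[OF that, of k]] that by simp
  have "emeasure \<alpha> (space M) + 1 = emeasure \<beta> (space M) + 1"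
    using 0(3)[OF sets.top] by (simp add: one z)
  then have "emeasure \<alpha> (space M) = emeasure \<beta> (space M)" by (simp add: ennreal_add_left_cancel add.commute)
  then show ?case by (simp add: Np_def s)
next
  case (Suc n)
  let ?N = "kernel_pow M Q k z" and ?N' = "kernel_pow M Q k z'"
  interpret N: prob_space ?N by (rule prob_space_kernel_pow[OF z(1)])
  interpret N': prob_space ?N' by (rule prob_space_kernel_pow[OF z(2)])
  have a: "subprob_space \<alpha>" "sets \<alpha> = sets M" and b: "subprob_space \<beta>" "sets \<beta> = sets M"
    using Suc.prems(1,2) by (auto simp: space_subprob_algebra)
  interpret a: subprob_space \<alpha> by (rule a)
  interpret b: subprob_space \<beta> by (rule b)
  have diff: "measure \<alpha> A - measure \<beta> A = measure ?N A - measure ?N' A" if A: "A \<in> sets M" for A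
  proof -
    have "ennreal (measure \<alpha> A + measure ?N' A) = ennreal (measure \<beta> A + measure ?N A)"
      using Suc.prems(3)[OF A] by (simp add: a.emeasure_eq_measure b.emeasure_eq_measure N.emeasure_eq_measure N'.emeasure_eq_measure)
    then have "measure \<alpha> A + measure ?N' A = measure \<beta> A + measure ?N A"
      by (subst (asm) ennreal_inj) auto
    then show ?thesis by simp
  qed
  obtain \<alpha>' \<beta>' \<gamma> Y where s': "sets \<alpha>' = sets M" "sets \<beta>' = sets M" "sets \<gamma> = sets M" and Y: "Y \<in> sets M"
    and da: "\<And>A. A \<in> sets M \<Longrightarrow> emeasure \<alpha> A = emeasure \<alpha>' A + emeasure \<gamma> A"
    and db: "\<And>A. A \<in> sets M \<Longrightarrow> emeasure \<beta> A = emeasure \<beta>' A + emeasure \<gamma> A"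
    and ea: "\<And>A. A \<in> sets M \<Longrightarrow> emeasure \<alpha>' A = ennreal (measure \<alpha> (A \<inter> Y) - measure \<beta> (A \<inter> Y))"
    and eb: "\<And>A. A \<in> sets M \<Longrightarrow> emeasure \<beta>' A = ennreal (measure \<beta> (A - Y) - measure \<alpha> (A - Y))"
    using Jordan_splitting[OF a.finite_measure_axioms b.finite_measure_axioms a(2) b(2)] by metis
  have TVa: "emeasure \<alpha>' A \<le> emeasure (TV k z z') A" if A: "A \<in> sets M" for A
  proof -
    have "emeasure \<alpha>' A \<le> ennreal \<bar>measure ?N (A \<inter> Y) - measure ?N' (A \<inter> Y)\<bar>"
      unfolding ea[OF A] using A Y diff[of "A \<inter> Y"] by (intro ennreal_leI) auto
    also have "\<dots> \<le> emeasure (TV k z z') (A \<inter> Y)" using A Y by (intro emeasure_TV_ge z) auto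
    also have "\<dots> \<le> emeasure (TV k z z') A" using A by (intro emeasure_mono) auto
    finally show ?thesis .
  qed
  have TVb: "emeasure \<beta>' A \<le> emeasure (TV k z z') A" if A: "A \<in> sets M" for A
  proof -
    have "emeasure \<beta>' A \<le> ennreal \<bar>measure ?N (A - Y) - measure ?N' (A - Y)\<bar>"
      unfolding eb[OF A] using A Y diff[of "A - Y"] by (intro ennreal_leI) auto
    also have "\<dots> \<le> emeasure (TV k z z') (A - Y)" using A Y by (intro emeasure_TV_ge z) auto
    also have "\<dots> \<le> emeasure (TV k z z') A" using A by (intro emeasure_mono) auto
    finally show ?thesis .
  qed
  have sp': "space \<alpha>' = space M" "space \<beta>' = space M"
    using s' by (auto intro!: sets_eq_imp_space_eq)
  have ne: "space M \<noteq> {}" using z by auto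
  have suba: "\<alpha>' \<in> space (subprob_algebra M)"
  proof -
    have "emeasure \<alpha>' (space M) \<le> emeasure \<alpha> (space M)" using da[OF sets.top] by simp
    also have "\<dots> \<le> 1" using a.emeasure_space_le_1 sets_eq_imp_space_eq[OF a(2)] by simp
    finally show ?thesis using ne s' sp' by (auto simp: space_subprob_algebra intro!: subprob_spaceI)
  qed
  have subb: "\<beta>' \<in> space (subprob_algebra M)"
  proof -
    have "emeasure \<beta>' (space M) \<le> emeasure \<beta> (space M)" using db[OF sets.top] by simp
    also have "\<dots> \<le> 1" using b.emeasure_space_le_1 sets_eq_imp_space_eq[OF b(2)] by simp
    finally show ?thesis using ne s' sp' by (auto simp: space_subprob_algebra intro!: subprob_spaceI)
  qed
  have bal: "emeasure \<alpha>' A + emeasure ?N' A = emeasure \<beta>' A + emeasure ?N A" if A: "A \<in> sets M" for A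
  proof -
    have "emeasure \<gamma> A + (emeasure \<alpha>' A + emeasure ?N' A) = emeasure \<gamma> A + (emeasure \<beta>' A + emeasure ?N A)"
      using Suc.prems(3)[OF A] da[OF A] db[OF A] by (simp add: add_ac)
    moreover have "emeasure \<gamma> A \<noteq> \<top>"
      using da[OF A] a.emeasure_finite[of A] by (auto simp: top_unique)
    ultimately show ?thesis unfolding ennreal_add_left_cancel by simp
  qed
  have int_eq: "(\<integral>\<^sup>+y. u y \<partial>\<alpha>') + (\<integral>\<^sup>+y. u y \<partial>?N') = (\<integral>\<^sup>+y. u y \<partial>\<beta>') + (\<integral>\<^sup>+y. u y \<partial>?N)"
    if u: "u \<in> borel_measurable M" for u
  proof -
    have "sum_measure \<alpha>' ?N' = sum_measure \<beta>' ?N"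
    proof (rule measure_eqI)
      fix A assume "A \<in> sets (sum_measure \<alpha>' ?N')"
      then have A: "A \<in> sets M" by (simp add: s')
      have "emeasure (sum_measure \<alpha>' ?N') A = emeasure \<alpha>' A + emeasure ?N' A"
        by (rule emeasure_sum_measure) (simp_all add: s' z A)
      also have "\<dots> = emeasure \<beta>' A + emeasure ?N A" by (rule bal[OF A])
      also have "\<dots> = emeasure (sum_measure \<beta>' ?N) A"
        by (rule emeasure_sum_measure[symmetric]) (simp_all add: s' z A)
      finally show "emeasure (sum_measure \<alpha>' ?N') A = emeasure (sum_measure \<beta>' ?N) A" .
    qed (simp add: s')
    then show ?thesis
      using nn_integral_sum_measure[of ?N' \<alpha>' u] nn_integral_sum_measure[of ?N \<beta>' u] u z
      by (simp add: s' measurable_set_cong[OF s'(1)] measurable_set_cong[OF s'(2)])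
  qed
  have bindA: "emeasure (\<mu> \<bind> Q) A = (\<integral>\<^sup>+y. emeasure (Q y) A \<partial>\<mu>)" if "sets \<mu> = sets M" "A \<in> sets M" for \<mu> A
  proof (rule emeasure_bind[where N=M])
    show "space \<mu> \<noteq> {}" using ne sets_eq_imp_space_eq[OF that(1)] by simp
    show "Q \<in> \<mu> \<rightarrow>\<^sub>M subprob_algebra M" using Q_sub by (simp add: measurable_set_cong[OF that(1)])
  qed (rule that)
  have "Np p (\<alpha>' \<bind> Q) (\<lambda>y. rn n y x') \<le> Np p (\<beta>' \<bind> Q) (\<lambda>y. rn n y x') + ennreal (\<Sum>j<n. 2 * F * rate (Suc k + j) z z' powr (1 / p))" for x'
  proof (rule Suc.IH)
    show "\<alpha>' \<bind> Q \<in> space (subprob_algebra M)" "\<beta>' \<bind> Q \<in> space (subprob_algebra M)"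
      using subprob_space_bind[of \<alpha>' Q M] subprob_space_bind[of \<beta>' Q M] sets_bind[of \<alpha>' Q M] sets_bind[of \<beta>' Q M]
        suba subb Q_sub ne sp' s' by (auto simp: space_subprob_algebra measurable_set_cong[OF s'(1)] measurable_set_cong[OF s'(2)])
    fix A assume A: "A \<in> sets M"
    have [measurable]: "(\<lambda>y. emeasure (Q y) A) \<in> borel_measurable M"
      by (rule measurable_compose[OF Q_sub measurable_emeasure_subprob_algebra[OF A]])
    show "emeasure (\<alpha>' \<bind> Q) A + emeasure (kernel_pow M Q (Suc k) z') A = emeasure (\<beta>' \<bind> Q) A + emeasure (kernel_pow M Q (Suc k) z) A"
      using int_eq[of "\<lambda>y. emeasure (Q y) A"] A z by (simp add: bindA s' kernel_pow.simps(2))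
  qed
  note ih = this
  let ?x' = "x - (\<integral>y. f y \<partial>\<pi>)" and ?\<delta> = "ennreal (\<Sum>j<n. 2 * F * rate (Suc k + j) z z' powr (1 / p))"
    and ?t = "ennreal (F * rate k z z' powr (1 / p))" and ?r = "\<lambda>y. rn (Suc n) y x"
  \<comment> \<open>Each residual part is charged the norm of \<open>f\<close> once: one
    \<open>?t\<close> for the step forward from \<alpha>', and one for the way back to \<beta>'.
    Hence the factor 2 in the error.\<close>
  have "Np p \<alpha>' ?r \<le> Np p (\<alpha>' \<bind> Q) (\<lambda>w. rn n w ?x') + Np p \<alpha>' (\<lambda>y. ennreal \<bar>f y\<bar>)"
    by (rule Np_rn_Suc(1)[OF s'(1)])
  also have "\<dots> \<le> (Np p (\<beta>' \<bind> Q) (\<lambda>w. rn n w ?x') + ?\<delta>) + ?t"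
    by (intro add_mono ih Np_f_le_TV z s' TVa)
  also have "\<dots> \<le> ((Np p \<beta>' ?r + Np p \<beta>' (\<lambda>y. ennreal \<bar>f y\<bar>)) + ?\<delta>) + ?t"
    by (intro add_right_mono Np_rn_Suc(2) s')
  also have "\<dots> \<le> ((Np p \<beta>' ?r + ?t) + ?\<delta>) + ?t"
    by (intro add_right_mono add_left_mono Np_f_le_TV z s' TVb)
  also have "\<dots> = Np p \<beta>' ?r + (?t + ?t + ?\<delta>)" by (simp add: add_ac)
  also have "?t + ?t + ?\<delta> = ennreal (\<Sum>j<Suc n. 2 * F * rate (k + j) z z' powr (1 / p))"
  proof -
    have "(\<Sum>j<Suc n. 2 * F * rate (k + j) z z' powr (1 / p)) = 2 * F * rate k z z' powr (1 / p) + (\<Sum>j<n. 2 * F * rate (Suc k + j) z z' powr (1 / p))"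
      by (subst sum.lessThan_Suc_shift) simp
    moreover have "0 \<le> (\<Sum>j<n. 2 * F * rate (Suc k + j) z z' powr (1 / p))"
      using F by (intro sum_nonneg) auto
    ultimately show ?thesis using F by (simp add: ennreal_plus[symmetric] del: ennreal_plus)
  qed
  finally have le: "Np p \<alpha>' ?r \<le> Np p \<beta>' ?r + ennreal (\<Sum>j<Suc n. 2 * F * rate (k + j) z z' powr (1 / p))" .
  \<comment> \<open>The common part \<gamma> contributes the same constant to both sides; the
    two-point inequality restores it without enlarging the error.\<close>
  let ?c = "\<integral>\<^sup>+y. ennreal_powr (?r y) p \<partial>\<gamma>"
  have rm: "(\<lambda>y. ennreal_powr (?r y) p) \<in> borel_measurable M"
    by (rule measurable_compose[OF rn_measurable1 ennreal_powr_measurable])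
  have "Np p \<alpha> ?r \<le> ennreal_powr (ennreal_powr (Np p \<alpha>' ?r) p + ?c) (1 / p)"
    unfolding Np_powr[OF p_pos(2)] unfolding Np_def
    using nn_integral_le_add_measure[of \<alpha>' \<alpha> \<gamma> "\<lambda>y. ennreal_powr (?r y) p"] rm da a(2) s'
    by (intro ennreal_powr_mono p_pos) (simp add: measurable_set_cong[OF a(2)])
  also have "\<dots> \<le> ennreal_powr (ennreal_powr (Np p \<beta>' ?r) p + ?c) (1 / p) + ennreal (\<Sum>j<Suc n. 2 * F * rate (k + j) z z' powr (1 / p))"
    by (rule ennreal_powr_two_point_Minkowski[OF p_pos(3) le])
  also have "ennreal_powr (ennreal_powr (Np p \<beta>' ?r) p + ?c) (1 / p) \<le> Np p \<beta> ?r"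
    unfolding Np_powr[OF p_pos(2)] unfolding Np_def
    using nn_integral_add_measure_le[of \<beta>' \<beta> \<gamma> "\<lambda>y. ennreal_powr (?r y) p"] rm db b(2) s'
    by (intro ennreal_powr_mono p_pos) (simp add: measurable_set_cong[OF b(2)])
  finally show ?case by (simp add: add_right_mono)
qed

text \<open>At \<open>k = 0\<close> the two laws are point masses at \<open>z\<close> and
  \<open>z'\<close>. The errors form a geometric series of ratio \<open>(1/4) powr (1 / p)\<close>
  in stretches of length \<tau>, which sums to at most \<open>p * \<tau>\<close>.\<close>

lemma rn_pointwise:
  assumes z: "z \<in> space M" "z' \<in> space M"
  shows "rn n z 0 \<le> rn n z' 0 + ennreal (2 * F * p * real \<tau> * \<kappa> powr (1 / p)) * ennreal ((V z + V z') powr (1 / p))"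
proof -
  have Npr: "Np p (return M y) (\<lambda>w. rn n w 0) = rn n y 0" if y: "y \<in> space M" for y
    unfolding Np_def using y p_pos
    by (subst nn_integral_return) (auto simp: ennreal_powr_powr_inverse intro: measurable_compose[OF rn_measurable1 ennreal_powr_measurable])
  have ret: "return M y \<in> space (subprob_algebra M)" if "y \<in> space M" for y
    using measurable_space[OF measurable_return_prob_space that] by (simp add: space_prob_algebra space_subprob_algebra prob_space_imp_subprob_space)
  have "Np p (return M z) (\<lambda>w. rn n w 0) \<le> Np p (return M z') (\<lambda>w. rn n w 0) + ennreal (\<Sum>j<n. 2 * F * rate (0 + j) z z' powr (1 / p))"
    by (rule rn_two_starts[OF z ret[OF z(1)] ret[OF z(2)]]) (simp add: add.commute)
  also have "(\<Sum>j<n. 2 * F * rate (0 + j) z z' powr (1 / p)) \<le> (2 * F * p * real \<tau> * \<kappa> powr (1 / p)) * (V z + V z') powr (1 / p)"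
  proof -
    let ?r = "(1/4) powr (1 / p) :: real"
    have r: "?r \<le> 1 - 1 / p" using p by (intro quarter_powr_le) auto
    then have r1: "?r < 1" using q01(1) by linarith
    have "rate j z z' powr (1 / p) = \<kappa> powr (1 / p) * (V z + V z') powr (1 / p) * ?r ^ (j div \<tau>)" for j
    proof -
      have "((1/4) ^ (j div \<tau>)) powr (1 / p) = ?r ^ (j div \<tau>)"
        by (simp add: powr_realpow[symmetric] powr_powr mult.commute)
      then show ?thesis by (simp add: rate_def powr_mult)
    qed
    then have "(\<Sum>j<n. 2 * F * rate (0 + j) z z' powr (1 / p)) = 2 * F * (\<kappa> powr (1 / p) * (V z + V z') powr (1 / p)) * (\<Sum>j<n. ?r ^ (j div \<tau>))"
      by (simp add: sum_distrib_left mult_ac)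
    also have "\<dots> \<le> 2 * F * (\<kappa> powr (1 / p) * (V z + V z') powr (1 / p)) * (p * real \<tau>)"
    proof (rule mult_left_mono)
      have "(\<Sum>j<n. ?r ^ (j div \<tau>)) \<le> real \<tau> / (1 - ?r)"
        by (rule geometric_div_series(2)[OF _ r1 tau_pos]) simp
      also have "\<dots> \<le> real \<tau> / (1 / p)" using r r1 p by (intro divide_left_mono) auto
      finally show "(\<Sum>j<n. ?r ^ (j div \<tau>)) \<le> p * real \<tau>" by (simp add: mult.commute)
    qed (use F in simp)
    finally show ?thesis by (simp add: mult_ac)
  qed
  finally show ?thesis
    using F p by (simp add: Npr z ennreal_mult add_left_mono ennreal_leI)
qed

text \<open>The pointwise comparison is integrated over the second point under \<pi> and then over
  the first under \<xi>. No power is lost, because the \<open>p\<close>-th power of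
  \<open>(V z + V z') powr (1 / p)\<close> is linear in the two values of \<open>V\<close>.\<close>

lemma initial_moment:
  assumes \<xi>: "\<xi> \<in> space (prob_algebra M)"
  shows "chain_moment M Q \<xi> \<pi> f n p \<le> chain_moment M Q \<pi> \<pi> f n p
    + ennreal (2 * F * p * real \<tau> * \<kappa> powr (1 / p)) * ennreal_powr ((\<integral>\<^sup>+z. ennreal (V z) \<partial>\<xi>) + ennreal v) (1 / p)"
proof -
  have x: "prob_space \<xi>" "sets \<xi> = sets M" using \<xi> by (auto simp: space_prob_algebra)
  interpret x: prob_space \<xi> by (rule x)
  have sx: "space \<xi> = space M" by (rule sets_eq_imp_space_eq[OF x(2)])
  let ?c = "ennreal (2 * F * p * real \<tau> * \<kappa> powr (1 / p))"
  have Npc: "Np p \<mu> (\<lambda>y. ?c * ennreal (w y powr (1 / p))) = ?c * ennreal_powr (\<integral>\<^sup>+y. ennreal (w y) \<partial>\<mu>) (1 / p)"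
    if w: "w \<in> borel_measurable \<mu>" "\<And>y. y \<in> space \<mu> \<Longrightarrow> 0 \<le> w y" for \<mu> :: "'a measure" and w
  proof -
    have "(\<integral>\<^sup>+y. ennreal_powr (?c * ennreal (w y powr (1 / p))) p \<partial>\<mu>) = (\<integral>\<^sup>+y. ennreal_powr ?c p * ennreal (w y) \<partial>\<mu>)"
      using p_pos w(2) by (intro nn_integral_cong) (simp add: ennreal_powr_mult powr_powr)
    also have "\<dots> = ennreal_powr ?c p * (\<integral>\<^sup>+y. ennreal (w y) \<partial>\<mu>)"
      using w by (intro nn_integral_cmult) simp
    finally show ?thesis using p_pos by (simp add: Np_def ennreal_powr_mult ennreal_powr_powr_inverse)
  qed
  have 1: "rn n z 0 \<le> Np p \<pi> (\<lambda>y. rn n y 0) + ?c * ennreal ((V z + v) powr (1 / p))" if z: "z \<in> space M" for z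
  proof -
    have "rn n z 0 = Np p \<pi> (\<lambda>_. rn n z 0)"
      by (rule Np_const[OF \<pi>.prob_space_axioms p_pos(1), symmetric])
    also have "\<dots> \<le> Np p \<pi> (\<lambda>y. rn n y 0 + ?c * ennreal ((V z + V y) powr (1 / p)))"
      by (rule Np_mono[OF p_pos(1)]) (use rn_pointwise z in simp)
    also have "\<dots> \<le> Np p \<pi> (\<lambda>y. rn n y 0) + Np p \<pi> (\<lambda>y. ?c * ennreal ((V z + V y) powr (1 / p)))"
      by (rule Np_Minkowski[OF p_pos(3)]) simp_all
    also have "Np p \<pi> (\<lambda>y. ?c * ennreal ((V z + V y) powr (1 / p))) = ?c * ennreal_powr (\<integral>\<^sup>+y. ennreal (V z + V y) \<partial>\<pi>) (1 / p)"
      by (rule Npc) (use V_pos[OF z] V_pos in \<open>auto intro!: less_imp_le add_pos_pos\<close>)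
    also have "(\<integral>\<^sup>+y. ennreal (V z + V y) \<partial>\<pi>) = ennreal (V z + v)"
    proof -
      have "(\<integral>\<^sup>+y. ennreal (V z + V y) \<partial>\<pi>) = (\<integral>\<^sup>+y. ennreal (V z) + ennreal (V y) \<partial>\<pi>)"
        using V_pos z by (intro nn_integral_cong) (simp add: less_imp_le)
      also have "\<dots> = ennreal (V z) + ennreal v"
        using \<pi>.emeasure_space_1 by (simp add: nn_integral_add v_nn)
      finally show ?thesis using V_pos[OF z] v_ge2 by simp
    qed
    finally show ?thesis using V_pos[OF z] v_ge2 by (simp del: ennreal_plus)
  qed
  have "chain_moment M Q \<xi> \<pi> f n p = Np p \<xi> (\<lambda>z. rn n z 0)" by (rule rn_path[OF \<xi>])
  also have "\<dots> \<le> Np p \<xi> (\<lambda>z. Np p \<pi> (\<lambda>y. rn n y 0) + ?c * ennreal ((V z + v) powr (1 / p)))"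
    by (rule Np_mono[OF p_pos(1)]) (use 1 sx in simp)
  also have "\<dots> \<le> Np p \<xi> (\<lambda>_. Np p \<pi> (\<lambda>y. rn n y 0)) + Np p \<xi> (\<lambda>z. ?c * ennreal ((V z + v) powr (1 / p)))"
    by (rule Np_Minkowski[OF p_pos(3)]) (simp_all add: measurable_set_cong[OF x(2)])
  also have "Np p \<xi> (\<lambda>_. Np p \<pi> (\<lambda>y. rn n y 0)) = Np p \<pi> (\<lambda>y. rn n y 0)"
    by (rule Np_const[OF x(1) p_pos(1)])
  also have "\<dots> = chain_moment M Q \<pi> \<pi> f n p" by (rule rn_path[symmetric, OF invariant_distrD(1)[OF inv]])
  also have "Np p \<xi> (\<lambda>z. ?c * ennreal ((V z + v) powr (1 / p))) = ?c * ennreal_powr (\<integral>\<^sup>+z. ennreal (V z + v) \<partial>\<xi>) (1 / p)"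
    by (rule Npc) (use V_pos v_ge2 sx in \<open>auto simp: measurable_set_cong[OF x(2)] intro!: less_imp_le add_pos_pos\<close>)
  also have "(\<integral>\<^sup>+z. ennreal (V z + v) \<partial>\<xi>) = (\<integral>\<^sup>+z. ennreal (V z) \<partial>\<xi>) + ennreal v"
  proof -
    have "(\<integral>\<^sup>+z. ennreal (V z + v) \<partial>\<xi>) = (\<integral>\<^sup>+z. ennreal (V z) + ennreal v \<partial>\<xi>)"
      using V_pos v_ge2 sx by (intro nn_integral_cong) (simp add: less_imp_le)
    also have "\<dots> = (\<integral>\<^sup>+z. ennreal (V z) \<partial>\<xi>) + ennreal v"
      using x.emeasure_space_1 by (subst nn_integral_add) (simp_all add: measurable_set_cong[OF x(2)])
    finally show ?thesis .
  qed
  finally show ?thesis .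
qed

end

text \<open>A vanishing norm of \<open>f\<close> is split off because the locale
  \<open>vge_rosenthal\<close> assumes \<open>0 < F\<close>, which keeps \<open>G\<close> and \<rho>
  positive.\<close>

lemma (in vge_chain) chain_moment_zero:
  assumes f0: "\<And>z. z \<in> space M \<Longrightarrow> f z = 0" and \<xi>: "\<xi> \<in> space (prob_algebra M)" and p: "0 < p"
  shows "chain_moment M Q \<xi> \<pi> f n p = 0"
proof -
  interpret X: markov_chain M Q \<xi> by unfold_locales (use Q_prob \<xi> in auto)
  have "(\<integral>x. f x \<partial>\<pi>) = (\<integral>x. 0 \<partial>\<pi>)"
    by (rule Bochner_Integration.integral_cong) (auto simp: f0)
  then have "chain_sum \<pi> f n \<omega> = 0" if "\<omega> \<in> space X.P" for \<omega>
    using X.coord_in_space[OF that] by (simp add: chain_sum_def centered_def f0)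
  then have "(\<integral>\<^sup>+\<omega>. ennreal (\<bar>chain_sum \<pi> f n \<omega>\<bar> powr p) \<partial>X.P) = (\<integral>\<^sup>+\<omega>. 0 \<partial>X.P)"
    by (intro nn_integral_cong) simp
  then show ?thesis by (simp add: chain_moment_def)
qed

theorem theorem4:
  fixes M :: "'a measure" and Q :: "'a \<Rightarrow> 'a measure" and V f :: "'a \<Rightarrow> real"
    and \<pi> :: "'a measure" and \<tau> n :: nat and \<kappa> p :: real
  assumes "V \<in> borel_measurable M" and "\<And>z. z \<in> space M \<Longrightarrow> exp 1 \<le> V z"
    and "Q \<in> M \<rightarrow>\<^sub>M prob_algebra M"
    and "VGE M Q V \<pi> \<tau> \<kappa>"
    and "p \<ge> 2"
    and "f \<in> borel_measurable M"
    and "fun_norm M (\<lambda>z. V z powr (1 / (2 * p))) f < \<infinity>"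
    and "n \<ge> 3"
  shows "chain_moment M Q \<pi> \<pi> f n p \<le>
      ennreal (C1 * sqrt 2 * p powr (1/2) * real n powr (1/2) * sqrt (asymp_var M Q \<pi> f))
    + ennreal (4 * D1) * ennreal_powr (ennreal \<kappa> * (\<integral>\<^sup>+ z. ennreal (V z) \<partial>\<pi>)) (2 / p)
        * ennreal (p\<^sup>2 * log 2 (2 * p) * real n powr (1/4) * real \<tau> powr (3/4))
        * fun_norm M (\<lambda>z. V z powr (1 / (2 * p))) f
    + ennreal (4 * D2) * ennreal_powr (ennreal \<kappa> * (\<integral>\<^sup>+ z. ennreal (V z) \<partial>\<pi>)) (1 / p)
        * ennreal (p\<^sup>2 * log 2 (2 * p) * real n powr (1 / p) * real \<tau>)
        * fun_norm M (\<lambda>z. V z powr (1 / (2 * p))) f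
    \<and> (\<forall>\<xi>\<in>space (prob_algebra M).
      chain_moment M Q \<xi> \<pi> f n p \<le> chain_moment M Q \<pi> \<pi> f n p
      + ennreal (32 / 15 * \<kappa> powr (1 / p))
        * ennreal_powr ((\<integral>\<^sup>+ z. ennreal (V z) \<partial>\<xi>) + (\<integral>\<^sup>+ z. ennreal (V z) \<partial>\<pi>)) (1 / p)
        * ennreal (p * real \<tau>)
        * fun_norm M (\<lambda>z. V z powr (1 / (2 * p))) f)"
proof -
  let ?W = "\<lambda>z. V z powr (1 / (2 * p))"
  interpret vge_chain M Q V \<pi> \<tau> \<kappa>
    by (rule vge_chain.intro) (fact assms)+
  define F where "F = enn2real (fun_norm M ?W f)"
  have norm: "fun_norm M ?W f = ennreal F"
    using assms(7) by (simp add: F_def)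
  have F0: "0 \<le> F" by (simp add: F_def)
  have f_le: "\<bar>f z\<bar> \<le> F * ?W z" if z: "z \<in> space M" for z
  proof -
    have "ennreal (\<bar>f z\<bar> / ?W z) \<le> fun_norm M ?W f"
      unfolding fun_norm_def by (rule SUP_upper[OF z])
    then have "\<bar>f z\<bar> / ?W z \<le> F" unfolding norm using F0 by (simp add: ennreal_le_iff)
    then show ?thesis using V_pos[OF z] by (simp add: divide_le_eq)
  qed
  have p: "0 < p" using assms(5) by simp
  have pi: "\<pi> \<in> space (prob_algebra M)" by (rule invariant_distrD(1)[OF inv])
  show ?thesis
  proof (cases "F = 0")
    case True
    then have "f z = 0" if "z \<in> space M" for z using f_le[OF that] by simp
    then have "chain_moment M Q \<xi> \<pi> f n p = 0" if "\<xi> \<in> space (prob_algebra M)" for \<xi>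
      using chain_moment_zero[OF _ that p] by simp
    then show ?thesis using pi by simp
  next
    case False
    then have Fpos: "0 < F" using F0 by simp
    interpret vge_rosenthal M Q V \<pi> \<tau> \<kappa> f p F
      by unfold_locales (use assms Fpos f_le in auto)
    have n: "0 < n" using assms(8) by simp
    have A_nn: "ennreal \<kappa> * ennreal v = ennreal A"
      using kappa v_ge2 by (simp add: A_def ennreal_mult)
    have powr_A: "ennreal_powr (ennreal A) r = ennreal (A powr r)" for r
      using A_pos by simp
    let ?t1 = "C1 * sqrt 2 * p powr (1/2) * real n powr (1/2) * sqrt (asymp_var M Q \<pi> f)"
    let ?u2 = "p\<^sup>2 * log 2 (2 * p) * real n powr (1/4) * real \<tau> powr (3/4)"
    let ?u3 = "p\<^sup>2 * log 2 (2 * p) * real n powr (1 / p) * real \<tau>"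
    have nonneg: "0 \<le> ?t1" "0 \<le> 4 * D1" "0 \<le> 4 * D2" "0 \<le> ?u2" "0 \<le> ?u3"
      using C1_ge D1_ge D2_ge asymp_var_nonneg assms(5) by auto
    have "chain_moment M Q \<pi> \<pi> f n p = ennreal ((\<integral>\<omega>. \<bar>chain_sum \<pi> f n \<omega>\<bar> powr p \<partial>P) powr (1 / p))"
      using stationary_moment(1)[OF n] by (simp add: chain_moment_def nn_integral_eq_integral)
    also have "\<dots> \<le> ennreal (?t1 + 4 * D1 * A powr (2 / p) * ?u2 * F + 4 * D2 * A powr (1 / p) * ?u3 * F)"
      by (rule ennreal_leI[OF stationary_moment(2)[OF n]])
    also have "\<dots> = ennreal ?t1 + ennreal (4 * D1) * ennreal (A powr (2 / p)) * ennreal ?u2 * ennreal F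
        + ennreal (4 * D2) * ennreal (A powr (1 / p)) * ennreal ?u3 * ennreal F"
      using nonneg F0 by (simp only: ennreal_plus ennreal_mult mult_nonneg_nonneg add_nonneg_nonneg powr_ge_zero)
    finally have 1: "chain_moment M Q \<pi> \<pi> f n p \<le> ennreal ?t1 + ennreal (4 * D1) * ennreal (A powr (2 / p)) * ennreal ?u2 * ennreal F
        + ennreal (4 * D2) * ennreal (A powr (1 / p)) * ennreal ?u3 * ennreal F" .
    have 2: "chain_moment M Q \<xi> \<pi> f n p \<le> chain_moment M Q \<pi> \<pi> f n p
        + ennreal (32 / 15 * \<kappa> powr (1 / p)) * ennreal_powr ((\<integral>\<^sup>+ z. ennreal (V z) \<partial>\<xi>) + ennreal v) (1 / p)
          * ennreal (p * real \<tau>) * ennreal F"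
      if \<xi>: "\<xi> \<in> space (prob_algebra M)" for \<xi>
    proof -
      let ?x = "ennreal_powr ((\<integral>\<^sup>+ z. ennreal (V z) \<partial>\<xi>) + ennreal v) (1 / p)"
      have "ennreal (2 * F * p * real \<tau> * \<kappa> powr (1 / p)) \<le> ennreal (32 / 15 * \<kappa> powr (1 / p) * (p * real \<tau>) * F)"
      proof (rule ennreal_leI)
        \<comment> \<open>The comparison of starting points produces the factor 2, which lies below
          32/15.\<close>
        have "2 * (F * p * real \<tau> * \<kappa> powr (1 / p)) \<le> 32 / 15 * (F * p * real \<tau> * \<kappa> powr (1 / p))"
          using F0 p by (intro mult_right_mono) auto
        then show "2 * F * p * real \<tau> * \<kappa> powr (1 / p) \<le> 32 / 15 * \<kappa> powr (1 / p) * (p * real \<tau>) * F"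
          by (simp add: mult_ac)
      qed
      also have "\<dots> = ennreal (32 / 15 * \<kappa> powr (1 / p)) * ennreal (p * real \<tau>) * ennreal F"
      proof -
        have "ennreal (x * y * z) = ennreal x * ennreal y * ennreal z" if "0 \<le> x" "0 \<le> y" "0 \<le> z" for x y z
          using that by (simp add: ennreal_mult)
        then show ?thesis by this (use F0 p in auto)
      qed
      finally have "ennreal (2 * F * p * real \<tau> * \<kappa> powr (1 / p)) * ?x
          \<le> ennreal (32 / 15 * \<kappa> powr (1 / p)) * ennreal (p * real \<tau>) * ennreal F * ?x"
        by (rule mult_right_mono) simp
      also have "\<dots> = ennreal (32 / 15 * \<kappa> powr (1 / p)) * ?x * ennreal (p * real \<tau>) * ennreal F"
        by (simp only: mult_ac)
      finally show ?thesis
        using initial_moment[OF \<xi>, of n] by (meson add_left_mono order_trans)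
    qed
    show ?thesis
      unfolding norm v_nn A_nn powr_A using 1 2 by blast
  qed
qed

end
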